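(* Let $\{T_1(s)\}_{s\ge 0}$ and $\{T_2(s)\}_{s\ge 0}$ be two commuting continuous semigroups of contractions on a complex Hilbert space $H$. Then there exist a complex Hilbert space $K\supseteq H$ and two commuting continuous semigroups of isometries $\{V_1(s)\}_{s\ge 0}$ and $\{V_2(s)\}_{s\ge 0}$ on $K$ such that for all $s,t\ge 0$, $$T_1(s)T_2(t)=P_H V_1(s)V_2(t)\big|_H ,$$ where $P_H$ denotes the orthogonal projection of $K$ onto $H$. Moreover, $K$, $\{V_1(s)\}_{s\ge 0}$ and $\{V_2(s)\}_{s\ge 0}$ can be chosen to be minimal, in the sense that $$K=\bigvee_{s,t\ge 0}V_1(s)V_2(t)H .$$
   Context: A continuous semigroup on a Hilbert space is a family $\{T(s)\}_{s\ge 0}$ of bounded operators with $T(0)=I$, $T(s+t)=T(s)T(t)$ for all $s,t\ge0$, and $s\mapsto T(s)$ strongly continuous (for semigroups of contractions, weak continuity at $0$ amounts to the same). Two semigroups $\{T_1(s)\}$, $\{T_2(s)\}$ commute if $T_1(s)T_2(t)=T_2(t)T_1(s)$ for all $s,t\ge 0$. $K\supseteq H$ means that $H$ is a closed subspace of $K$ with the inherited inner product. $\bigvee$ denotes closed linear span. *)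

theory Defs
  imports "HOL-Analysis.Analysis" "HOL-Library.Function_Algebras"
begin

text \<open>
  Spaces are carrier-based, because the dilation space of the theorem is existentially
  quantified and HOL has no quantification over types. The vectors form a complex linear
  subspace of an ambient complex vector space (a type in class \<open>ab_group_add\<close> together with
  a scalar multiplication), from which they inherit addition and zero; taking the whole
  type as carrier is allowed. Operators are total functions on the ambient type of which
  only the values on the carrier matter.
\<close>

record 'a cspace =
  vectors :: "'a set"
  cscale :: "complex \<Rightarrow> 'a \<Rightarrow> 'a"
  cinner :: "'a \<Rightarrow> 'a \<Rightarrow> complex"

definition hnorm :: "'a cspace \<Rightarrow> 'a \<Rightarrow> real" where
  "hnorm X x = sqrt (Re (cinner X x x))"

text \<open>
  The value 0 off the carrier is a dummy: the locale \<open>Metric_space\<close> wants a symmetric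
  nonnegative function on the whole type.
\<close>
definition hdist :: "('a::ab_group_add) cspace \<Rightarrow> 'a \<Rightarrow> 'a \<Rightarrow> real" where
  "hdist X x y = (if x \<in> vectors X \<and> y \<in> vectors X then hnorm X (x - y) else 0)"

definition htopology :: "('a::ab_group_add) cspace \<Rightarrow> 'a topology" where
  "htopology X = Metric_space.mtopology (vectors X) (hdist X)"

locale complex_inner_space = vector_space "cscale X"
  for X :: "('a::ab_group_add) cspace" +
  assumes subspace_vectors: "subspace (vectors X)"
    and cinner_add_left: "\<lbrakk>x \<in> vectors X; y \<in> vectors X; z \<in> vectors X\<rbrakk>
          \<Longrightarrow> cinner X (x + y) z = cinner X x z + cinner X y z"
    and cinner_scale_left: "\<lbrakk>x \<in> vectors X; y \<in> vectors X\<rbrakk>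
          \<Longrightarrow> cinner X (cscale X c x) y = c * cinner X x y"
    and cinner_commute: "\<lbrakk>x \<in> vectors X; y \<in> vectors X\<rbrakk>
          \<Longrightarrow> cinner X y x = cnj (cinner X x y)"
    and cinner_pos: "\<lbrakk>x \<in> vectors X; x \<noteq> 0\<rbrakk> \<Longrightarrow> 0 < Re (cinner X x x)"

locale complex_hilbert_space = complex_inner_space +
  assumes complete: "Metric_space.mcomplete (vectors X) (hdist X)"

definition linear_between ::
  "('a::ab_group_add) cspace \<Rightarrow> ('b::ab_group_add) cspace \<Rightarrow> ('a \<Rightarrow> 'b) \<Rightarrow> bool" where
  "linear_between X Y A \<longleftrightarrow>
     A \<in> vectors X \<rightarrow> vectors Y \<and>
     (\<forall>x\<in>vectors X. \<forall>y\<in>vectors X. A (x + y) = A x + A y) \<and>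
     (\<forall>c. \<forall>x\<in>vectors X. A (cscale X c x) = cscale Y c (A x))"

definition bounded_operator :: "('a::ab_group_add) cspace \<Rightarrow> ('a \<Rightarrow> 'a) \<Rightarrow> bool" where
  "bounded_operator X A \<longleftrightarrow>
     linear_between X X A \<and> (\<exists>C. \<forall>x\<in>vectors X. hnorm X (A x) \<le> C * hnorm X x)"

definition contraction :: "('a::ab_group_add) cspace \<Rightarrow> ('a \<Rightarrow> 'a) \<Rightarrow> bool" where
  "contraction X A \<longleftrightarrow>
     bounded_operator X A \<and> (\<forall>x\<in>vectors X. hnorm X (A x) \<le> hnorm X x)"

definition isometry :: "('a::ab_group_add) cspace \<Rightarrow> ('a \<Rightarrow> 'a) \<Rightarrow> bool" where
  "isometry X A \<longleftrightarrow>
     bounded_operator X A \<and> (\<forall>x\<in>vectors X. hnorm X (A x) = hnorm X x)"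

text \<open>Semigroups are indexed by \<open>real\<close>; only the values at nonnegative parameters matter.\<close>
definition continuous_semigroup ::
  "('a::ab_group_add) cspace \<Rightarrow> (real \<Rightarrow> 'a \<Rightarrow> 'a) \<Rightarrow> bool" where
  "continuous_semigroup X T \<longleftrightarrow>
     (\<forall>s\<ge>0. bounded_operator X (T s)) \<and>
     (\<forall>x\<in>vectors X. T 0 x = x) \<and>
     (\<forall>s\<ge>0. \<forall>t\<ge>0. \<forall>x\<in>vectors X. T (s + t) x = T s (T t x)) \<and>
     (\<forall>x\<in>vectors X. continuous_map (top_of_set {0..}) (htopology X) (\<lambda>s. T s x))"

definition contraction_semigroup ::
  "('a::ab_group_add) cspace \<Rightarrow> (real \<Rightarrow> 'a \<Rightarrow> 'a) \<Rightarrow> bool" where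
  "contraction_semigroup X T \<longleftrightarrow>
     continuous_semigroup X T \<and> (\<forall>s\<ge>0. contraction X (T s))"

definition isometry_semigroup ::
  "('a::ab_group_add) cspace \<Rightarrow> (real \<Rightarrow> 'a \<Rightarrow> 'a) \<Rightarrow> bool" where
  "isometry_semigroup X T \<longleftrightarrow>
     continuous_semigroup X T \<and> (\<forall>s\<ge>0. isometry X (T s))"

definition commuting_semigroups ::
  "('a::ab_group_add) cspace \<Rightarrow> (real \<Rightarrow> 'a \<Rightarrow> 'a) \<Rightarrow> (real \<Rightarrow> 'a \<Rightarrow> 'a) \<Rightarrow> bool" where
  "commuting_semigroups X T\<^sub>1 T\<^sub>2 \<longleftrightarrow>
     (\<forall>s\<ge>0. \<forall>t\<ge>0. \<forall>x\<in>vectors X. T\<^sub>1 s (T\<^sub>2 t x) = T\<^sub>2 t (T\<^sub>1 s x))"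

text \<open>
  The inclusion of a Hilbert space \<open>X\<close> in a Hilbert space \<open>Y\<close>, with the inherited inner
  product, is given by an embedding \<open>J\<close> that identifies \<open>X\<close> with the subspace
  \<open>J ` vectors X\<close>. The latter is closed since \<open>X\<close> is complete.
\<close>
definition isometric_embedding ::
  "('a::ab_group_add) cspace \<Rightarrow> ('b::ab_group_add) cspace \<Rightarrow> ('a \<Rightarrow> 'b) \<Rightarrow> bool" where
  "isometric_embedding X Y J \<longleftrightarrow>
     linear_between X Y J \<and>
     (\<forall>x\<in>vectors X. \<forall>y\<in>vectors X. cinner Y (J x) (J y) = cinner X x y)"

text \<open>The point of \<open>M\<close> is unique; it exists when \<open>M\<close> is a closed subspace of a Hilbert space.\<close>
definition orthogonal_projection ::
  "('a::ab_group_add) cspace \<Rightarrow> 'a set \<Rightarrow> 'a \<Rightarrow> 'a" where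
  "orthogonal_projection X M x = (THE y. y \<in> M \<and> (\<forall>z\<in>M. cinner X (x - y) z = 0))"

definition closed_linear_span :: "('a::ab_group_add) cspace \<Rightarrow> 'a set \<Rightarrow> 'a set" where
  "closed_linear_span X S = htopology X closure_of (module.span (cscale X) S)"

text \<open>
  The type of candidates for a dilation space of a pair of one-parameter semigroups on a
  space with vectors of type \<open>'a\<close>. It is large enough for every minimal one: if the vectors
  \<open>V\<^sub>1 s (V\<^sub>2 t h)\<close> span a dense subspace, then mapping \<open>k\<close> to the function that takes
  \<open>(s, t, h)\<close> to the inner product of \<open>k\<close> with \<open>V\<^sub>1 s (V\<^sub>2 t h)\<close> is linear and injective.
\<close>
type_synonym 'a dilation_space = "(real \<times> real \<times> 'a \<Rightarrow> complex) cspace"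

context complex_inner_space
begin

lemma vectors_add: "x \<in> vectors X \<Longrightarrow> y \<in> vectors X \<Longrightarrow> x + y \<in> vectors X"
  and vectors_diff: "x \<in> vectors X \<Longrightarrow> y \<in> vectors X \<Longrightarrow> x - y \<in> vectors X"
  and vectors_scale: "x \<in> vectors X \<Longrightarrow> cscale X c x \<in> vectors X"
  and vectors_zero: "0 \<in> vectors X"
  using subspace_vectors subspace_add subspace_diff subspace_scale subspace_0 by blast+

lemma cinner_add_right:
  assumes "x \<in> vectors X" "y \<in> vectors X" "z \<in> vectors X"
  shows "cinner X z (x + y) = cinner X z x + cinner X z y"
  using assms by (metis cinner_add_left cinner_commute complex_cnj_add vectors_add)

lemma cinner_scale_right:
  assumes "x \<in> vectors X" "y \<in> vectors X"
  shows "cinner X x (cscale X c y) = cnj c * cinner X x y"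
  using assms by (metis cinner_commute cinner_scale_left complex_cnj_mult vectors_scale)

lemma cinner_zero_left: "y \<in> vectors X \<Longrightarrow> cinner X 0 y = 0"
  using cinner_scale_left[of 0 y 0] vectors_zero by simp

lemma cinner_diff_left:
  assumes "x \<in> vectors X" "y \<in> vectors X" "z \<in> vectors X"
  shows "cinner X (x - y) z = cinner X x z - cinner X y z"
  using cinner_add_left[of "x - y" y z] assms vectors_diff by simp

lemma cinner_self_nonneg: "x \<in> vectors X \<Longrightarrow> 0 \<le> Re (cinner X x x)"
  using cinner_pos[of x] cinner_zero_left[of 0] by (cases "x = 0") auto

lemma cinner_self_real: "x \<in> vectors X \<Longrightarrow> cinner X x x = of_real (Re (cinner X x x))"
  by (metis cinner_commute Reals_cnj_iff of_real_Re)

lemma hnorm_nonneg: "x \<in> vectors X \<Longrightarrow> 0 \<le> hnorm X x"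
  by (simp add: hnorm_def cinner_self_nonneg)

lemma hnorm_sq: "x \<in> vectors X \<Longrightarrow> (hnorm X x)\<^sup>2 = Re (cinner X x x)"
  by (simp add: hnorm_def cinner_self_nonneg)

lemma hnorm_eq_0: "x \<in> vectors X \<Longrightarrow> hnorm X x = 0 \<longleftrightarrow> x = 0"
  using cinner_pos[of x] cinner_zero_left[of 0] vectors_zero by (cases "x = 0") (auto simp: hnorm_def)

lemma hnorm_scale: "x \<in> vectors X \<Longrightarrow> hnorm X (cscale X c x) = cmod c * hnorm X x"
proof -
  assume x: "x \<in> vectors X"
  have "cinner X (cscale X c x) (cscale X c x) = (c * cnj c) * cinner X x x"
    using x by (simp add: cinner_scale_left cinner_scale_right vectors_scale)
  also have "\<dots> = of_real ((cmod c)\<^sup>2 * Re (cinner X x x))"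
    by (subst cinner_self_real[OF x]) (simp only: complex_norm_square of_real_mult)
  finally show ?thesis
    by (simp add: hnorm_def real_sqrt_mult del: of_real_mult of_real_power)
qed

lemma Cauchy_Schwarz:
  assumes x: "x \<in> vectors X" and y: "y \<in> vectors X"
  shows "cmod (cinner X x y) \<le> hnorm X x * hnorm X y"
proof (cases "y = 0")
  case True
  then show ?thesis
    using cinner_commute[OF vectors_zero x] cinner_zero_left[OF x] x y
    by (simp add: hnorm_nonneg)
next
  case False
  define n where "n = Re (cinner X y y)"
  define a where "a = cinner X x y"
  have n: "n > 0" "cinner X y y = of_real n"
    using cinner_pos[OF y False] cinner_self_real[OF y] unfolding n_def by blast+
  let ?c = "a / of_real n"
  let ?z = "x - cscale X ?c y"
  have z: "?z \<in> vectors X" and cy: "cscale X ?c y \<in> vectors X"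
    using x y by (auto intro: vectors_diff vectors_scale)
  have "cinner X ?z y = 0"
    using x y n cy by (simp add: cinner_diff_left cinner_scale_left a_def)
  then have yz: "cinner X y ?z = 0"
    using cinner_commute[OF z y] by simp
  have "cinner X ?z ?z = cinner X x ?z"
    using x y z cy by (simp add: cinner_diff_left cinner_scale_left yz)
  also have "\<dots> = cnj (cinner X ?z x)"
    using cinner_commute[OF z x] by simp
  also have "\<dots> = cnj (cinner X x x) - cnj ?c * a"
    using x y cy cinner_commute[OF y x]
    by (simp add: cinner_diff_left cinner_scale_left a_def)
  also have "cnj ?c * a = (a * cnj a) / of_real n"
    by simp
  also have "\<dots> = of_real ((cmod a)\<^sup>2 / n)"
    by (simp only: complex_norm_square of_real_divide)
  finally have "Re (cinner X ?z ?z) = Re (cinner X x x) - (cmod a)\<^sup>2 / n"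
    by simp
  with cinner_self_nonneg[OF z] have "(cmod a)\<^sup>2 / n \<le> Re (cinner X x x)"
    by simp
  then have "(cmod a)\<^sup>2 \<le> (hnorm X x * hnorm X y)\<^sup>2"
    using n(1) x y by (simp add: power_mult_distrib hnorm_sq n_def divide_le_eq)
  then show ?thesis
    unfolding a_def
    by (rule power2_le_imp_le) (simp add: hnorm_nonneg x y)
qed

lemma hnorm_triangle:
  assumes x: "x \<in> vectors X" and y: "y \<in> vectors X"
  shows "hnorm X (x + y) \<le> hnorm X x + hnorm X y"
proof (rule power2_le_imp_le)
  have "(hnorm X (x + y))\<^sup>2 =
      Re (cinner X x x) + Re (cinner X y y) + (Re (cinner X x y) + Re (cinner X y x))"
    using x y by (simp add: hnorm_sq vectors_add cinner_add_left cinner_add_right)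
  also have "\<dots> = (hnorm X x)\<^sup>2 + (hnorm X y)\<^sup>2 + 2 * Re (cinner X x y)"
    using x y cinner_commute[OF x y] by (simp add: hnorm_sq)
  also have "\<dots> \<le> (hnorm X x)\<^sup>2 + (hnorm X y)\<^sup>2 + 2 * (hnorm X x * hnorm X y)"
    using Cauchy_Schwarz[OF x y] complex_Re_le_cmod[of "cinner X x y"] by linarith
  also have "\<dots> = (hnorm X x + hnorm X y)\<^sup>2"
    by (simp add: power2_sum)
  finally show "(hnorm X (x + y))\<^sup>2 \<le> (hnorm X x + hnorm X y)\<^sup>2" .
qed (simp add: hnorm_nonneg x y)

lemma hnorm_minus_commute:
  assumes "x \<in> vectors X" "y \<in> vectors X"
  shows "hnorm X (x - y) = hnorm X (y - x)"
proof -
  have "cscale X (- 1) (y - x) = x - y"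
    by (simp add: scale_minus_left)
  then show ?thesis
    using hnorm_scale[of "y - x" "- 1"] vectors_diff[of y x] assms by simp
qed

sublocale Metric_space "vectors X" "hdist X"
proof
  fix x y z
  show "0 \<le> hdist X x y"
    by (simp add: hdist_def hnorm_nonneg vectors_diff)
  show "hdist X x y = hdist X y x"
    by (simp add: hdist_def hnorm_minus_commute)
  show "hdist X x y = 0 \<longleftrightarrow> x = y" if "x \<in> vectors X" "y \<in> vectors X"
    using that by (simp add: hdist_def hnorm_eq_0 vectors_diff)
  show "hdist X x z \<le> hdist X x y + hdist X y z"
    if "x \<in> vectors X" "y \<in> vectors X" "z \<in> vectors X"
    using that hnorm_triangle[of "x - y" "y - z"] by (simp add: hdist_def vectors_diff)
qed

lemma orthogonal_projection_eqI:
  assumes M: "subspace M" "M \<subseteq> vectors X" and x: "x \<in> vectors X"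
    and y: "y \<in> M" "\<forall>z\<in>M. cinner X (x - y) z = 0"
  shows "orthogonal_projection X M x = y"
  unfolding orthogonal_projection_def
proof (rule the_equality)
  fix w assume w: "w \<in> M \<and> (\<forall>z\<in>M. cinner X (x - w) z = 0)"
  have d: "w - y \<in> M"
    using M(1) w y subspace_diff by blast
  have v: "w - y \<in> vectors X" "x - y \<in> vectors X" "x - w \<in> vectors X"
    using M x w y d by (auto intro: vectors_diff)
  have "cinner X (w - y) (w - y) = cinner X (x - y) (w - y) - cinner X (x - w) (w - y)"
    using cinner_diff_left[OF v(2,3,1)] by simp
  then have "cinner X (w - y) (w - y) = 0"
    using w y d by simp
  then show "w = y"
    using cinner_pos[OF v(1)] by auto
qed (use y in blast)

end

end

theory Submission
  imports Defs
begin

text \<open>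
  Write \<open>U (s, t) = T\<^sub>1 s T\<^sub>2 t\<close>. A dilation amounts to a positive semidefinite kernel on
  pairs (point of the plane, vector of \<open>H\<close>), with prescribed value \<open>\<langle>U (z - l) h, h'\<rangle>\<close> at
  \<open>(z, h)\<close>, \<open>(l, h')\<close> whenever \<open>l \<le> z\<close>, that is invariant under translations of the plane;
  its values at incomparable points are free. Two kernels that agree on the overlap of their
  index sets can be amalgamated, by Schur complements and compactness, which allows one to
  build the kernel on a finite grid point by point; only points comparable with the new one
  matter, and there positivity follows from contractivity and the semigroup law. Compactness
  (Tychonoff) gives a kernel on the whole plane, averaging over translates and again
  compactness make it invariant. The translations act by commuting isometries on the Hilbert
  space of the kernel over the closed first quadrant, and they are strongly continuous since
  \<open>\<parallel>V\<^sub>i s x - x\<parallel>\<^sup>2 = 2 \<parallel>h\<parallel>\<^sup>2 - 2 Re \<langle>T\<^sub>i s h, h\<rangle>\<close> for each generator \<open>x\<close> with vector \<open>h\<close>.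
\<close>

section \<open>The Hilbert space of a positive semidefinite kernel\<close>

text \<open>The two requirements on a kernel, positivity and the prescribed values at comparable
  points, are convex, pass to pointwise limits and are unaffected by translations, since the values
  depend on \<open>z - l\<close> only. The diagonal is prescribed too, so Cauchy-Schwarz bounds all
  other values and cluster points exist. Hence finite grids suffice, and averages of translates
  remain admissible. The delicate point is the insertion of one point \<open>p\<close>. Values
  chosen earlier between points above \<open>p\<close> may be incompatible with \<open>p\<close>:
  the vectors over these points must leave a positive remainder when their components over
  \<open>p\<close> are subtracted. If the points above \<open>p\<close> have a least element
  \<open>q\<close>, the component over \<open>p\<close> factors through the one over
  \<open>q\<close>, and contractivity of \<open>U (q - p)\<close> gives positivity. So the order in
  which a grid is filled matters. The dilation space has to consist of functions on index triples.
  The vectors of a kernel space are such functions, and its completion can be made of pointwise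
  limits, with no quotient of Cauchy sequences. Minimality is then the density of the kernel
  vectors.\<close>

definition lincomb :: "('a::ab_group_add) cspace \<Rightarrow> ('i \<Rightarrow> 'a) \<Rightarrow> (complex \<times> 'i) list \<Rightarrow> 'a" where
  "lincomb X e xs = (\<Sum>(c, x)\<leftarrow>xs. cscale X c (e x))"

text \<open>The sesquilinear form of a kernel on formal linear combinations. These are lists in
  which indices may repeat: concatenation is addition and scaling the coefficients is scaling,
  without any merging of equal indices.\<close>

definition kform ::
  "('i \<Rightarrow> 'j \<Rightarrow> complex) \<Rightarrow> (complex \<times> 'i) list \<Rightarrow> (complex \<times> 'j) list \<Rightarrow> complex" where
  "kform k xs ys = (\<Sum>(c, x)\<leftarrow>xs. \<Sum>(d, y)\<leftarrow>ys. c * cnj d * k x y)"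

text \<open>The inequality constrains only the real part of the quadratic form, so hermitian
  symmetry is a separate clause; it makes the form real.\<close>

definition psd_kernel :: "'i set \<Rightarrow> ('i \<Rightarrow> 'i \<Rightarrow> complex) \<Rightarrow> bool" where
  "psd_kernel I k \<longleftrightarrow>
     (\<forall>x\<in>I. \<forall>y\<in>I. k y x = cnj (k x y)) \<and>
     (\<forall>xs. snd ` set xs \<subseteq> I \<longrightarrow> 0 \<le> Re (kform k xs xs))"

lemma lincomb_simps [simp]:
  "lincomb X e [] = 0"
  "lincomb X e (p # xs) = cscale X (fst p) (e (snd p)) + lincomb X e xs"
  "lincomb X e (xs @ ys) = lincomb X e xs + lincomb X e ys"
  by (simp_all add: lincomb_def case_prod_unfold)

lemma lincomb_cong: "(\<And>x. x \<in> snd ` set xs \<Longrightarrow> e x = f x) \<Longrightarrow> lincomb X e xs = lincomb X f xs"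
  by (induction xs) auto

lemma kform_Nil [simp]: "kform k [] ys = 0" "kform k xs [] = 0"
  by (simp_all add: kform_def case_prod_unfold)

lemma kform_eq_left: "kform k xs ys = (\<Sum>(c, x)\<leftarrow>xs. c * (\<Sum>(d, y)\<leftarrow>ys. cnj d * k x y))"
  by (simp add: kform_def case_prod_unfold sum_list_const_mult mult.assoc)

lemma kform_swap: "kform k xs ys = (\<Sum>(d, y)\<leftarrow>ys. \<Sum>(c, x)\<leftarrow>xs. c * cnj d * k x y)"
proof (induction xs)
  case (Cons p xs)
  then show ?case
    by (simp add: kform_def case_prod_unfold sum_list_addf)
qed (simp add: kform_def case_prod_unfold)

lemma kform_eq_right: "kform k xs ys = (\<Sum>(d, y)\<leftarrow>ys. cnj d * (\<Sum>(c, x)\<leftarrow>xs. c * k x y))"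
  unfolding kform_swap by (simp add: case_prod_unfold sum_list_const_mult[symmetric] mult_ac)

lemma kform_scale_left: "kform k (map (apfst ((*) c)) xs) ys = c * kform k xs ys"
  by (simp add: kform_eq_left o_def case_prod_unfold sum_list_const_mult mult.assoc)

lemma kform_append:
  "kform k (xs @ xs') ys = kform k xs ys + kform k xs' ys"
  "kform k xs (ys @ ys') = kform k xs ys + kform k xs ys'"
  by (simp_all add: kform_def case_prod_unfold sum_list_addf)

lemma kform_diff: "kform (\<lambda>x y. k x y - l x y) xs ys = kform k xs ys - kform l xs ys"
  by (simp add: kform_def case_prod_unfold right_diff_distrib sum_list_subtractf)

lemma kform_cong:
  assumes "\<And>x y. x \<in> snd ` set xs \<Longrightarrow> y \<in> snd ` set ys \<Longrightarrow> k x y = l x y"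
  shows "kform k xs ys = kform l xs ys"
  unfolding kform_def case_prod_unfold
  by (intro arg_cong[of _ _ sum_list] map_cong refl) (use assms in force)

lemma cnj_sum_list: "cnj (sum_list xs) = sum_list (map cnj xs)"
  by (induction xs) auto

lemma kform_commute:
  assumes "\<And>x y. x \<in> snd ` set xs \<Longrightarrow> y \<in> snd ` set ys \<Longrightarrow> k y x = cnj (k x y)"
  shows "kform k ys xs = cnj (kform k xs ys)"
proof -
  have "cnj (kform k xs ys) = kform (\<lambda>y x. cnj (k x y)) ys xs"
    unfolding kform_swap[of k] by (simp add: kform_def cnj_sum_list case_prod_unfold o_def mult_ac)
  then show ?thesis
    using assms by (auto intro: kform_cong)
qed

lemma psd_kernelI:
  assumes "\<And>x y. x \<in> I \<Longrightarrow> y \<in> I \<Longrightarrow> k y x = cnj (k x y)"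
    and "\<And>xs. snd ` set xs \<subseteq> I \<Longrightarrow> 0 \<le> Re (kform k xs xs)"
  shows "psd_kernel I k"
  using assms unfolding psd_kernel_def by blast

lemma psd_kernelD:
  assumes "psd_kernel I k"
  shows "x \<in> I \<Longrightarrow> y \<in> I \<Longrightarrow> k y x = cnj (k x y)"
    and "snd ` set xs \<subseteq> I \<Longrightarrow> 0 \<le> Re (kform k xs xs)"
  using assms unfolding psd_kernel_def by blast+

context complex_inner_space
begin

lemma vectors_lincomb:
  "(\<And>x. x \<in> snd ` set xs \<Longrightarrow> e x \<in> vectors X) \<Longrightarrow> lincomb X e xs \<in> vectors X"
  by (induction xs) (auto simp: vectors_zero intro: vectors_add vectors_scale)

lemma cinner_zero_right: "y \<in> vectors X \<Longrightarrow> cinner X y 0 = 0"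
  using cinner_commute[OF vectors_zero, of y] cinner_zero_left[of y] by simp

lemma cinner_diff_right:
  assumes "x \<in> vectors X" "y \<in> vectors X" "z \<in> vectors X"
  shows "cinner X z (x - y) = cinner X z x - cinner X z y"
  using cinner_add_right[of "x - y" y z] assms vectors_diff by simp

lemma cinner_lincomb_right:
  assumes "\<And>y. y \<in> snd ` set ys \<Longrightarrow> f y \<in> vectors X" "x \<in> vectors X"
  shows "cinner X x (lincomb X f ys) = (\<Sum>(d, y)\<leftarrow>ys. cnj d * cinner X x (f y))"
  using assms(1)
proof (induction ys)
  case (Cons p ys)
  then show ?case using assms(2)
    by (auto simp: cinner_add_right cinner_scale_right vectors_scale vectors_lincomb case_prod_unfold)
qed (simp add: cinner_zero_right assms)

lemma cinner_lincomb_left: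
  assumes "\<And>x. x \<in> snd ` set xs \<Longrightarrow> e x \<in> vectors X" "y \<in> vectors X"
  shows "cinner X (lincomb X e xs) y = (\<Sum>(c, x)\<leftarrow>xs. c * cinner X (e x) y)"
  using assms(1)
proof (induction xs)
  case (Cons p xs)
  then show ?case using assms(2)
    by (auto simp: cinner_add_left cinner_scale_left vectors_scale vectors_lincomb case_prod_unfold)
qed (simp add: cinner_zero_left assms)

lemma cinner_lincomb:
  assumes "\<And>x. x \<in> snd ` set xs \<Longrightarrow> e x \<in> vectors X" "\<And>y. y \<in> snd ` set ys \<Longrightarrow> f y \<in> vectors X"
  shows "cinner X (lincomb X e xs) (lincomb X f ys) = kform (\<lambda>x y. cinner X (e x) (f y)) xs ys"
proof -
  have "cinner X (lincomb X e xs) (lincomb X f ys)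
      = (\<Sum>(c, x)\<leftarrow>xs. c * cinner X (e x) (lincomb X f ys))"
    using assms by (intro cinner_lincomb_left vectors_lincomb)
  also have "\<dots> = (\<Sum>(c, x)\<leftarrow>xs. c * (\<Sum>(d, y)\<leftarrow>ys. cnj d * cinner X (e x) (f y)))"
    unfolding case_prod_unfold
    by (intro arg_cong[of _ _ sum_list] map_cong refl arg_cong2[of _ _ _ _ "(*)"]
        cinner_lincomb_right[unfolded case_prod_unfold]) (use assms in auto)
  finally show ?thesis by (simp add: kform_eq_left)
qed

lemma hnorm_zero [simp]: "hnorm X 0 = 0"
  by (simp add: hnorm_eq_0 vectors_zero)

lemma hnorm_diff_triangle:
  assumes "x \<in> vectors X" "y \<in> vectors X" "z \<in> vectors X"
  shows "hnorm X (x - z) \<le> hnorm X (x - y) + hnorm X (y - z)"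
  using hnorm_triangle[of "x - y" "y - z"] assms by (simp add: vectors_diff)

lemma hnorm_diff_ineq:
  assumes "x \<in> vectors X" "y \<in> vectors X"
  shows "\<bar>hnorm X x - hnorm X y\<bar> \<le> hnorm X (x - y)"
  using hnorm_triangle[of "x - y" y] hnorm_triangle[of "y - x" x] hnorm_minus_commute[of x y] assms
  by (simp add: vectors_diff)

lemma hnorm_diff_sq:
  assumes "x \<in> vectors X" "y \<in> vectors X"
  shows "(hnorm X (x - y))\<^sup>2 = (hnorm X x)\<^sup>2 + (hnorm X y)\<^sup>2 - 2 * Re (cinner X x y)"
  using assms cinner_commute[of x y]
  by (simp add: hnorm_sq vectors_diff cinner_diff_left cinner_diff_right)

lemma eq_if_hnorm_diff_small:
  assumes "x \<in> vectors X" "y \<in> vectors X" "\<And>\<epsilon>. \<epsilon> > 0 \<Longrightarrow> hnorm X (x - y) \<le> \<epsilon>"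
  shows "x = y"
proof -
  have "hnorm X (x - y) \<le> 0"
    using assms(3) by (rule field_le_epsilon[of _ 0, simplified])
  then show ?thesis
    using assms hnorm_nonneg[of "x - y"] hnorm_eq_0[of "x - y"] by (simp add: vectors_diff)
qed

lemma MCauchy_hnorm_iff:
  "MCauchy \<sigma> \<longleftrightarrow> (\<forall>n. \<sigma> n \<in> vectors X) \<and>
     (\<forall>\<epsilon>>0. \<exists>N. \<forall>m n. N \<le> m \<longrightarrow> N \<le> n \<longrightarrow> hnorm X (\<sigma> m - \<sigma> n) < \<epsilon>)"
  unfolding MCauchy_def by (auto simp: hdist_def image_subset_iff)

lemma limitin_hnorm_iff:
  assumes "\<And>n. \<sigma> n \<in> vectors X"
  shows "limitin mtopology \<sigma> x sequentially \<longleftrightarrow>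
     x \<in> vectors X \<and> (\<lambda>n. hnorm X (\<sigma> n - x)) \<longlonglongrightarrow> 0"
  unfolding limitin_metric tendsto_iff
  using assms by (auto simp: hdist_def hnorm_nonneg vectors_diff)

lemma psd_kernel_gram:
  assumes "\<And>x. x \<in> I \<Longrightarrow> e x \<in> vectors X"
  shows "psd_kernel I (\<lambda>x y. cinner X (e x) (e y))"
  unfolding psd_kernel_def
proof (intro conjI ballI allI impI)
  show "0 \<le> Re (kform (\<lambda>x y. cinner X (e x) (e y)) xs xs)" if "snd ` set xs \<subseteq> I" for xs
    using cinner_lincomb[of xs e xs e] that assms
    by (metis cinner_self_nonneg subsetD vectors_lincomb)
qed (use assms cinner_commute in blast)

end

section \<open>Completion of a space of functions with continuous point evaluations\<close>

lemma tendsto_sum_list: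
  fixes f :: "'c \<Rightarrow> 'n \<Rightarrow> 'b::topological_monoid_add"
  assumes "\<And>x. x \<in> set xs \<Longrightarrow> (f x \<longlongrightarrow> g x) F"
  shows "((\<lambda>n. \<Sum>x\<leftarrow>xs. f x n) \<longlongrightarrow> (\<Sum>x\<leftarrow>xs. g x)) F"
  using assms by (induction xs) (auto intro!: tendsto_intros)

lemma vector_space_fun: "vector_space (\<lambda>c (f :: 'i \<Rightarrow> complex) x. c * f x)"
  by standard (auto simp: algebra_simps)

text \<open>Evaluation at \<open>x\<close> is the inner product with \<open>e x\<close>, so a Cauchy
  sequence in \<open>W\<close> converges pointwise, and its pointwise limit can stand for its class
  in the completion. Finite spanning by the \<open>e x\<close> ensures that different classes have
  different limits. The completion thus stays inside the type of functions on the indices.\<close>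

locale reproducing_space = complex_inner_space W
  for W :: "('i \<Rightarrow> complex) cspace" +
  fixes I :: "'i set" and e :: "'i \<Rightarrow> 'i \<Rightarrow> complex"
  assumes cscale_eq: "cscale W = (\<lambda>c f x. c * f x)"
    and e_vectors: "x \<in> I \<Longrightarrow> e x \<in> vectors W"
    and reproducing: "f \<in> vectors W \<Longrightarrow> x \<in> I \<Longrightarrow> f x = cinner W f (e x)"
    and outside: "f \<in> vectors W \<Longrightarrow> x \<notin> I \<Longrightarrow> f x = 0"
    and spanned: "f \<in> vectors W \<Longrightarrow> \<exists>xs. snd ` set xs \<subseteq> I \<and> f = lincomb W e xs"
begin

definition represents :: "(nat \<Rightarrow> 'i \<Rightarrow> complex) \<Rightarrow> ('i \<Rightarrow> complex) \<Rightarrow> bool" where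
  "represents \<sigma> f \<longleftrightarrow> MCauchy \<sigma> \<and> (\<forall>x. (\<lambda>n. \<sigma> n x) \<longlonglongrightarrow> f x)"

lemma represents_vectors: "represents \<sigma> f \<Longrightarrow> \<sigma> n \<in> vectors W"
  by (auto simp: represents_def MCauchy_hnorm_iff)

lemma represents_const: "w \<in> vectors W \<Longrightarrow> represents (\<lambda>n. w) w"
  by (auto simp: represents_def MCauchy_hnorm_iff)

lemma represents_add:
  assumes "represents \<sigma> f" "represents \<tau> g"
  shows "represents (\<lambda>n. \<sigma> n + \<tau> n) (f + g)"
  unfolding represents_def MCauchy_hnorm_iff
proof (intro conjI allI impI)
  note v = assms[THEN represents_vectors]
  show "\<sigma> n + \<tau> n \<in> vectors W" for n
    by (intro vectors_add v)
  fix \<epsilon> :: real assume "\<epsilon> > 0"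
  then obtain M N where MN: "\<And>m n. M \<le> m \<Longrightarrow> M \<le> n \<Longrightarrow> hnorm W (\<sigma> m - \<sigma> n) < \<epsilon> / 2"
      "\<And>m n. N \<le> m \<Longrightarrow> N \<le> n \<Longrightarrow> hnorm W (\<tau> m - \<tau> n) < \<epsilon> / 2"
    using assms unfolding represents_def MCauchy_hnorm_iff by (meson half_gt_zero)
  have "hnorm W (\<sigma> m + \<tau> m - (\<sigma> n + \<tau> n)) < \<epsilon>" if "max M N \<le> m" "max M N \<le> n" for m n
    using MN(1)[of m n] MN(2)[of m n] that
      hnorm_triangle[of "\<sigma> m - \<sigma> n" "\<tau> m - \<tau> n"] v
    by (simp add: vectors_diff algebra_simps)
  then show "\<exists>N. \<forall>m n. N \<le> m \<longrightarrow> N \<le> n \<longrightarrow> hnorm W (\<sigma> m + \<tau> m - (\<sigma> n + \<tau> n)) < \<epsilon>"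
    by blast
qed (use assms in \<open>auto simp: represents_def intro!: tendsto_intros\<close>)

lemma represents_scale:
  assumes "represents \<sigma> f"
  shows "represents (\<lambda>n. cscale W c (\<sigma> n)) (cscale W c f)"
  unfolding represents_def MCauchy_hnorm_iff
proof (intro conjI allI impI)
  note v = assms[THEN represents_vectors]
  show "cscale W c (\<sigma> n) \<in> vectors W" for n
    by (intro vectors_scale v)
  fix \<epsilon> :: real assume e: "\<epsilon> > 0"
  then have "\<epsilon> / (cmod c + 1) > 0"
    by (simp add: add_nonneg_pos)
  then obtain N where N: "\<And>m n. N \<le> m \<Longrightarrow> N \<le> n \<Longrightarrow> hnorm W (\<sigma> m - \<sigma> n) < \<epsilon> / (cmod c + 1)"
    using assms unfolding represents_def MCauchy_hnorm_iff by meson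
  have "hnorm W (cscale W c (\<sigma> m) - cscale W c (\<sigma> n)) < \<epsilon>" if "N \<le> m" "N \<le> n" for m n
  proof -
    have "hnorm W (cscale W c (\<sigma> m) - cscale W c (\<sigma> n)) = cmod c * hnorm W (\<sigma> m - \<sigma> n)"
      using v by (simp add: hnorm_scale vectors_diff flip: scale_right_diff_distrib)
    also have "\<dots> \<le> (cmod c + 1) * hnorm W (\<sigma> m - \<sigma> n)"
      using v by (intro mult_right_mono) (auto simp: hnorm_nonneg vectors_diff)
    also have "\<dots> < \<epsilon>"
      using N[OF that] by (simp add: pos_less_divide_eq add_nonneg_pos mult.commute)
    finally show ?thesis .
  qed
  then show "\<exists>N. \<forall>m n. N \<le> m \<longrightarrow> N \<le> n \<longrightarrow> hnorm W (cscale W c (\<sigma> m) - cscale W c (\<sigma> n)) < \<epsilon>"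
    by blast
qed (use assms in \<open>auto simp: represents_def cscale_eq intro!: tendsto_intros\<close>)

lemma represents_diff:
  assumes "represents \<sigma> f" "represents \<tau> g"
  shows "represents (\<lambda>n. \<sigma> n - \<tau> n) (f - g)"
  using represents_add[OF assms(1) represents_scale[OF assms(2), of "-1"]]
  by (simp add: scale_minus_left)

lemma represents_bounded:
  assumes "represents \<sigma> f"
  shows "\<exists>B>0. \<forall>n. hnorm W (\<sigma> n) \<le> B"
proof -
  note v = assms[THEN represents_vectors]
  obtain N where N: "\<And>m n. N \<le> m \<Longrightarrow> N \<le> n \<Longrightarrow> hnorm W (\<sigma> m - \<sigma> n) < 1"
    using assms unfolding represents_def MCauchy_hnorm_iff by (meson zero_less_one)
  define B where "B = 1 + (\<Sum>n\<le>N. hnorm W (\<sigma> n))"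
  have le: "hnorm W (\<sigma> n) \<le> (\<Sum>n\<le>N. hnorm W (\<sigma> n))" if "n \<le> N" for n
    using that v by (intro member_le_sum) (auto simp: hnorm_nonneg)
  have "hnorm W (\<sigma> n) \<le> B" for n
  proof (cases "n \<le> N")
    case False
    then show ?thesis
      using N[of n N] le[of N] hnorm_diff_ineq[OF v v, of n N] by (simp add: B_def)
  qed (use le[of n] in \<open>simp add: B_def\<close>)
  moreover have "B > 0"
    unfolding B_def using v by (intro add_pos_nonneg sum_nonneg) (auto simp: hnorm_nonneg)
  ultimately show ?thesis by blast
qed

lemma convergent_cinner:
  assumes "represents \<sigma> f" "represents \<tau> g"
  shows "convergent (\<lambda>n. cinner W (\<sigma> n) (\<tau> n))"
proof -
  note v = assms[THEN represents_vectors]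
  obtain A B where A: "A > 0" "\<And>n. hnorm W (\<sigma> n) \<le> A" and B: "B > 0" "\<And>n. hnorm W (\<tau> n) \<le> B"
    using assms[THEN represents_bounded] by blast
  have "Cauchy (\<lambda>n. cinner W (\<sigma> n) (\<tau> n))"
    unfolding Cauchy_def dist_norm
  proof (intro allI impI)
    fix \<epsilon> :: real assume e: "\<epsilon> > 0"
    then have "\<epsilon> / (2 * B) > 0" "\<epsilon> / (2 * A) > 0"
      using A(1) B(1) by simp_all
    then obtain M N where M: "\<And>m n. M \<le> m \<Longrightarrow> M \<le> n \<Longrightarrow> hnorm W (\<sigma> m - \<sigma> n) < \<epsilon> / (2 * B)"
      and N: "\<And>m n. N \<le> m \<Longrightarrow> N \<le> n \<Longrightarrow> hnorm W (\<tau> m - \<tau> n) < \<epsilon> / (2 * A)"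
      using assms unfolding represents_def MCauchy_hnorm_iff by meson
    have "cmod (cinner W (\<sigma> m) (\<tau> m) - cinner W (\<sigma> n) (\<tau> n)) < \<epsilon>"
      if mn: "max M N \<le> m" "max M N \<le> n" for m n
    proof -
      have "cinner W (\<sigma> m) (\<tau> m) - cinner W (\<sigma> n) (\<tau> n)
          = cinner W (\<sigma> m - \<sigma> n) (\<tau> m) + cinner W (\<sigma> n) (\<tau> m - \<tau> n)"
        using v by (simp add: cinner_diff_left cinner_diff_right)
      also have "cmod \<dots> \<le> hnorm W (\<sigma> m - \<sigma> n) * hnorm W (\<tau> m) + hnorm W (\<sigma> n) * hnorm W (\<tau> m - \<tau> n)"
        using v by (intro order_trans[OF norm_triangle_ineq] add_mono Cauchy_Schwarz) (auto intro: vectors_diff)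
      also have "\<dots> \<le> hnorm W (\<sigma> m - \<sigma> n) * B + A * hnorm W (\<tau> m - \<tau> n)"
        using v A B by (intro add_mono mult_left_mono mult_right_mono) (auto simp: hnorm_nonneg vectors_diff)
      also have "\<dots> < \<epsilon> / (2 * B) * B + A * (\<epsilon> / (2 * A))"
        using M[of m n] N[of m n] mn A(1) B(1)
        by (intro add_strict_mono mult_strict_right_mono mult_strict_left_mono) auto
      also have "\<dots> = \<epsilon>"
        using A(1) B(1) by (simp add: field_simps)
      finally show ?thesis .
    qed
    then show "\<exists>M. \<forall>m\<ge>M. \<forall>n\<ge>M. cmod (cinner W (\<sigma> m) (\<tau> m) - cinner W (\<sigma> n) (\<tau> n)) < \<epsilon>"
      by blast
  qed
  then show ?thesis
    by (rule Cauchy_convergent)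
qed

lemma tendsto_cinner_vector:
  assumes "represents \<sigma> f" "snd ` set xs \<subseteq> I"
  shows "(\<lambda>n. cinner W (\<sigma> n) (lincomb W e xs)) \<longlonglongrightarrow> (\<Sum>(d, y)\<leftarrow>xs. cnj d * f y)"
proof -
  have "cinner W (\<sigma> n) (lincomb W e xs) = (\<Sum>(d, y)\<leftarrow>xs. cnj d * \<sigma> n y)" for n
  proof -
    have "cinner W (\<sigma> n) (lincomb W e xs) = (\<Sum>(d, y)\<leftarrow>xs. cnj d * cinner W (\<sigma> n) (e y))"
      using assms represents_vectors[OF assms(1)] by (intro cinner_lincomb_right) (auto intro: e_vectors)
    also have "\<dots> = (\<Sum>(d, y)\<leftarrow>xs. cnj d * \<sigma> n y)"
      unfolding case_prod_unfold using assms(2) represents_vectors[OF assms(1)]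
      by (intro arg_cong[of _ _ sum_list] map_cong refl) (auto simp: reproducing)
    finally show ?thesis .
  qed
  then show ?thesis
    using assms(1) unfolding represents_def
    by (auto simp: case_prod_unfold intro!: tendsto_sum_list tendsto_intros)
qed

text \<open>
  Pointwise convergence to 0 gives weak convergence to 0, because \<open>W\<close> is spanned by the
  vectors \<open>e x\<close>; together with the Cauchy property this gives norm convergence.
\<close>
lemma represents_zero_tendsto:
  assumes "represents \<sigma> 0"
  shows "(\<lambda>n. hnorm W (\<sigma> n)) \<longlonglongrightarrow> 0"
proof (rule LIMSEQ_I)
  note v = assms[THEN represents_vectors]
  obtain B where B: "B > 0" "\<And>n. hnorm W (\<sigma> n) \<le> B"
    using represents_bounded[OF assms] by blast
  fix r :: real assume r: "r > 0"
  then have "r\<^sup>2 / (2 * B) > 0" using B by simp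
  then obtain N where N: "\<And>m n. N \<le> m \<Longrightarrow> N \<le> n \<Longrightarrow> hnorm W (\<sigma> m - \<sigma> n) < r\<^sup>2 / (2 * B)"
    using assms unfolding represents_def MCauchy_hnorm_iff by meson
  obtain xs where xs: "snd ` set xs \<subseteq> I" "\<sigma> N = lincomb W e xs"
    using spanned v by blast
  have "(\<lambda>n. cinner W (\<sigma> n) (\<sigma> N)) \<longlonglongrightarrow> 0"
    using tendsto_cinner_vector[OF assms xs(1)] xs(2) by (simp add: case_prod_unfold)
  then obtain M where M: "\<And>n. M \<le> n \<Longrightarrow> cmod (cinner W (\<sigma> n) (\<sigma> N)) < r\<^sup>2 / 2"
    using r by (metis LIMSEQ_D diff_zero half_gt_zero zero_less_power)
  have "norm (hnorm W (\<sigma> n) - 0) < r" if n: "max M N \<le> n" for n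
  proof -
    \<comment> \<open>One fixed late term \<open>\<sigma> N\<close> stands for all later ones: the
      first summand is small by the Cauchy property and boundedness, the second because
      \<open>\<sigma> N\<close> is a finite combination of the \<open>e x\<close>.\<close>
    have "(hnorm W (\<sigma> n))\<^sup>2 = Re (cinner W (\<sigma> n) (\<sigma> n - \<sigma> N)) + Re (cinner W (\<sigma> n) (\<sigma> N))"
      using v by (simp add: hnorm_sq cinner_diff_right)
    also have "\<dots> \<le> hnorm W (\<sigma> n) * hnorm W (\<sigma> n - \<sigma> N) + cmod (cinner W (\<sigma> n) (\<sigma> N))"
      using v by (intro add_mono order_trans[OF complex_Re_le_cmod Cauchy_Schwarz] complex_Re_le_cmod)
        (auto intro: vectors_diff)
    also have "\<dots> \<le> B * hnorm W (\<sigma> n - \<sigma> N) + cmod (cinner W (\<sigma> n) (\<sigma> N))"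
      using v B by (intro add_mono mult_right_mono) (auto simp: hnorm_nonneg vectors_diff)
    also have "\<dots> < B * (r\<^sup>2 / (2 * B)) + r\<^sup>2 / 2"
      using M[of n] N[of n N] n B by (intro add_strict_mono mult_strict_left_mono) auto
    also have "\<dots> = r\<^sup>2"
      using B by (simp add: field_simps)
    finally have "hnorm W (\<sigma> n) < r"
      using r by (meson power_less_imp_less_base order_less_imp_le)
    then show ?thesis
      using v by (simp add: hnorm_nonneg)
  qed
  then show "\<exists>no. \<forall>n\<ge>no. norm (hnorm W (\<sigma> n) - 0) < r"
    by blast
qed

definition limit_cinner :: "('i \<Rightarrow> complex) \<Rightarrow> ('i \<Rightarrow> complex) \<Rightarrow> complex" where
  "limit_cinner f g =
     lim (\<lambda>n. cinner W ((SOME \<sigma>. represents \<sigma> f) n) ((SOME \<tau>. represents \<tau> g) n))"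

text \<open>The limit does not depend on the sequences picked by \<open>SOME\<close>: two sequences
  representing the same function differ by one that represents 0, which tends to 0 in norm by
  \<open>represents_zero_tendsto\<close>.\<close>

lemma tendsto_limit_cinner:
  assumes s: "represents \<sigma> f" and t: "represents \<tau> g"
  shows "(\<lambda>n. cinner W (\<sigma> n) (\<tau> n)) \<longlonglongrightarrow> limit_cinner f g"
proof -
  define \<sigma>' \<tau>' where "\<sigma>' = (SOME \<sigma>. represents \<sigma> f)" and "\<tau>' = (SOME \<tau>. represents \<tau> g)"
  have s': "represents \<sigma>' f" and t': "represents \<tau>' g"
    unfolding \<sigma>'_def \<tau>'_def using s t by (metis someI)+
  note v = represents_vectors[OF s] represents_vectors[OF s'] represents_vectors[OF t]
    represents_vectors[OF t']
  have "(\<lambda>n. cinner W (\<sigma>' n) (\<tau>' n)) \<longlonglongrightarrow> limit_cinner f g"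
    using convergent_cinner[OF s' t'] unfolding limit_cinner_def \<sigma>'_def \<tau>'_def
    by (simp add: convergent_LIMSEQ_iff)
  obtain A B where A: "A > 0" "\<And>n. hnorm W (\<sigma>' n) \<le> A"
      and B: "B > 0" "\<And>n. hnorm W (\<tau> n) \<le> B"
    using represents_bounded[OF s'] represents_bounded[OF t] by blast
  have "(\<lambda>n. cinner W (\<sigma> n) (\<tau> n) - cinner W (\<sigma>' n) (\<tau>' n)) \<longlonglongrightarrow> 0"
  proof (rule Lim_null_comparison)
    have "cmod (cinner W (\<sigma> n) (\<tau> n) - cinner W (\<sigma>' n) (\<tau>' n))
        \<le> hnorm W (\<sigma> n - \<sigma>' n) * B + A * hnorm W (\<tau> n - \<tau>' n)" for n
    proof -
      have "cinner W (\<sigma> n) (\<tau> n) - cinner W (\<sigma>' n) (\<tau>' n)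
          = cinner W (\<sigma> n - \<sigma>' n) (\<tau> n) + cinner W (\<sigma>' n) (\<tau> n - \<tau>' n)"
        using v by (simp add: cinner_diff_left cinner_diff_right)
      also have "cmod \<dots> \<le> hnorm W (\<sigma> n - \<sigma>' n) * hnorm W (\<tau> n) + hnorm W (\<sigma>' n) * hnorm W (\<tau> n - \<tau>' n)"
        using v by (intro order_trans[OF norm_triangle_ineq] add_mono Cauchy_Schwarz) (auto intro: vectors_diff)
      also have "\<dots> \<le> hnorm W (\<sigma> n - \<sigma>' n) * B + A * hnorm W (\<tau> n - \<tau>' n)"
        using v A B by (intro add_mono mult_left_mono mult_right_mono) (auto simp: hnorm_nonneg vectors_diff)
      finally show ?thesis .
    qed
    then show "\<forall>\<^sub>F n in sequentially. norm (cinner W (\<sigma> n) (\<tau> n) - cinner W (\<sigma>' n) (\<tau>' n))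
        \<le> hnorm W (\<sigma> n - \<sigma>' n) * B + A * hnorm W (\<tau> n - \<tau>' n)"
      by simp
    have "(\<lambda>n. hnorm W (\<sigma> n - \<sigma>' n)) \<longlonglongrightarrow> 0" "(\<lambda>n. hnorm W (\<tau> n - \<tau>' n)) \<longlonglongrightarrow> 0"
      using represents_diff[OF s s'] represents_diff[OF t t'] by (auto intro: represents_zero_tendsto)
    then show "(\<lambda>n. hnorm W (\<sigma> n - \<sigma>' n) * B + A * hnorm W (\<tau> n - \<tau>' n)) \<longlonglongrightarrow> 0"
      by (auto intro!: tendsto_eq_intros)
  qed
  with \<open>(\<lambda>n. cinner W (\<sigma>' n) (\<tau>' n)) \<longlonglongrightarrow> limit_cinner f g\<close> show ?thesis
    using tendsto_add by fastforce
qed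

definition completion :: "('i \<Rightarrow> complex) cspace" where
  "completion =
     \<lparr>vectors = {f. \<exists>\<sigma>. represents \<sigma> f}, cscale = cscale W, cinner = limit_cinner\<rparr>"

lemma completion_simps [simp]:
  "f \<in> vectors completion \<longleftrightarrow> (\<exists>\<sigma>. represents \<sigma> f)"
  "cscale completion = cscale W"
  "cinner completion = limit_cinner"
  by (simp_all add: completion_def)

lemma limit_cinner_eqI:
  assumes "represents \<sigma> f" "represents \<tau> g" "(\<lambda>n. cinner W (\<sigma> n) (\<tau> n)) \<longlonglongrightarrow> a"
  shows "limit_cinner f g = a"
  using tendsto_limit_cinner[OF assms(1,2)] assms(3) LIMSEQ_unique by blast

lemma limit_cinner_W: "f \<in> vectors W \<Longrightarrow> g \<in> vectors W \<Longrightarrow> limit_cinner f g = cinner W f g"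
  by (rule limit_cinner_eqI[OF represents_const represents_const]) auto

text \<open>At a point \<open>x\<close> with \<open>f x \<noteq> 0\<close>, the Cauchy-Schwarz
  inequality for \<open>\<sigma> n\<close> and \<open>e x\<close> passes to the limit and bounds
  \<open>f x\<close> by the limit norm of \<open>f\<close>.\<close>

lemma Re_limit_cinner_pos:
  assumes s: "represents \<sigma> f" and "f \<noteq> 0"
  shows "0 < Re (limit_cinner f f)"
proof -
  note v = represents_vectors[OF s]
  obtain x where x: "f x \<noteq> 0"
    using \<open>f \<noteq> 0\<close> by (auto simp: fun_eq_iff)
  have sx: "(\<lambda>n. \<sigma> n x) \<longlonglongrightarrow> f x"
    using s by (simp add: represents_def)
  have "x \<in> I"
  proof (rule ccontr)
    assume "x \<notin> I"
    then have "(\<lambda>n. \<sigma> n x) = (\<lambda>n. 0)"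
      using v outside by blast
    then show False
      using sx x LIMSEQ_unique tendsto_const by metis
  qed
  have "(cmod (f x))\<^sup>2 \<le> Re (limit_cinner f f) * (hnorm W (e x))\<^sup>2"
  proof (rule LIMSEQ_le)
    show "(\<lambda>n. (cmod (\<sigma> n x))\<^sup>2) \<longlonglongrightarrow> (cmod (f x))\<^sup>2"
      by (intro tendsto_intros sx)
    show "(\<lambda>n. Re (cinner W (\<sigma> n) (\<sigma> n)) * (hnorm W (e x))\<^sup>2) \<longlonglongrightarrow> Re (limit_cinner f f) * (hnorm W (e x))\<^sup>2"
      by (intro tendsto_intros tendsto_limit_cinner s)
    have "(cmod (\<sigma> n x))\<^sup>2 \<le> Re (cinner W (\<sigma> n) (\<sigma> n)) * (hnorm W (e x))\<^sup>2" for n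
      using power_mono[OF Cauchy_Schwarz[OF v e_vectors[OF \<open>x \<in> I\<close>]] norm_ge_zero, of n 2]
      by (simp add: reproducing[OF v \<open>x \<in> I\<close>] power_mult_distrib hnorm_sq v)
    then show "\<exists>N. \<forall>n\<ge>N. (cmod (\<sigma> n x))\<^sup>2 \<le> Re (cinner W (\<sigma> n) (\<sigma> n)) * (hnorm W (e x))\<^sup>2"
      by blast
  qed
  moreover have "(cmod (f x))\<^sup>2 > 0"
    using x by simp
  ultimately have "0 < Re (limit_cinner f f) * (hnorm W (e x))\<^sup>2"
    by linarith
  then show ?thesis
    by (simp add: zero_less_mult_iff)
qed

lemma complex_inner_space_completion: "complex_inner_space completion"
proof (intro complex_inner_space.intro complex_inner_space_axioms.intro)
  show "vector_space (cscale completion)"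
    by (simp add: vector_space_axioms)
  show "module.subspace (cscale completion) (vectors completion)"
    unfolding completion_simps(2)
  proof (rule subspaceI)
    show "0 \<in> vectors completion"
      using represents_const[OF vectors_zero] by auto
  qed (auto intro: represents_add represents_scale)
  fix f g h c
  assume "f \<in> vectors completion" "g \<in> vectors completion"
  then obtain \<sigma> \<tau> where s: "represents \<sigma> f" and t: "represents \<tau> g" by auto
  note v = represents_vectors[OF s] represents_vectors[OF t]
  note l = tendsto_limit_cinner
  show "cinner completion (cscale completion c f) g = c * cinner completion f g"
    unfolding completion_simps
    by (rule limit_cinner_eqI[OF represents_scale[OF s] t])
      (use tendsto_mult[OF tendsto_const[of c] l[OF s t]] v in \<open>simp add: cinner_scale_left\<close>)
  show "cinner completion g f = cnj (cinner completion f g)"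
    unfolding completion_simps
    by (rule limit_cinner_eqI[OF t s])
      (use tendsto_cnj[OF l[OF s t]] v in \<open>simp flip: cinner_commute\<close>)
  assume "h \<in> vectors completion"
  then obtain \<rho> where r: "represents \<rho> h" by auto
  show "cinner completion (f + g) h = cinner completion f h + cinner completion g h"
    unfolding completion_simps
    by (rule limit_cinner_eqI[OF represents_add[OF s t] r])
      (use tendsto_add[OF l[OF s r] l[OF t r]] v represents_vectors[OF r] in \<open>simp add: cinner_add_left\<close>)
next
  show "0 < Re (cinner completion f f)" if "f \<in> vectors completion" "f \<noteq> 0" for f
    using that Re_limit_cinner_pos by auto
qed

sublocale C: complex_inner_space completion
  by (rule complex_inner_space_completion)

lemma hnorm_completion: "f \<in> vectors W \<Longrightarrow> hnorm completion f = hnorm W f"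
  by (simp add: hnorm_def limit_cinner_W)

lemma tendsto_hnorm_represents:
  assumes s: "represents \<sigma> f"
  shows "(\<lambda>n. hnorm W (\<sigma> n)) \<longlonglongrightarrow> hnorm completion f"
  unfolding hnorm_def completion_simps by (intro tendsto_intros tendsto_limit_cinner s)

lemma represents_imp_tendsto:
  assumes s: "represents \<sigma> f"
  shows "(\<lambda>n. hnorm completion (f - \<sigma> n)) \<longlonglongrightarrow> 0"
proof (rule LIMSEQ_I)
  note v = represents_vectors[OF s]
  fix r :: real assume "r > 0"
  then have "r / 2 > 0" by simp
  then obtain N where N: "\<And>m n. N \<le> m \<Longrightarrow> N \<le> n \<Longrightarrow> hnorm W (\<sigma> m - \<sigma> n) < r / 2"
    using s unfolding represents_def MCauchy_hnorm_iff by meson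
  \<comment> \<open>The Cauchy estimate with \<open>n\<close> fixed, in the limit
    \<open>m \<rightarrow> \<infinity>\<close>; the strict inequality weakens to
    \<open>\<le>\<close>.\<close>
  have "hnorm completion (f - \<sigma> n) \<le> r / 2" if "N \<le> n" for n
  proof (rule LIMSEQ_le_const2)
    show "(\<lambda>m. hnorm W (\<sigma> m - \<sigma> n)) \<longlonglongrightarrow> hnorm completion (f - \<sigma> n)"
      by (intro tendsto_hnorm_represents represents_diff s represents_const v)
    show "\<exists>M. \<forall>m\<ge>M. hnorm W (\<sigma> m - \<sigma> n) \<le> r / 2"
      using N that by (meson less_imp_le)
  qed
  moreover have "0 \<le> hnorm completion (f - \<sigma> n)" for n
    using represents_diff[OF s represents_const[OF v[of n]]] by (intro C.hnorm_nonneg) auto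
  ultimately show "\<exists>no. \<forall>n\<ge>no. norm (hnorm completion (f - \<sigma> n) - 0) < r"
    using \<open>r > 0\<close> by (intro exI[of _ N]) (fastforce intro: le_less_trans)
qed

lemma dense_in_completion:
  assumes "f \<in> vectors completion" "\<epsilon> > 0"
  shows "\<exists>w\<in>vectors W. hnorm completion (f - w) < \<epsilon>"
proof -
  obtain \<sigma> where s: "represents \<sigma> f"
    using assms by auto
  have "\<forall>\<^sub>F n in sequentially. hnorm completion (f - \<sigma> n) < \<epsilon>"
    using represents_imp_tendsto[OF s] assms(2) by (auto dest: order_tendstoD)
  then show ?thesis
    using represents_vectors[OF s] by (auto simp: eventually_sequentially)
qed

text \<open>Each \<open>F n\<close> is replaced by some \<open>w n\<close> in \<open>W\<close> at
  distance less than \<open>1 / (n + 1)\<close>. Then \<open>w\<close> is Cauchy in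
  \<open>W\<close>, converges pointwise thanks to the reproducing vectors, and the function that it
  represents is the limit of \<open>F\<close> as well.\<close>

lemma complete_completion: "C.mcomplete"
  unfolding C.mcomplete_def
proof (intro allI impI)
  fix F assume F: "C.MCauchy F"
  then have vF: "F n \<in> vectors completion" for n
    by (auto simp: C.MCauchy_def simp del: completion_simps)
  have "\<exists>w\<in>vectors W. hnorm completion (F n - w) < 1 / real (Suc n)" for n
    using dense_in_completion[OF vF] by simp
  then obtain w where w: "\<And>n. w n \<in> vectors W" "\<And>n. hnorm completion (F n - w n) < 1 / real (Suc n)"
    by metis
  have vw: "w n \<in> vectors completion" for n
    using represents_const[OF w(1)] by auto
  have w0: "(\<lambda>n. hnorm completion (F n - w n)) \<longlonglongrightarrow> 0"
  proof (rule Lim_null_comparison[OF _ LIMSEQ_inverse_real_of_nat])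
    show "\<forall>\<^sub>F n in sequentially. norm (hnorm completion (F n - w n)) \<le> inverse (real (Suc n))"
      using w(2) vF vw by (intro always_eventually allI)
        (auto simp: inverse_eq_divide C.hnorm_nonneg C.vectors_diff less_imp_le simp del: completion_simps)
  qed
  have cw: "MCauchy w"
    unfolding MCauchy_hnorm_iff
  proof (intro conjI allI impI w(1))
    fix \<epsilon> :: real assume "\<epsilon> > 0"
    then have e3: "\<epsilon> / 3 > 0" by simp
    then obtain N where N: "\<And>m n. N \<le> m \<Longrightarrow> N \<le> n \<Longrightarrow> hnorm completion (F m - F n) < \<epsilon> / 3"
      using F unfolding C.MCauchy_hnorm_iff by meson
    obtain M where M: "\<And>n. M \<le> n \<Longrightarrow> hnorm completion (F n - w n) < \<epsilon> / 3"
      using order_tendstoD(2)[OF w0 e3] by (auto simp: eventually_sequentially)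
    have "hnorm W (w m - w n) < \<epsilon>" if "max M N \<le> m" "max M N \<le> n" for m n
    proof -
      have "hnorm W (w m - w n) = hnorm completion (w m - w n)"
        using w(1) by (simp add: hnorm_completion vectors_diff)
      also have "\<dots> \<le> hnorm completion (w m - F m) + hnorm completion (F m - F n) + hnorm completion (F n - w n)"
        using C.hnorm_diff_triangle[of "w m" "F m" "w n"] C.hnorm_diff_triangle[of "F m" "F n" "w n"]
          vw vF by fastforce
      also have "\<dots> < \<epsilon>"
        using M[of m] M[of n] N[of m n] that C.hnorm_minus_commute[OF vw vF, of m m] by simp
      finally show ?thesis .
    qed
    then show "\<exists>N. \<forall>m n. N \<le> m \<longrightarrow> N \<le> n \<longrightarrow> hnorm W (w m - w n) < \<epsilon>"
      by blast
  qed
  have "convergent (\<lambda>n. w n x)" for x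
  proof (cases "x \<in> I")
    case True
    have "Cauchy (\<lambda>n. w n x)"
      unfolding Cauchy_def dist_norm
    proof (intro allI impI)
      fix \<epsilon> :: real assume "\<epsilon> > 0"
      then have "\<epsilon> / (hnorm W (e x) + 1) > 0"
        using e_vectors[OF True] by (simp add: hnorm_nonneg add_nonneg_pos)
      then obtain N where N: "\<And>m n. N \<le> m \<Longrightarrow> N \<le> n \<Longrightarrow> hnorm W (w m - w n) < \<epsilon> / (hnorm W (e x) + 1)"
        using cw unfolding MCauchy_hnorm_iff by meson
      have "cmod (w m x - w n x) < \<epsilon>" if "N \<le> m" "N \<le> n" for m n
      proof -
        have "cmod (w m x - w n x) = cmod (cinner W (w m - w n) (e x))"
          using reproducing[OF vectors_diff[OF w(1) w(1)] True, of m n] by simp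
        also have "\<dots> \<le> hnorm W (w m - w n) * hnorm W (e x)"
          using w(1) True by (intro Cauchy_Schwarz) (auto intro: vectors_diff e_vectors)
        also have "\<dots> \<le> hnorm W (w m - w n) * (hnorm W (e x) + 1)"
          using w(1) by (intro mult_left_mono) (auto simp: hnorm_nonneg vectors_diff)
        also have "\<dots> < \<epsilon>"
          using N[OF that] e_vectors[OF True]
          by (simp add: pos_less_divide_eq hnorm_nonneg add_nonneg_pos)
        finally show ?thesis .
      qed
      then show "\<exists>M. \<forall>m\<ge>M. \<forall>n\<ge>M. cmod (w m x - w n x) < \<epsilon>"
        by blast
    qed
    then show ?thesis
      by (rule Cauchy_convergent)
  next
    case False
    then show ?thesis
      using outside[OF w(1) False] by (simp add: convergent_const)
  qed
  then obtain g where g: "\<And>x. (\<lambda>n. w n x) \<longlonglongrightarrow> g x"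
    unfolding convergent_def by metis
  have r: "represents w g"
    using cw g by (simp add: represents_def)
  then have vg: "g \<in> vectors completion"
    by auto
  have "(\<lambda>n. hnorm completion (F n - g)) \<longlonglongrightarrow> 0"
  proof (rule Lim_null_comparison)
    show "(\<lambda>n. hnorm completion (F n - w n) + hnorm completion (g - w n)) \<longlonglongrightarrow> 0"
      using tendsto_add[OF w0 represents_imp_tendsto[OF r]] by simp
    show "\<forall>\<^sub>F n in sequentially. norm (hnorm completion (F n - g))
        \<le> hnorm completion (F n - w n) + hnorm completion (g - w n)"
      using C.hnorm_diff_triangle[OF vF vw vg] C.hnorm_minus_commute[OF vg vw] vF vg
      by (intro always_eventually allI) (simp add: C.hnorm_nonneg C.vectors_diff del: completion_simps)
  qed
  then show "\<exists>x. limitin C.mtopology F x sequentially"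
    using vF vg C.limitin_hnorm_iff by blast
qed

lemma complex_hilbert_space_completion: "complex_hilbert_space completion"
  by (intro complex_hilbert_space.intro complex_inner_space_completion
      complex_hilbert_space_axioms.intro complete_completion)

end

section \<open>The inner product space of a kernel\<close>

definition kcomb :: "'i set \<Rightarrow> ('i \<Rightarrow> 'i \<Rightarrow> complex) \<Rightarrow> (complex \<times> 'i) list \<Rightarrow> 'i \<Rightarrow> complex" where
  "kcomb I k xs = (\<lambda>y. if y \<in> I then \<Sum>(c, x)\<leftarrow>xs. c * k x y else 0)"

text \<open>The Moore-Aronszajn construction. Identifying a formal combination with the function it
  induces on \<open>I\<close> divides out the null vectors. The inner product evaluates
  \<open>g\<close> along some expansion of \<open>f\<close>; that the choice is immaterial is
  \<open>cinner_kcomb\<close>.\<close>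

definition kernel_space :: "'i set \<Rightarrow> ('i \<Rightarrow> 'i \<Rightarrow> complex) \<Rightarrow> ('i \<Rightarrow> complex) cspace" where
  "kernel_space I k =
     \<lparr>vectors = kcomb I k ` {xs. snd ` set xs \<subseteq> I}, cscale = (\<lambda>c f x. c * f x),
      cinner = (\<lambda>f g. \<Sum>(c, x)\<leftarrow>(SOME xs. snd ` set xs \<subseteq> I \<and> f = kcomb I k xs). c * cnj (g x))\<rparr>"

lemma kernel_space_simps [simp]:
  "vectors (kernel_space I k) = kcomb I k ` {xs. snd ` set xs \<subseteq> I}"
  "cscale (kernel_space I k) = (\<lambda>c f x. c * f x)"
  by (simp_all add: kernel_space_def)

lemma kcomb_append: "kcomb I k (xs @ ys) = kcomb I k xs + kcomb I k ys"
  by (auto simp: kcomb_def)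

lemma kcomb_scale: "kcomb I k (map (apfst ((*) c)) xs) = (\<lambda>x. c * kcomb I k xs x)"
  by (auto simp: kcomb_def o_def case_prod_unfold sum_list_const_mult mult.assoc)

lemma lincomb_kernel_space:
  assumes "cscale W = (\<lambda>c f x. c * f x)"
  shows "lincomb W (\<lambda>x. kcomb I k [(1, x)]) xs = kcomb I k xs"
  by (induction xs) (auto simp: assms kcomb_def fun_eq_iff zero_fun_def)

context
  fixes I :: "'i set" and k :: "'i \<Rightarrow> 'i \<Rightarrow> complex"
  assumes psd: "psd_kernel I k"
begin

lemma kform_eq_kcomb:
  assumes "snd ` set ys \<subseteq> I"
  shows "kform k xs ys = (\<Sum>(d, y)\<leftarrow>ys. cnj d * kcomb I k xs y)"
  unfolding kform_eq_right case_prod_unfold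
  by (intro arg_cong[of _ _ sum_list] map_cong refl) (use assms in \<open>auto simp: kcomb_def case_prod_unfold\<close>)

text \<open>The form depends on its left argument only through the induced function, by
  \<open>kform_eq_kcomb\<close>, so the chosen expansion \<open>zs\<close> may be exchanged for
  \<open>xs\<close>. Hermitian symmetry is used to recognize the defining sum as a value of the
  form.\<close>

lemma cinner_kcomb:
  assumes xs: "snd ` set xs \<subseteq> I" and ys: "snd ` set ys \<subseteq> I"
  shows "cinner (kernel_space I k) (kcomb I k xs) (kcomb I k ys) = kform k xs ys"
proof -
  define zs where "zs = (SOME zs. snd ` set zs \<subseteq> I \<and> kcomb I k xs = kcomb I k zs)"
  have zs: "snd ` set zs \<subseteq> I" "kcomb I k xs = kcomb I k zs"
    unfolding zs_def
    using someI[of "\<lambda>zs. snd ` set zs \<subseteq> I \<and> kcomb I k xs = kcomb I k zs" xs] xs by blast+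
  have "cinner (kernel_space I k) (kcomb I k xs) (kcomb I k ys)
      = (\<Sum>(c, x)\<leftarrow>zs. c * cnj (kcomb I k ys x))"
    by (simp add: kernel_space_def zs_def)
  also have "\<dots> = cnj (\<Sum>(c, x)\<leftarrow>zs. cnj c * kcomb I k ys x)"
    by (simp add: cnj_sum_list o_def case_prod_unfold)
  also have "\<dots> = cnj (kform k ys zs)"
    by (simp add: kform_eq_kcomb zs(1))
  also have "\<dots> = kform k zs ys"
    using psd_kernelD(1)[OF psd] zs(1) ys by (intro kform_commute[symmetric]) blast
  also have "\<dots> = kform k xs ys"
    using ys zs(2) by (simp add: kform_eq_kcomb)
  finally show ?thesis .
qed

lemma complex_inner_space_kernel_space: "complex_inner_space (kernel_space I k)"
proof (intro complex_inner_space.intro complex_inner_space_axioms.intro)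
  let ?W = "kernel_space I k"
  show "vector_space (cscale ?W)"
    using vector_space_fun by simp
  interpret vector_space "\<lambda>c (f :: 'i \<Rightarrow> complex) x. c * f x"
    by (rule vector_space_fun)
  show "module.subspace (cscale ?W) (vectors ?W)"
    unfolding kernel_space_simps(2)
  proof (rule subspaceI)
    have "kcomb I k [] = 0"
      by (auto simp: kcomb_def)
    then show "0 \<in> vectors ?W"
      by (force intro!: image_eqI[of _ _ "[]"])
  next
    fix f g assume "f \<in> vectors ?W" "g \<in> vectors ?W"
    then obtain xs ys where "snd ` set xs \<subseteq> I" "f = kcomb I k xs" "snd ` set ys \<subseteq> I" "g = kcomb I k ys"
      by auto
    then have "f + g = kcomb I k (xs @ ys)" "snd ` set (xs @ ys) \<subseteq> I"
      by (simp_all add: kcomb_append image_Un)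
    then show "f + g \<in> vectors ?W"
      unfolding kernel_space_simps by (intro image_eqI[where x = "xs @ ys"] CollectI)
  next
    fix f c assume "f \<in> vectors ?W"
    then obtain xs where xs: "snd ` set xs \<subseteq> I" "f = kcomb I k xs"
      by auto
    have "snd ` set (map (apfst ((*) c)) xs) \<subseteq> I"
      using xs(1) by (simp add: image_image)
    moreover have "(\<lambda>x. c * f x) = kcomb I k (map (apfst ((*) c)) xs)"
      by (simp only: xs(2) kcomb_scale)
    ultimately show "(\<lambda>x. c * f x) \<in> vectors ?W"
      unfolding kernel_space_simps
      by (intro image_eqI[where x = "map (apfst ((*) c)) xs"] CollectI)
  qed
  fix f g h c
  assume "f \<in> vectors ?W" "g \<in> vectors ?W"
  then obtain xs ys where xs: "snd ` set xs \<subseteq> I" "f = kcomb I k xs"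
    and ys: "snd ` set ys \<subseteq> I" "g = kcomb I k ys"
    by auto
  have "snd ` set (map (apfst ((*) c)) xs) \<subseteq> I"
    using xs by auto
  from cinner_kcomb[OF this ys(1)]
  show "cinner ?W (cscale ?W c f) g = c * cinner ?W f g"
    using cinner_kcomb[OF xs(1) ys(1)] unfolding xs(2) ys(2) kernel_space_simps
    by (simp only: kcomb_scale kform_scale_left)
  show "cinner ?W g f = cnj (cinner ?W f g)"
    unfolding xs(2) ys(2) cinner_kcomb[OF xs(1) ys(1)] cinner_kcomb[OF ys(1) xs(1)]
    using psd_kernelD(1)[OF psd] xs(1) ys(1) by (intro kform_commute) blast
  assume "h \<in> vectors ?W"
  then obtain zs where zs: "snd ` set zs \<subseteq> I" "h = kcomb I k zs"
    by auto
  have "snd ` set (xs @ ys) \<subseteq> I"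
    using xs ys by auto
  from cinner_kcomb[OF this zs(1)]
  show "cinner ?W (f + g) h = cinner ?W f h + cinner ?W g h"
    using xs ys zs by (simp add: kcomb_append kform_append cinner_kcomb)
next
  fix f assume "f \<in> vectors (kernel_space I k)" "f \<noteq> 0"
  then obtain xs where xs: "snd ` set xs \<subseteq> I" "f = kcomb I k xs"
    by auto
  obtain y where y: "f y \<noteq> 0"
    using \<open>f \<noteq> 0\<close> by (auto simp: fun_eq_iff)
  then have yI: "y \<in> I"
    using xs by (auto simp: kcomb_def split: if_splits)
  define q where "q = Re (kform k xs xs)"
  have q: "q \<ge> 0"
    unfolding q_def using psd_kernelD(2)[OF psd xs(1)] .
  define b where "b = Re (k y y)"
  \<comment> \<open>This is the squared length of \<open>f - s * f y * e_y\<close>, where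
    \<open>e_y\<close> is the kernel vector at \<open>y\<close>. It is expanded by hand because the
    Cauchy-Schwarz lemma of the locale presupposes the definiteness that is being proved.\<close>
  have quad: "0 \<le> q - 2 * s * (cmod (f y))\<^sup>2 + s\<^sup>2 * (cmod (f y))\<^sup>2 * b" for s :: real
  proof -
    define t where "t = - of_real s * f y"
    have "0 \<le> Re (kform k (xs @ [(t, y)]) (xs @ [(t, y)]))"
      using xs(1) yI by (intro psd_kernelD(2)[OF psd]) auto
    also have "kform k (xs @ [(t, y)]) (xs @ [(t, y)])
        = kform k xs xs + kform k xs [(t, y)] + (kform k [(t, y)] xs + kform k [(t, y)] [(t, y)])"
      by (simp add: kform_append)
    also have "kform k [(t, y)] xs = cnj (kform k xs [(t, y)])"
      using psd_kernelD(1)[OF psd] xs(1) yI by (intro kform_commute) auto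
    also have "kform k xs [(t, y)] = cnj t * f y"
      using kform_eq_kcomb[of "[(t, y)]" xs] xs yI by simp
    also have "cnj t * f y = - of_real s * (f y * cnj (f y))"
      by (simp add: t_def)
    also have "\<dots> = of_real (- s * (cmod (f y))\<^sup>2)"
      unfolding complex_norm_square[symmetric] by simp
    also have "kform k [(t, y)] [(t, y)] = of_real (s\<^sup>2) * (f y * cnj (f y)) * k y y"
      by (simp add: kform_def t_def power2_eq_square mult_ac)
    also have "\<dots> = of_real (s\<^sup>2 * (cmod (f y))\<^sup>2) * k y y"
      unfolding complex_norm_square[symmetric] by simp
    finally show ?thesis
      by (simp add: q_def b_def)
  qed
  have "q \<noteq> 0"
  proof
    assume "q = 0"
    \<comment> \<open>For \<open>q = 0\<close> the quadratic is
      \<open>s * (cmod (f y))\<^sup>2 * (s * b - 2)\<close>, which is negative for small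
      \<open>s > 0\<close>; the summand 1 covers \<open>b = 0\<close>.\<close>
    define s where "s = 1 / (\<bar>b\<bar> + 1)"
    have s: "s > 0" "s * b < 2"
      by (auto simp: s_def divide_less_eq abs_if)
    have "0 \<le> s * (cmod (f y))\<^sup>2 * (s * b - 2)"
      using quad[of s] \<open>q = 0\<close> by (simp add: algebra_simps power2_eq_square)
    moreover have "s * (cmod (f y))\<^sup>2 > 0"
      using s y by simp
    ultimately show False
      using s(2) by (simp add: zero_le_mult_iff)
  qed
  then show "0 < Re (cinner (kernel_space I k) f f)"
    using q xs by (simp add: cinner_kcomb q_def)
qed

lemma reproducing_space_kernel_space:
  "reproducing_space (kernel_space I k) I (\<lambda>x. kcomb I k [(1, x)])"
proof (intro reproducing_space.intro complex_inner_space_kernel_space reproducing_space_axioms.intro)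
  let ?W = "kernel_space I k"
  show "cscale ?W = (\<lambda>c f x. c * f x)"
    by simp
  show "kcomb I k [(1, x)] \<in> vectors ?W" if "x \<in> I" for x
    using that by auto
  fix f assume "f \<in> vectors ?W"
  then obtain xs where xs: "snd ` set xs \<subseteq> I" "f = kcomb I k xs"
    by auto
  show "f x = cinner ?W f (kcomb I k [(1, x)])" if "x \<in> I" for x
    using that xs cinner_kcomb[of xs "[(1, x)]"] by (simp add: kform_eq_kcomb)
  show "f x = 0" if "x \<notin> I" for x
    using that xs by (simp add: kcomb_def)
  show "\<exists>xs. snd ` set xs \<subseteq> I \<and> f = lincomb ?W (\<lambda>x. kcomb I k [(1, x)]) xs"
    using xs by (auto simp: lincomb_kernel_space)
qed

text \<open>Besides supplying the dilation space, this allows statements about kernels to be read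
  off from vectors: Cauchy-Schwarz, Schur complements and projection defects are obtained in this
  way. The density clause later gives minimality.\<close>

theorem kernel_realization:
  "\<exists>(K :: ('i \<Rightarrow> complex) cspace) e. complex_hilbert_space K \<and> e ` I \<subseteq> vectors K \<and>
     (\<forall>x\<in>I. \<forall>y\<in>I. cinner K (e x) (e y) = k x y) \<and>
     (\<forall>f\<in>vectors K. \<forall>\<epsilon>>0. \<exists>xs. snd ` set xs \<subseteq> I \<and> hnorm K (f - lincomb K e xs) < \<epsilon>)"
proof -
  define e where "e = (\<lambda>x. kcomb I k [(1, x)])"
  interpret reproducing_space "kernel_space I k" I e
    unfolding e_def by (rule reproducing_space_kernel_space)
  have W: "w \<in> vectors completion" if "w \<in> vectors (kernel_space I k)" for w
    using represents_const[OF that] by auto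
  have k: "cinner completion (e x) (e y) = k x y" if "x \<in> I" "y \<in> I" for x y
    using that cinner_kcomb[of "[(1, x)]" "[(1, y)]"] limit_cinner_W[OF e_vectors e_vectors, of x y]
    by (simp add: e_def kform_def)
  have "\<exists>xs. snd ` set xs \<subseteq> I \<and> hnorm completion (f - lincomb completion e xs) < \<epsilon>"
    if "f \<in> vectors completion" "\<epsilon> > 0" for f \<epsilon>
  proof -
    have "\<exists>w\<in>vectors (kernel_space I k). hnorm completion (f - w) < \<epsilon>"
      by (rule dense_in_completion[OF that])
    then obtain w where w: "w \<in> vectors (kernel_space I k)" "hnorm completion (f - w) < \<epsilon>"
      by blast
    obtain xs where xs: "snd ` set xs \<subseteq> I" "w = lincomb (kernel_space I k) e xs"
      using spanned[OF w(1)] by (elim exE conjE)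
    have "lincomb completion e xs = lincomb (kernel_space I k) e xs"
      unfolding lincomb_def completion_simps(2) ..
    then show ?thesis
      using w(2) xs by (intro exI[of _ xs]) simp
  qed
  moreover have "e ` I \<subseteq> vectors completion"
    by (intro image_subsetI W e_vectors)
  ultimately show ?thesis
    using k complex_hilbert_space_completion by (intro exI[of _ completion] exI[of _ e] conjI ballI allI impI)
qed

end

section \<open>Amalgamation and limits of kernels\<close>

lemma psd_kernel_mono: "psd_kernel I k \<Longrightarrow> J \<subseteq> I \<Longrightarrow> psd_kernel J k"
  unfolding psd_kernel_def by blast

lemma psd_kernel_cong:
  assumes "psd_kernel I k" "\<And>x y. x \<in> I \<Longrightarrow> y \<in> I \<Longrightarrow> l x y = k x y"
  shows "psd_kernel I l"
proof -
  have "kform l xs xs = kform k xs xs" if "snd ` set xs \<subseteq> I" for xs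
    by (rule kform_cong) (use assms(2) that in blast)
  moreover have "l y x = cnj (l x y)" if "x \<in> I" "y \<in> I" for x y
    unfolding assms(2)[OF that] assms(2)[OF that(2,1)] by (rule psd_kernelD(1)[OF assms(1) that])
  ultimately show ?thesis
    using psd_kernelD(2)[OF assms(1)] unfolding psd_kernel_def by metis
qed

text \<open>The map \<open>g\<close> may identify indices; since lists admit repetitions,
  relabelling needs no regrouping of coefficients.\<close>

lemma psd_kernel_pullback:
  assumes "psd_kernel J k" "g \<in> I \<rightarrow> J"
  shows "psd_kernel I (\<lambda>x y. k (g x) (g y))"
  unfolding psd_kernel_def
proof (intro conjI ballI allI impI)
  fix xs :: "(complex \<times> 'b) list" assume xs: "snd ` set xs \<subseteq> I"
  have "snd ` set (map (apsnd g) xs) = g ` snd ` set xs"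
    by (simp add: image_image)
  also have "\<dots> \<subseteq> J"
    using xs assms(2) by blast
  finally have "snd ` set (map (apsnd g) xs) \<subseteq> J" .
  then have "0 \<le> Re (kform k (map (apsnd g) xs) (map (apsnd g) xs))"
    by (rule psd_kernelD(2)[OF assms(1)])
  then show "0 \<le> Re (kform (\<lambda>x y. k (g x) (g y)) xs xs)"
    by (simp add: kform_def o_def case_prod_unfold)
next
  fix x y assume "x \<in> I" "y \<in> I"
  then show "k (g y) (g x) = cnj (k (g x) (g y))"
    using assms(2) by (intro psd_kernelD(1)[OF assms(1)]) auto
qed

lemma psd_kernel_add:
  assumes "psd_kernel I k" "psd_kernel I l"
  shows "psd_kernel I (\<lambda>x y. k x y + l x y)"
proof -
  have "kform (\<lambda>x y. k x y + l x y) xs xs = kform k xs xs + kform l xs xs" for xs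
    by (simp add: kform_def case_prod_unfold distrib_left sum_list_addf)
  then show ?thesis
    by (intro psd_kernelI)
      (simp_all add: psd_kernelD(2)[OF assms(1)] psd_kernelD(2)[OF assms(2)],
        metis psd_kernelD(1)[OF assms(1)] psd_kernelD(1)[OF assms(2)])
qed

lemma psd_kernel_scale:
  assumes "psd_kernel I k" "0 \<le> r"
  shows "psd_kernel I (\<lambda>x y. of_real r * k x y)"
proof -
  have "kform (\<lambda>x y. of_real r * k x y) xs xs = kform k (map (apfst ((*) (of_real r))) xs) xs" for xs
    by (simp add: kform_def o_def case_prod_unfold mult_ac)
  then have "kform (\<lambda>x y. of_real r * k x y) xs xs = of_real r * kform k xs xs" for xs
    by (simp only: kform_scale_left)
  then show ?thesis
    by (intro psd_kernelI)
      (simp_all add: psd_kernelD(2)[OF assms(1)] assms(2), metis psd_kernelD(1)[OF assms(1)])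
qed

lemma psd_kernel_sum:
  assumes "\<And>i. i \<in> N \<Longrightarrow> psd_kernel I (k i)"
  shows "psd_kernel I (\<lambda>x y. \<Sum>i\<in>N. k i x y)"
  using assms
proof (induction N rule: infinite_finite_induct)
  case (insert i N)
  then show ?case by (simp add: psd_kernel_add)
qed (simp_all add: psd_kernel_def kform_def case_prod_unfold)

lemma psd_kernel_mask:
  assumes "psd_kernel A k"
  shows "psd_kernel I (\<lambda>x y. if x \<in> A \<and> y \<in> A then k x y else 0)"
proof -
  let ?k = "\<lambda>x y. if x \<in> A \<and> y \<in> A then k x y else 0"
  have "kform ?k xs xs = kform k (filter (\<lambda>p. snd p \<in> A) xs) (filter (\<lambda>p. snd p \<in> A) xs)" for xs
  proof -
    have *: "(\<Sum>q\<leftarrow>ys. cnj (fst q) * ?k x (snd q))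
        = (if x \<in> A then \<Sum>q\<leftarrow>filter (\<lambda>p. snd p \<in> A) ys. cnj (fst q) * k x (snd q) else 0)" for x ys
      by (induction ys) auto
    have "(\<Sum>p\<leftarrow>ys. fst p * (if snd p \<in> A then g (snd p) else 0))
        = (\<Sum>p\<leftarrow>filter (\<lambda>p. snd p \<in> A) ys. fst p * g (snd p))"
      for g :: "'a \<Rightarrow> complex" and ys
      by (induction ys) auto
    then show ?thesis
      unfolding kform_eq_left case_prod_unfold * .
  qed
  moreover have "snd ` set (filter (\<lambda>p. snd p \<in> A) xs) \<subseteq> A" for xs :: "(complex \<times> 'a) list"
    by auto
  ultimately show ?thesis
    by (intro psd_kernelI)
      (simp_all add: psd_kernelD(2)[OF assms(1)], metis psd_kernelD(1)[OF assms(1)])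
qed

text \<open>This is the term by which a kernel and its Schur complement differ. For
  \<open>r = 0\<close> the quotient is 0 by convention, so that a vanishing pivot needs no separate
  treatment.\<close>

lemma psd_kernel_rank_one:
  assumes "0 \<le> r"
  shows "psd_kernel I (\<lambda>x y. f x * cnj (f y) / of_real r)"
proof -
  have inner: "(\<Sum>q\<leftarrow>ys. cnj (fst q) * (f x * cnj (f (snd q)) / of_real r))
      = f x * (cnj (\<Sum>q\<leftarrow>ys. fst q * f (snd q)) / of_real r)" for x ys
    by (induction ys) (simp_all add: add_divide_distrib distrib_left)
  have outer: "(\<Sum>q\<leftarrow>ys. fst q * (f (snd q) * a)) = (\<Sum>q\<leftarrow>ys. fst q * f (snd q)) * a" for a ys
    by (induction ys) (simp_all add: distrib_right)
  have "kform (\<lambda>x y. f x * cnj (f y) / of_real r) xs xs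
      = (\<Sum>q\<leftarrow>xs. fst q * f (snd q)) * (cnj (\<Sum>q\<leftarrow>xs. fst q * f (snd q)) / of_real r)" for xs
    unfolding kform_eq_left case_prod_unfold inner outer ..
  moreover have "0 \<le> Re (z * (cnj z / of_real r))" for z
    using assms by (simp add: Re_divide_of_real)
  ultimately show ?thesis
    by (intro psd_kernelI) (simp_all add: mult.commute)
qed

lemma psd_kernel_diagonal:
  assumes "psd_kernel I k" "x \<in> I"
  shows "k x x = of_real (Re (k x x))" "0 \<le> Re (k x x)"
proof -
  show "k x x = of_real (Re (k x x))"
    using psd_kernelD(1)[OF assms(1) assms(2,2)] by (simp add: complex_eq_iff)
  show "0 \<le> Re (k x x)"
    using psd_kernelD(2)[OF assms(1), of "[(1, x)]"] assms(2) by (simp add: kform_def)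
qed

lemma psd_kernel_Cauchy_Schwarz:
  assumes "psd_kernel I k" "x \<in> I" "y \<in> I"
  shows "cmod (k x y) \<le> sqrt (Re (k x x)) * sqrt (Re (k y y))"
proof -
  obtain K :: "('a \<Rightarrow> complex) cspace" and e where K: "complex_hilbert_space K" "e ` I \<subseteq> vectors K"
    "\<forall>x\<in>I. \<forall>y\<in>I. cinner K (e x) (e y) = k x y"
    using kernel_realization[OF assms(1)] by blast
  interpret complex_hilbert_space K by (rule K(1))
  show ?thesis
    using Cauchy_Schwarz[of "e x" "e y"] K(2,3) assms by (auto simp: hnorm_def)
qed

text \<open>The Gram kernel of the vectors \<open>e x\<close> with their components along
  \<open>e b\<close> removed. If \<open>k b b = 0\<close>, the quotients are 0 and nothing is
  subtracted.\<close>

lemma psd_kernel_Schur_complement: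
  assumes k: "psd_kernel I k" and b: "b \<in> I"
  shows "psd_kernel I (\<lambda>x y. k x y - k x b * k b y / k b b)"
proof -
  obtain K :: "('a \<Rightarrow> complex) cspace" and e where K: "complex_hilbert_space K" "e ` I \<subseteq> vectors K"
    "\<forall>x\<in>I. \<forall>y\<in>I. cinner K (e x) (e y) = k x y"
    using kernel_realization[OF k] by blast
  interpret complex_hilbert_space K by (rule K(1))
  have e: "e x \<in> vectors K" if "x \<in> I" for x
    using K(2) that by blast
  define v where "v x = e x - cscale K (k x b / k b b) (e b)" for x
  have v: "psd_kernel I (\<lambda>x y. cinner K (v x) (v y))"
    by (rule psd_kernel_gram) (auto simp: v_def intro!: vectors_diff vectors_scale e b)
  show ?thesis
  proof (rule psd_kernel_cong[OF v])
    fix x y assume xy: "x \<in> I" "y \<in> I"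
    have "cnj (k b b) = k b b" "cnj (k y b) = k b y"
      using psd_kernelD(1)[OF k] b xy by metis+
    then show "k x y - k x b * k b y / k b b = cinner K (v x) (v y)"
      using xy b K(3)
      by (simp add: v_def cinner_diff_left cinner_diff_right cinner_scale_left cinner_scale_right
          vectors_diff vectors_scale e)
  qed
qed

text \<open>The single function \<open>k\<close> carries both given kernels; its values between
  \<open>A\<close> and \<open>C\<close> are irrelevant. Removing the component along one
  \<open>b\<close> in \<open>B\<close> leaves a problem with a smaller \<open>B\<close>, and adding
  the rank one term back undoes the removal. The kernel changes in the induction and is therefore
  arbitrary. For empty \<open>B\<close> the two kernels are put side by side as an orthogonal
  sum.\<close>

lemma amalgamation_finite:
  assumes "finite B"
    and "psd_kernel (A \<union> B) k" "psd_kernel (B \<union> C) k"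
    and "A \<inter> C = {}" "B \<inter> (A \<union> C) = {}"
  shows "\<exists>l. psd_kernel (A \<union> B \<union> C) l \<and>
    (\<forall>x\<in>A \<union> B. \<forall>y\<in>A \<union> B. l x y = k x y) \<and> (\<forall>x\<in>B \<union> C. \<forall>y\<in>B \<union> C. l x y = k x y)"
  using assms
proof (induction B arbitrary: k rule: finite_induct)
  case empty
  let ?l = "\<lambda>x y. (if x \<in> A \<and> y \<in> A then k x y else 0) + (if x \<in> C \<and> y \<in> C then k x y else 0)"
  have "psd_kernel (A \<union> C) ?l"
    using empty by (intro psd_kernel_add psd_kernel_mask) auto
  moreover have "\<forall>x\<in>A. \<forall>y\<in>A. ?l x y = k x y" "\<forall>x\<in>C. \<forall>y\<in>C. ?l x y = k x y"
    using empty by auto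
  ultimately show ?case
    by (metis (no_types, lifting) Un_empty_left Un_empty_right)
next
  case (insert b B)
  define s where "s x y = k x y - k x b * k b y / k b b" for x y
  have psd: "psd_kernel (A \<union> insert b B) k" "psd_kernel (insert b B \<union> C) k"
    by fact+
  have "psd_kernel (A \<union> insert b B) s" "psd_kernel (insert b B \<union> C) s"
    unfolding s_def by (intro psd_kernel_Schur_complement psd; simp)+
  then have "psd_kernel (A \<union> B) s" "psd_kernel (B \<union> C) s"
    by (meson psd_kernel_mono order_refl subset_insertI Un_mono)+
  then obtain l where l: "psd_kernel (A \<union> B \<union> C) l"
      "\<forall>x\<in>A \<union> B. \<forall>y\<in>A \<union> B. l x y = s x y" "\<forall>x\<in>B \<union> C. \<forall>y\<in>B \<union> C. l x y = s x y"
    using insert.IH[of s] insert.prems by blast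
  have bb: "k b b = of_real (Re (k b b))" "0 \<le> Re (k b b)"
    using psd_kernel_diagonal[OF psd(1), of b] by auto
  have herm: "k b x = cnj (k x b)" if "x \<in> A \<union> insert b B \<union> C" for x
    using that psd[THEN psd_kernelD(1), of x b] by blast
  \<comment> \<open>For a vanishing pivot Cauchy-Schwarz annihilates the row and the column of
    \<open>b\<close>, so the rank one term, then 0, still restores \<open>k\<close>.\<close>
  have zero: "k x b = 0 \<and> k b x = 0" if "x \<in> A \<union> insert b B \<union> C" "k b b = 0" for x
  proof -
    have "cmod (k x b) \<le> 0"
      using that psd[THEN psd_kernel_Cauchy_Schwarz, of x b] by auto
    then show ?thesis
      using herm[OF that(1)] by simp
  qed
  \<comment> \<open>Since \<open>b\<close> lies outside \<open>A \<union> B \<union> C\<close>, the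
    first summand vanishes in its row and column, and the rank one term alone produces the values
    there.\<close>
  define l' where "l' x y = (if x \<in> A \<union> B \<union> C \<and> y \<in> A \<union> B \<union> C then l x y else 0)
      + k x b * cnj (k y b) / of_real (Re (k b b))" for x y
  have "psd_kernel (A \<union> insert b B \<union> C) l'"
    unfolding l'_def by (intro psd_kernel_add psd_kernel_mask psd_kernel_rank_one l bb)
  moreover have b: "b \<notin> A \<union> B \<union> C"
    using insert by auto
  have eq: "l' x y = k x y"
    if "x \<in> A \<union> insert b B \<union> C" "y \<in> A \<union> insert b B \<union> C"
      "x \<noteq> b \<Longrightarrow> y \<noteq> b \<Longrightarrow> l x y = s x y" for x y
  proof -
    have "l' x y = (if x \<noteq> b \<and> y \<noteq> b then s x y else 0) + k x b * k b y / k b b"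
      using that b herm[of y] bb(1) by (auto simp: l'_def)
    then show ?thesis
      using zero[OF that(1)] zero[OF that(2)] by (cases "k b b = 0") (auto simp: s_def)
  qed
  moreover have "l' x y = k x y" if "x \<in> A \<union> insert b B" "y \<in> A \<union> insert b B" for x y
    using that l(2) by (intro eq) auto
  moreover have "l' x y = k x y" if "x \<in> insert b B \<union> C" "y \<in> insert b B \<union> C" for x y
    using that l(3) by (intro eq) auto
  ultimately show ?case
    by blast
qed

text \<open>Tychonoff for the product of the discs of radius \<open>M j\<close>. The role of a
  convergent subnet is played by a filter: \<open>F\<close> refined by the preimages of the
  neighbourhoods of a cluster point.\<close>

lemma pointwise_cluster_point:
  fixes f :: "'n \<Rightarrow> 'j \<Rightarrow> complex"
  assumes F: "F \<noteq> bot" and bounded: "\<And>n j. cmod (f n j) \<le> M j"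
  obtains G l where "G \<noteq> bot" "G \<le> F" "\<And>j. ((\<lambda>n. f n j) \<longlongrightarrow> l j) G"
proof -
  let ?P = "PiE UNIV (\<lambda>j. cball 0 (M j)) :: ('j \<Rightarrow> complex) set"
  have "compactin (product_topology (\<lambda>_. euclidean) UNIV) ?P"
    by (subst compactin_PiE) auto
  then have "compact ?P"
    by (simp add: euclidean_product_topology)
  moreover have "filtermap f F \<noteq> bot" "eventually (\<lambda>x. x \<in> ?P) (filtermap f F)"
    using F bounded by (auto simp: filtermap_bot_iff eventually_filtermap PiE_iff intro!: always_eventually)
  ultimately obtain l where l: "inf (nhds l) (filtermap f F) \<noteq> bot"
    unfolding compact_filter by blast
  define G where "G = inf F (filtercomap f (nhds l))"
  have "G \<noteq> bot"
  proof
    assume "G = bot"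
    then have "eventually (\<lambda>_. False) G" by simp
    then obtain P Q where P: "eventually P F" and Q: "eventually Q (filtercomap f (nhds l))"
      and PQ: "\<And>n. P n \<Longrightarrow> Q n \<Longrightarrow> False"
      unfolding G_def eventually_inf by blast
    obtain R where R: "eventually R (nhds l)" "\<And>n. R (f n) \<Longrightarrow> Q n"
      using Q unfolding eventually_filtercomap by blast
    have "eventually (\<lambda>z. \<not> R z) (filtermap f F)"
      unfolding eventually_filtermap using P by eventually_elim (use PQ R in blast)
    then have "eventually (\<lambda>_. False) (inf (nhds l) (filtermap f F))"
      unfolding eventually_inf using R(1) by blast
    then show False
      using l by (simp add: eventually_False)
  qed
  have lim: "(f \<longlongrightarrow> l) G"
    unfolding G_def by (rule filterlim_mono[OF filterlim_filtercomap order_refl]) simp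
  have "((\<lambda>n. f n j) \<longlongrightarrow> l j) G" for j
    using continuous_on_tendsto_compose[OF continuous_on_product_coordinates[where i = j] lim] by simp
  then show ?thesis
    using that[of G l] \<open>G \<noteq> bot\<close> by (simp add: G_def)
qed

text \<open>A bound on the diagonals suffices, because Cauchy-Schwarz bounds the remaining values.
  The domains \<open>S n\<close> may vary, as long as each point of \<open>I\<close> belongs to them
  eventually.\<close>

lemma psd_kernel_cluster_point:
  assumes F: "F \<noteq> bot" and psd: "\<And>n. psd_kernel (S n) (k n)"
    and diag: "\<And>n x. x \<in> S n \<Longrightarrow> Re (k n x x) \<le> m x"
    and S: "\<And>x. x \<in> I \<Longrightarrow> \<forall>\<^sub>F n in F. x \<in> S n"
  obtains G l where "G \<noteq> bot" "G \<le> F" "psd_kernel I l"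
    "\<And>x y. x \<in> I \<Longrightarrow> y \<in> I \<Longrightarrow> ((\<lambda>n. k n x y) \<longlongrightarrow> l x y) G"
proof -
  \<comment> \<open>Off \<open>S n\<close> the values of \<open>k n\<close> are uncontrolled and are
    cut to 0; at a given pair of points the cut is eventually inactive. The absolute values in
    \<open>M\<close> take care of points that lie in no \<open>S n\<close>, where \<open>m\<close>
    may be negative.\<close>
  define f where "f n p = (if fst p \<in> S n \<and> snd p \<in> S n then k n (fst p) (snd p) else 0)" for n p
  define M where "M p = sqrt \<bar>m (fst p)\<bar> * sqrt \<bar>m (snd p)\<bar>" for p
  have "cmod (f n p) \<le> M p" for n p
  proof (cases "fst p \<in> S n \<and> snd p \<in> S n")
    case True
    have "cmod (k n (fst p) (snd p)) \<le> sqrt (Re (k n (fst p) (fst p))) * sqrt (Re (k n (snd p) (snd p)))"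
      using True psd_kernel_Cauchy_Schwarz[OF psd] by blast
    also have "\<dots> \<le> M p"
      unfolding M_def using True diag psd_kernel_diagonal(2)[OF psd]
      by (intro mult_mono real_sqrt_le_mono) (auto intro: order_trans[OF _ abs_ge_self])
    finally show ?thesis using True by (simp add: f_def)
  qed (auto simp: f_def M_def)
  then obtain G l where G: "G \<noteq> bot" "G \<le> F" and l: "\<And>p. ((\<lambda>n. f n p) \<longlongrightarrow> l p) G"
    using pointwise_cluster_point[OF F, of f M] by blast
  have ev: "\<forall>\<^sub>F n in G. x \<in> S n" if "x \<in> I" for x
    using S[OF that] G(2) by (simp add: le_filter_def)
  have lim: "((\<lambda>n. k n x y) \<longlongrightarrow> l (x, y)) G" if "x \<in> I" "y \<in> I" for x y
  proof (rule Lim_transform_eventually[OF l])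
    show "\<forall>\<^sub>F n in G. f n (x, y) = k n x y"
      using ev[OF that(1)] ev[OF that(2)] by eventually_elim (simp add: f_def)
  qed
  have "psd_kernel I (\<lambda>x y. l (x, y))"
    unfolding psd_kernel_def
  proof (intro conjI ballI allI impI)
    fix x y assume xy: "x \<in> I" "y \<in> I"
    have "\<forall>\<^sub>F n in G. k n y x = cnj (k n x y)"
      using ev[OF xy(1)] ev[OF xy(2)] by eventually_elim (rule psd_kernelD(1)[OF psd])
    then have "((\<lambda>n. k n y x) \<longlongrightarrow> cnj (l (x, y))) G"
      using tendsto_cnj[OF lim[OF xy]] by (simp add: tendsto_cong)
    then show "l (y, x) = cnj (l (x, y))"
      using tendsto_unique[OF G(1)] lim[OF xy(2,1)] by blast
  next
    fix xs :: "(complex \<times> 'b) list" assume xs: "snd ` set xs \<subseteq> I"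
    have "\<forall>\<^sub>F n in G. \<forall>x\<in>snd ` set xs. x \<in> S n"
      using ev xs by (intro eventually_ball_finite) auto
    then have "\<forall>\<^sub>F n in G. 0 \<le> Re (kform (k n) xs xs)"
      by eventually_elim (auto intro!: psd_kernelD(2)[OF psd])
    moreover have "((\<lambda>n. Re (kform (k n) xs xs)) \<longlongrightarrow> Re (kform (\<lambda>x y. l (x, y)) xs xs)) G"
      unfolding kform_def case_prod_unfold
      using xs by (intro tendsto_intros tendsto_sum_list lim) auto
    ultimately show "0 \<le> Re (kform (\<lambda>x y. l (x, y)) xs xs)"
      by (intro tendsto_lowerbound[OF _ _ G(1)])
  qed
  with G lim show ?thesis
    using that by blast
qed

text \<open>
  For finite \<open>B\<close> the Schur complements realize the Gram kernel in which \<open>A\<close> and \<open>C\<close> are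
  orthogonal modulo \<open>B\<close>; the general case follows by compactness.
\<close>
proposition amalgamation:
  assumes AB: "psd_kernel (A \<union> B) k" and BC: "psd_kernel (B \<union> C) k"
    and disjoint: "A \<inter> C = {}" "B \<inter> (A \<union> C) = {}"
  obtains l where "psd_kernel (A \<union> B \<union> C) l"
    "\<And>x y. x \<in> A \<union> B \<Longrightarrow> y \<in> A \<union> B \<Longrightarrow> l x y = k x y"
    "\<And>x y. x \<in> B \<union> C \<Longrightarrow> y \<in> B \<union> C \<Longrightarrow> l x y = k x y"
proof -
  have "\<exists>l. psd_kernel (A \<union> (F \<inter> B) \<union> C) l \<and>
    (\<forall>x\<in>A \<union> (F \<inter> B). \<forall>y\<in>A \<union> (F \<inter> B). l x y = k x y) \<and>
    (\<forall>x\<in>(F \<inter> B) \<union> C. \<forall>y\<in>(F \<inter> B) \<union> C. l x y = k x y)" if "finite F" for F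
    using that disjoint
    by (intro amalgamation_finite psd_kernel_mono[OF AB] psd_kernel_mono[OF BC]) auto
  then obtain l where l: "\<And>F. finite F \<Longrightarrow> psd_kernel (A \<union> (F \<inter> B) \<union> C) (l F)"
    "\<And>F x y. finite F \<Longrightarrow> x \<in> A \<union> (F \<inter> B) \<Longrightarrow> y \<in> A \<union> (F \<inter> B) \<Longrightarrow> l F x y = k x y"
    "\<And>F x y. finite F \<Longrightarrow> x \<in> (F \<inter> B) \<union> C \<Longrightarrow> y \<in> (F \<inter> B) \<union> C \<Longrightarrow> l F x y = k x y"
    by metis
  \<comment> \<open>The filter also ranges over infinite sets \<open>F\<close>, about which nothing
    is known; the empty domain makes the requirements on them vacuous.\<close>
  define S where "S F = (if finite F then A \<union> (F \<inter> B) \<union> C else {})" for F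
  have S: "\<forall>\<^sub>F F in finite_subsets_at_top B. x \<in> S F" if "x \<in> A \<union> B \<union> C" for x
  proof -
    have "\<forall>\<^sub>F F in finite_subsets_at_top B. finite F \<and> {x} \<inter> B \<subseteq> F"
      unfolding eventually_finite_subsets_at_top by (intro exI[of _ "{x} \<inter> B"]) auto
    then show ?thesis
      by eventually_elim (use that in \<open>auto simp: S_def\<close>)
  qed
  have psd: "psd_kernel (S F) (l F)" for F
  proof (cases "finite F")
    case False
    then show ?thesis
      by (intro psd_kernelI) (auto simp: S_def)
  qed (simp add: S_def l(1))
  have diag: "Re (l F x x) \<le> Re (k x x)" if "x \<in> S F" for F x
    using that l(2,3)[of F x x] by (auto simp: S_def split: if_splits)
  obtain G l' where G: "G \<noteq> bot" "G \<le> finite_subsets_at_top B" and l': "psd_kernel (A \<union> B \<union> C) l'"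
    "\<And>x y. x \<in> A \<union> B \<union> C \<Longrightarrow> y \<in> A \<union> B \<union> C \<Longrightarrow> ((\<lambda>F. l F x y) \<longlongrightarrow> l' x y) G"
    using psd_kernel_cluster_point[OF finite_subsets_at_top_neq_bot psd diag S] by metis
  have fin: "\<forall>\<^sub>F F in finite_subsets_at_top B. finite F \<and> {x, y} \<inter> B \<subseteq> F" for x y
    unfolding eventually_finite_subsets_at_top by (intro exI[of _ "{x, y} \<inter> B"]) auto
  have eq: "l' x y = k x y"
    if "x \<in> A \<union> B \<union> C" "y \<in> A \<union> B \<union> C" "\<And>F. finite F \<Longrightarrow> {x, y} \<inter> B \<subseteq> F \<Longrightarrow> l F x y = k x y" for x y
  proof -
    have "\<forall>\<^sub>F F in finite_subsets_at_top B. l F x y = k x y"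
      using fin[of x y] by eventually_elim (use that in blast)
    then have "\<forall>\<^sub>F F in G. l F x y = k x y"
      using G(2) by (simp add: le_filter_def)
    then have "((\<lambda>F. l F x y) \<longlongrightarrow> k x y) G"
      by (simp add: tendsto_cong)
    then show ?thesis
      using tendsto_unique[OF G(1) l'(2)] that by blast
  qed
  show ?thesis
  proof (rule that[OF l'(1)])
    show "l' x y = k x y" if "x \<in> A \<union> B" "y \<in> A \<union> B" for x y
      using that by (intro eq l(2)) auto
    show "l' x y = k x y" if "x \<in> B \<union> C" "y \<in> B \<union> C" for x y
      using that by (intro eq l(3)) auto
  qed
qed

section \<open>An invariant dilating kernel\<close>

lemma diff_nonneg_prod: "0 \<le> w - z \<longleftrightarrow> z \<le> (w :: real \<times> real)"
  by (auto simp: less_eq_prod_def)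

text \<open>For Gram vectors \<open>e\<close>, the hypothesis says that \<open>e x - e (g x)\<close>
  is orthogonal to all \<open>e (g y)\<close>, so \<open>e (g x)\<close> is the projection of
  \<open>e x\<close> on their closed span. The difference is the Gram kernel of the
  remainders.\<close>

lemma psd_kernel_projection_defect:
  assumes k: "psd_kernel I k" and J: "J \<subseteq> I" and g: "g \<in> J \<rightarrow> I"
    and proj: "\<And>x y. x \<in> J \<Longrightarrow> y \<in> J \<Longrightarrow> k x (g y) = k (g x) (g y)"
  shows "psd_kernel J (\<lambda>x y. k x y - k (g x) (g y))"
proof -
  obtain K :: "('a \<Rightarrow> complex) cspace" and e where K: "complex_hilbert_space K" "e ` I \<subseteq> vectors K"
    and eK: "\<forall>x\<in>I. \<forall>y\<in>I. cinner K (e x) (e y) = k x y"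
    using kernel_realization[OF k] by blast
  interpret complex_hilbert_space K by (rule K(1))
  have e: "e x \<in> vectors K" if "x \<in> I" for x
    using K(2) that by blast
  have gI: "g x \<in> I" "x \<in> I" if "x \<in> J" for x
    using that g J by blast+
  have v: "psd_kernel J (\<lambda>x y. cinner K (e x - e (g x)) (e y - e (g y)))"
    by (rule psd_kernel_gram) (intro vectors_diff e gI)
  show ?thesis
  proof (rule psd_kernel_cong[OF v])
    fix x y assume xy: "x \<in> J" "y \<in> J"
    have "k (g x) y = cnj (k y (g x))"
      by (rule psd_kernelD(1)[OF k]) (intro gI xy)+
    also have "\<dots> = cnj (k (g y) (g x))"
      using proj[OF xy(2,1)] by simp
    also have "\<dots> = k (g x) (g y)"
      by (rule psd_kernelD(1)[OF k, symmetric]) (intro gI xy)+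
    finally show "k x y - k (g x) (g y) = cinner K (e x - e (g x)) (e y - e (g y))"
      using xy gI[OF xy(1)] gI[OF xy(2)] eK proj[OF xy]
      by (simp add: cinner_diff_left cinner_diff_right vectors_diff e)
  qed
qed

section \<open>Kernels with the values prescribed by a two-parameter family of contractions\<close>

locale contraction_family = complex_inner_space H
  for H :: "('a::ab_group_add) cspace" +
  fixes U :: "real \<times> real \<Rightarrow> 'a \<Rightarrow> 'a"
  assumes U_vectors: "0 \<le> p \<Longrightarrow> h \<in> vectors H \<Longrightarrow> U p h \<in> vectors H"
    and U_add: "0 \<le> p \<Longrightarrow> h \<in> vectors H \<Longrightarrow> h' \<in> vectors H \<Longrightarrow> U p (h + h') = U p h + U p h'"
    and U_scale: "0 \<le> p \<Longrightarrow> h \<in> vectors H \<Longrightarrow> U p (cscale H c h) = cscale H c (U p h)"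
    and U_norm: "0 \<le> p \<Longrightarrow> h \<in> vectors H \<Longrightarrow> hnorm H (U p h) \<le> hnorm H h"
    and U_0: "h \<in> vectors H \<Longrightarrow> U 0 h = h"
    and U_plus: "0 \<le> p \<Longrightarrow> 0 \<le> q \<Longrightarrow> h \<in> vectors H \<Longrightarrow> U (p + q) h = U p (U q h)"
begin

lemma U_diff_vectors: "l \<le> z \<Longrightarrow> h \<in> vectors H \<Longrightarrow> U (z - l) h \<in> vectors H"
  by (simp add: U_vectors diff_nonneg_prod)

lemma U_trans: "l \<le> p \<Longrightarrow> p \<le> z \<Longrightarrow> h \<in> vectors H \<Longrightarrow> U (p - l) (U (z - p) h) = U (z - l) h"
  using U_plus[of "p - l" "z - p" h] by (simp add: diff_nonneg_prod)

lemma U_lincomb: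
  assumes "0 \<le> p" "\<And>x. x \<in> snd ` set xs \<Longrightarrow> e x \<in> vectors H"
  shows "U p (lincomb H e xs) = lincomb H (\<lambda>x. U p (e x)) xs"
  using assms(2)
proof (induction xs)
  case Nil
  show ?case
    using U_scale[OF assms(1) vectors_zero, of 0] by simp
next
  case (Cons q xs)
  then show ?case
    by (simp add: U_add[OF assms(1)] U_scale[OF assms(1)] vectors_scale vectors_lincomb)
qed

text \<open>Positivity of the defect operator of \<open>U p\<close>, expressed without adjoints: by
  linearity the form at a list is the squared norm of \<open>v\<close> minus that of
  \<open>U p v\<close>, for one vector \<open>v\<close>.\<close>

lemma psd_kernel_defect:
  assumes "0 \<le> p" "a \<in> I \<rightarrow> vectors H"
  shows "psd_kernel I (\<lambda>x y. cinner H (a x) (a y) - cinner H (U p (a x)) (U p (a y)))"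
proof (rule psd_kernelI)
  have a: "a x \<in> vectors H" "U p (a x) \<in> vectors H" if "x \<in> I" for x
    using that assms U_vectors by blast+
  show "cinner H (a y) (a x) - cinner H (U p (a y)) (U p (a x))
      = cnj (cinner H (a x) (a y) - cinner H (U p (a x)) (U p (a y)))" if "x \<in> I" "y \<in> I" for x y
    using cinner_commute[OF a(1)[OF that(1)] a(1)[OF that(2)]]
      cinner_commute[OF a(2)[OF that(1)] a(2)[OF that(2)]] by simp
  fix xs :: "(complex \<times> 'b) list" assume xs: "snd ` set xs \<subseteq> I"
  define v where "v = lincomb H a xs"
  have v: "v \<in> vectors H"
    unfolding v_def using xs a by (intro vectors_lincomb) blast
  have Uv: "U p v = lincomb H (\<lambda>x. U p (a x)) xs"
    unfolding v_def using xs a by (intro U_lincomb assms) blast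
  have "kform (\<lambda>x y. cinner H (a x) (a y) - cinner H (U p (a x)) (U p (a y))) xs xs
      = cinner H v v - cinner H (U p v) (U p v)"
    unfolding kform_diff Uv unfolding v_def
    using xs a by (subst (1 2) cinner_lincomb) blast+
  moreover have "Re (cinner H (U p v) (U p v)) \<le> Re (cinner H v v)"
    using power_mono[OF U_norm[OF assms(1) v] hnorm_nonneg[OF U_vectors[OF assms(1) v]], of 2]
    by (simp add: hnorm_sq v U_vectors assms)
  ultimately show "0 \<le> Re (kform (\<lambda>x y. cinner H (a x) (a y) - cinner H (U p (a x)) (U p (a y))) xs xs)"
    by simp
qed

text \<open>In a realization, the vectors over each point form a copy of \<open>H\<close>, and the
  clause says that the vector at \<open>(z, h)\<close> has projection
  \<open>(l, U (z - l) h)\<close> on the copy over any \<open>l \<le> z\<close>. Pairs in the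
  opposite order follow by hermitian symmetry; incomparable pairs are unconstrained.\<close>

definition dilates :: "(real \<times> real) set \<Rightarrow> ((real \<times> real) \<times> 'a \<Rightarrow> (real \<times> real) \<times> 'a \<Rightarrow> complex) \<Rightarrow> bool" where
  "dilates S k \<longleftrightarrow> psd_kernel (S \<times> vectors H) k \<and>
     (\<forall>z\<in>S. \<forall>l\<in>S. l \<le> z \<longrightarrow> (\<forall>h\<in>vectors H. \<forall>h'\<in>vectors H. k (z, h) (l, h') = cinner H (U (z - l) h) h'))"

lemma dilates_psd: "dilates S k \<Longrightarrow> psd_kernel (S \<times> vectors H) k"
  by (simp add: dilates_def)

lemma dilates_ge:
  "dilates S k \<Longrightarrow> z \<in> S \<Longrightarrow> l \<in> S \<Longrightarrow> l \<le> z \<Longrightarrow> h \<in> vectors H \<Longrightarrow> h' \<in> vectors H \<Longrightarrow>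
     k (z, h) (l, h') = cinner H (U (z - l) h) h'"
  by (simp add: dilates_def)

lemma dilates_le:
  assumes "dilates S k" "z \<in> S" "l \<in> S" "l \<le> z" "h \<in> vectors H" "h' \<in> vectors H"
  shows "k (l, h) (z, h') = cinner H h (U (z - l) h')"
proof -
  have "k (l, h) (z, h') = cnj (k (z, h') (l, h))"
    by (rule psd_kernelD(1)[OF dilates_psd[OF assms(1)]]) (use assms in simp_all)
  also have "\<dots> = cnj (cinner H (U (z - l) h') h)"
    by (simp add: dilates_ge[OF assms(1-4,6,5)])
  also have "\<dots> = cinner H h (U (z - l) h')"
    using cinner_commute[OF U_diff_vectors[OF assms(4,6)] assms(5)] by simp
  finally show ?thesis .
qed

lemma dilates_same:
  "dilates S k \<Longrightarrow> z \<in> S \<Longrightarrow> h \<in> vectors H \<Longrightarrow> h' \<in> vectors H \<Longrightarrow> k (z, h) (z, h') = cinner H h h'"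
  by (simp add: dilates_ge U_0)

lemma dilates_mono: "dilates S k \<Longrightarrow> R \<subseteq> S \<Longrightarrow> dilates R k"
  unfolding dilates_def by (meson Sigma_mono order_refl psd_kernel_mono subsetD)

text \<open>The values that the new point \<open>p\<close> forces. The last branch is meaningful
  only for \<open>fst x \<le> fst y\<close>; the function is used as a kernel only where
  \<open>p\<close> is comparable with all other points or absent.\<close>

definition extend ::
  "real \<times> real \<Rightarrow> ((real \<times> real) \<times> 'a \<Rightarrow> (real \<times> real) \<times> 'a \<Rightarrow> complex) \<Rightarrow>
     (real \<times> real) \<times> 'a \<Rightarrow> (real \<times> real) \<times> 'a \<Rightarrow> complex" where
  "extend p k x y =
     (if fst x \<noteq> p \<and> fst y \<noteq> p then k x y
      else if fst y \<le> fst x then cinner H (U (fst x - fst y) (snd x)) (snd y)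
      else cinner H (snd x) (U (fst y - fst x) (snd y)))"

lemma extend_other: "z \<noteq> p \<Longrightarrow> l \<noteq> p \<Longrightarrow> extend p k (z, h) (l, h') = k (z, h) (l, h')"
  by (simp add: extend_def)

lemma extend_ge:
  "z = p \<or> l = p \<Longrightarrow> l \<le> z \<Longrightarrow> extend p k (z, h) (l, h') = cinner H (U (z - l) h) h'"
  by (auto simp: extend_def)

lemma extend_le:
  "z = p \<or> l = p \<Longrightarrow> l \<le> z \<Longrightarrow> h \<in> vectors H \<Longrightarrow> h' \<in> vectors H \<Longrightarrow>
     extend p k (l, h) (z, h') = cinner H h (U (z - l) h')"
  by (cases "z = l") (auto simp: extend_def U_0)

lemma dilates_extend:
  assumes k: "dilates S k" and psd: "psd_kernel (insert p S \<times> vectors H) (extend p k)"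
  shows "dilates (insert p S) (extend p k)"
  unfolding dilates_def
proof (intro conjI ballI impI psd)
  fix z l h h' assume "z \<in> insert p S" "l \<in> insert p S" "l \<le> z" "h \<in> vectors H" "h' \<in> vectors H"
  then show "extend p k (z, h) (l, h') = cinner H (U (z - l) h) h'"
    by (cases "z = p \<or> l = p") (auto simp: extend_ge extend_other dilates_ge[OF k])
qed

text \<open>With \<open>r\<close> the greatest element of \<open>L\<close>, the vector at
  \<open>(p, h)\<close> is taken to be the one at \<open>(r, U (p - r) h)\<close> plus a new vector
  orthogonal to everything over \<open>L\<close>, the new vectors having the defect of
  \<open>U (p - r)\<close> as Gram kernel. Values at lower points come out right because
  \<open>U (r - l) (U (p - r) h) = U (p - l) h\<close>.\<close>

lemma dilates_extend_top:
  assumes k: "dilates L k" and p: "p \<notin> L" and le: "\<And>l. l \<in> L \<Longrightarrow> l \<le> p"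
    and max: "L = {} \<or> (\<exists>r\<in>L. \<forall>l\<in>L. l \<le> r)"
  shows "dilates (insert p L) (extend p k)"
proof (rule dilates_extend[OF k])
  show "psd_kernel (insert p L \<times> vectors H) (extend p k)"
  proof (cases "L = {}")
    case True
    have "psd_kernel (insert p L \<times> vectors H) (\<lambda>x y. cinner H (snd x) (snd y))"
      by (rule psd_kernel_gram) auto
    then show ?thesis
      by (rule psd_kernel_cong) (auto simp: True extend_def U_0)
  next
    case False
    then obtain r where r: "r \<in> L" "\<And>l. l \<in> L \<Longrightarrow> l \<le> r"
      using max by blast
    note rp = le[OF r(1)]
    have pr: "0 \<le> p - r"
      using rp by (simp add: diff_nonneg_prod)
    define \<psi> where "\<psi> x = (if fst x = p then (r, U (p - r) (snd x)) else x)" for x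
    let ?d = "\<lambda>x y. cinner H (snd x) (snd y) - cinner H (U (p - r) (snd x)) (U (p - r) (snd y))"
    let ?A = "{p} \<times> vectors H"
    have "psd_kernel (insert p L \<times> vectors H)
      (\<lambda>x y. k (\<psi> x) (\<psi> y) + (if x \<in> ?A \<and> y \<in> ?A then ?d x y else 0))"
    proof (intro psd_kernel_add psd_kernel_mask psd_kernel_defect pr)
      show "psd_kernel (insert p L \<times> vectors H) (\<lambda>x y. k (\<psi> x) (\<psi> y))"
        by (rule psd_kernel_pullback[OF dilates_psd[OF k]])
          (use r p rp in \<open>auto simp: \<psi>_def U_diff_vectors split: if_splits\<close>)
    qed auto
    then show ?thesis
    proof (rule psd_kernel_cong)
      fix x y assume xy: "x \<in> insert p L \<times> vectors H" "y \<in> insert p L \<times> vectors H"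
      obtain z h l h' where x: "x = (z, h)" and y: "y = (l, h')"
        by (metis surj_pair)
      have v: "h \<in> vectors H" "h' \<in> vectors H" "U (p - r) h \<in> vectors H" "U (p - r) h' \<in> vectors H"
        using xy x y rp by (auto intro: U_diff_vectors)
      consider "z = p" "l = p" | "z = p" "l \<in> L" "l \<noteq> p" | "z \<in> L" "z \<noteq> p" "l = p"
        | "z \<in> L" "l \<in> L" "z \<noteq> p" "l \<noteq> p"
        using xy x y p by auto
      then show "extend p k x y = k (\<psi> x) (\<psi> y) + (if x \<in> ?A \<and> y \<in> ?A then ?d x y else 0)"
      proof cases
        case 1
        then show ?thesis
          using v r by (simp add: x y \<psi>_def extend_ge U_0 dilates_same[OF k])
      next
        case 2
        then show ?thesis
          using v r le by (simp add: x y \<psi>_def extend_ge dilates_ge[OF k] U_trans rp)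
      next
        case 3
        then show ?thesis
          using v r le by (simp add: x y \<psi>_def extend_le dilates_le[OF k] U_trans rp)
      next
        case 4
        then show ?thesis
          by (simp add: x y \<psi>_def extend_other)
      qed
    qed
  qed
qed

text \<open>
  The extended kernel is the Gram kernel obtained by writing the vector at \<open>(u, h)\<close>, \<open>u \<in> V\<close>,
  as the vector at \<open>(p, U (u - p) h)\<close> plus a remainder orthogonal to everything at or below \<open>p\<close>.
\<close>
lemma dilates_extend_between:
  assumes k: "dilates (V \<union> L) k" and p: "p \<notin> V \<union> L"
    and ge: "\<And>u. u \<in> V \<Longrightarrow> p \<le> u" and le: "\<And>l. l \<in> L \<Longrightarrow> l \<le> p"
    and min: "V = {} \<or> (\<exists>q\<in>V. \<forall>u\<in>V. q \<le> u)"
    and max: "L = {} \<or> (\<exists>r\<in>L. \<forall>l\<in>L. l \<le> r)"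
  shows "dilates (insert p (V \<union> L)) (extend p k)"
proof (rule dilates_extend[OF k])
  let ?B = "V \<times> vectors H"
  define a where "a x = U (fst x - p) (snd x)" for x
  \<comment> \<open>Positivity of the remainder over \<open>p\<close>, in two stages through the
    least element \<open>q\<close> of \<open>V\<close>: first the defect of the projection on the
    copy of \<open>H\<close> over \<open>q\<close>, then the contraction defect of
    \<open>U (q - p)\<close>. Their sum is the remainder because
    \<open>U (q - p) (b x) = a x\<close>.\<close>
  have psd_V: "psd_kernel ?B (\<lambda>x y. k x y - cinner H (a x) (a y))"
  proof (cases "V = {}")
    case True
    then show ?thesis
      by (intro psd_kernelI) auto
  next
    case False
    then obtain q where q: "q \<in> V" "\<And>u. u \<in> V \<Longrightarrow> q \<le> u"
      using min by blast
    note pq = ge[OF q(1)]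
    define b where "b x = U (fst x - q) (snd x)" for x
    have b: "b x \<in> vectors H" if "x \<in> ?B" for x
      using that q(2) by (auto simp: b_def U_diff_vectors)
    have kb: "k x (q, v) = cinner H (b x) v" if "x \<in> ?B" "v \<in> vectors H" for x v
      using that q by (auto simp: b_def dilates_ge[OF k])
    have qq: "k (q, v) (q, v') = cinner H v v'" if "v \<in> vectors H" "v' \<in> vectors H" for v v'
      using that q by (simp add: dilates_same[OF k])
    have "psd_kernel ?B (\<lambda>x y. k x y - k (q, b x) (q, b y))"
    proof (rule psd_kernel_projection_defect[OF dilates_psd[OF k]])
      show "(\<lambda>x. (q, b x)) \<in> ?B \<rightarrow> (V \<union> L) \<times> vectors H"
        using b q by blast
      show "k x (q, b y) = k (q, b x) (q, b y)" if "x \<in> ?B" "y \<in> ?B" for x y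
        unfolding kb[OF that(1) b[OF that(2)]] qq[OF b[OF that(1)] b[OF that(2)]] ..
    qed blast
    moreover have "psd_kernel ?B
        (\<lambda>x y. cinner H (b x) (b y) - cinner H (U (q - p) (b x)) (U (q - p) (b y)))"
      using pq b by (intro psd_kernel_defect) (auto simp: diff_nonneg_prod)
    ultimately have "psd_kernel ?B (\<lambda>x y. k x y - k (q, b x) (q, b y)
        + (cinner H (b x) (b y) - cinner H (U (q - p) (b x)) (U (q - p) (b y))))"
      by (rule psd_kernel_add)
    then show ?thesis
    proof (rule psd_kernel_cong)
      fix x y assume xy: "x \<in> ?B" "y \<in> ?B"
      have "U (q - p) (b z) = a z" if "z \<in> ?B" for z
        using that q pq by (auto simp: a_def b_def U_trans)
      then show "k x y - cinner H (a x) (a y) = k x y - k (q, b x) (q, b y)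
          + (cinner H (b x) (b y) - cinner H (U (q - p) (b x)) (U (q - p) (b y)))"
        using xy b by (simp add: qq)
    qed
  qed
  define k0 where "k0 = extend p k"
  have k0: "dilates (insert p L) k0"
    unfolding k0_def using k p le max by (intro dilates_extend_top) (auto elim: dilates_mono)
  \<comment> \<open>Points of \<open>V\<close> are sent down to their components over
    \<open>p\<close>, where the kernel \<open>k0\<close> with top point \<open>p\<close> is already
    available; the remainder over \<open>V\<close> is added separately.\<close>
  define \<psi> where "\<psi> x = (if fst x \<in> V then (p, a x) else x)" for x
  have "psd_kernel (insert p (V \<union> L) \<times> vectors H)
      (\<lambda>x y. k0 (\<psi> x) (\<psi> y) + (if x \<in> ?B \<and> y \<in> ?B then k x y - cinner H (a x) (a y) else 0))"
  proof (intro psd_kernel_add psd_kernel_mask psd_V)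
    show "psd_kernel (insert p (V \<union> L) \<times> vectors H) (\<lambda>x y. k0 (\<psi> x) (\<psi> y))"
      by (rule psd_kernel_pullback[OF dilates_psd[OF k0]])
        (use ge in \<open>auto simp: \<psi>_def a_def U_diff_vectors U_0 split: if_splits\<close>)
  qed
  then show "psd_kernel (insert p (V \<union> L) \<times> vectors H) (extend p k)"
  proof (rule psd_kernel_cong)
    fix x y assume xy: "x \<in> insert p (V \<union> L) \<times> vectors H" "y \<in> insert p (V \<union> L) \<times> vectors H"
    obtain z h l h' where x: "x = (z, h)" and y: "y = (l, h')"
      by (metis surj_pair)
    have v: "h \<in> vectors H" "h' \<in> vectors H"
      using xy x y by auto
    have aV: "U (u - p) h \<in> vectors H" "U (u - p) h' \<in> vectors H" if "u \<in> V" for u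
      using U_diff_vectors[OF ge[OF that]] v by blast+
    have pV: "p \<notin> V" using p by blast
    have zl: "z \<in> V \<or> z \<in> insert p L \<and> z \<notin> V" "l \<in> V \<or> l \<in> insert p L \<and> l \<notin> V"
      using xy x y by auto
    then consider "z \<in> V" "l \<in> V" | "z \<in> V" "l \<in> insert p L" "l \<notin> V"
      | "z \<in> insert p L" "z \<notin> V" "l \<in> V" | "z \<in> insert p L" "l \<in> insert p L" "z \<notin> V" "l \<notin> V"
      by blast
    then show "extend p k x y = k0 (\<psi> x) (\<psi> y)
        + (if x \<in> ?B \<and> y \<in> ?B then k x y - cinner H (a x) (a y) else 0)"
    proof cases
      case 1
      then have "z \<noteq> p" "l \<noteq> p" using pV by auto
      then show ?thesis
        using 1 v aV by (simp add: x y \<psi>_def a_def extend_other dilates_same[OF k0])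
    next
      case 2
      then have le': "l \<le> p" "p \<le> z" "z \<noteq> p" using pV ge[of z] le[of l] by auto
      have "extend p k x y = cinner H (U (z - l) h) h'"
      proof (cases "l = p")
        case False
        then show ?thesis
          using 2 le' v order_trans[OF le'(1,2)] by (simp add: x y extend_other dilates_ge[OF k])
      qed (use le' in \<open>simp add: x y extend_ge\<close>)
      then show ?thesis
        using 2 le' v aV by (simp add: x y \<psi>_def a_def dilates_ge[OF k0] U_trans)
    next
      case 3
      then have le': "z \<le> p" "p \<le> l" "l \<noteq> p" using pV ge[of l] le[of z] by auto
      have "extend p k x y = cinner H h (U (l - z) h')"
      proof (cases "z = p")
        case False
        then show ?thesis
          using 3 le' v order_trans[OF le'(1,2)] by (simp add: x y extend_other dilates_le[OF k])
      qed (use le' v in \<open>simp add: x y extend_le\<close>)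
      then show ?thesis
        using 3 le' v aV by (simp add: x y \<psi>_def a_def dilates_le[OF k0] U_trans)
    next
      case 4
      then show ?thesis
        by (simp add: x y \<psi>_def k0_def)
    qed
  qed
qed

text \<open>The points of \<open>S\<close> comparable with \<open>p\<close> form the common part of
  an amalgamation, with \<open>p\<close> alone on one side and the incomparable points on the other.
  No value is prescribed across the two sides, so whatever the amalgamation puts there is
  admissible.\<close>

lemma dilates_insert:
  assumes k: "dilates S k" and p: "p \<notin> S"
    and min: "(\<forall>u\<in>S. \<not> p \<le> u) \<or> (\<exists>q\<in>S. p \<le> q \<and> (\<forall>u\<in>S. p \<le> u \<longrightarrow> q \<le> u))"
    and max: "(\<forall>l\<in>S. \<not> l \<le> p) \<or> (\<exists>r\<in>S. r \<le> p \<and> (\<forall>l\<in>S. l \<le> p \<longrightarrow> l \<le> r))"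
  shows "\<exists>k'. dilates (insert p S) k'"
proof -
  define V L where "V = {u\<in>S. p \<le> u}" and "L = {l\<in>S. l \<le> p}"
  have VL: "V \<union> L \<subseteq> S"
    by (auto simp: V_def L_def)
  have ext: "dilates (insert p (V \<union> L)) (extend p k)"
  proof (rule dilates_extend_between[OF dilates_mono[OF k VL]])
    show "p \<notin> V \<union> L"
      using p VL by blast
    show "V = {} \<or> (\<exists>q\<in>V. \<forall>u\<in>V. q \<le> u)" "L = {} \<or> (\<exists>r\<in>L. \<forall>l\<in>L. l \<le> r)"
      using min max unfolding V_def L_def by blast+
  qed (simp_all add: V_def L_def)
  let ?A = "{p} \<times> vectors H" and ?B = "(V \<union> L) \<times> vectors H" and ?C = "(S - (V \<union> L)) \<times> vectors H"
  have BC: "?B \<union> ?C = S \<times> vectors H" and AB: "?A \<union> ?B = insert p (V \<union> L) \<times> vectors H"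
    using VL by auto
  have eq: "extend p k x y = k x y" if "x \<in> S \<times> vectors H" "y \<in> S \<times> vectors H" for x y
    using that p by (auto simp: extend_def)
  have "psd_kernel (?A \<union> ?B) (extend p k)"
    unfolding AB by (rule dilates_psd[OF ext])
  moreover have "psd_kernel (?B \<union> ?C) (extend p k)"
    unfolding BC by (rule psd_kernel_cong[OF dilates_psd[OF k] eq])
  moreover have "?A \<inter> ?C = {}" "?B \<inter> (?A \<union> ?C) = {}"
    using p VL by blast+
  ultimately obtain k' where k': "psd_kernel (?A \<union> ?B \<union> ?C) k'"
    "\<And>x y. x \<in> ?A \<union> ?B \<Longrightarrow> y \<in> ?A \<union> ?B \<Longrightarrow> k' x y = extend p k x y"
    "\<And>x y. x \<in> ?B \<union> ?C \<Longrightarrow> y \<in> ?B \<union> ?C \<Longrightarrow> k' x y = extend p k x y"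
    by (rule amalgamation) (rule that)
  have "dilates (insert p S) k'"
    unfolding dilates_def
  proof (intro conjI ballI impI)
    have "?A \<union> ?B \<union> ?C = insert p S \<times> vectors H"
      using VL by auto
    then show "psd_kernel (insert p S \<times> vectors H) k'"
      using k'(1) by simp
    fix z l h h' assume zl: "z \<in> insert p S" "l \<in> insert p S" "l \<le> z" and h: "h \<in> vectors H" "h' \<in> vectors H"
    show "k' (z, h) (l, h') = cinner H (U (z - l) h) h'"
    proof (cases "z \<in> S \<and> l \<in> S")
      case True
      then have "k' (z, h) (l, h') = k (z, h) (l, h')"
        using k'(3)[unfolded BC] eq h by simp
      then show ?thesis
        using True zl h by (simp add: dilates_ge[OF k])
    next
      case False
      then have "z \<in> insert p (V \<union> L)" "l \<in> insert p (V \<union> L)"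
        using zl by (auto simp: V_def L_def)
      then show ?thesis
        using k'(2)[unfolded AB] zl h by (simp add: dilates_ge[OF ext])
    qed
  qed
  then show ?thesis by blast
qed

text \<open>
  Each row is added on top of the grid and filled from right to left: then the points below a
  new point have a greatest element, and the points above it have a least one.
\<close>
lemma dilates_grid:
  fixes X Y :: "real set"
  assumes "finite X" "finite Y"
  shows "\<exists>k. dilates (X \<times> Y) k"
  using assms(2)
proof (induction Y rule: finite_linorder_max_induct)
  case empty
  have "dilates {} (\<lambda>x y. 0)"
    unfolding dilates_def by (auto intro!: psd_kernelI)
  then show ?case by auto
next
  case (insert y Y)
  note finY = insert.hyps(1)
  have Yy: "a < y" if "a \<in> Y" for a
    using insert.hyps(2) that by blast
  \<comment> \<open>The filled part \<open>X'\<close> of the new row is upward closed in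
    \<open>X\<close>. The induction adds a new minimum \<open>b\<close> in each step, that is, it
    runs from right to left.\<close>
  have "\<exists>k. dilates (X \<times> Y \<union> X' \<times> {y}) k"
    if "finite X'" "X' \<subseteq> X" "\<And>x x'. x \<in> X \<Longrightarrow> x' \<in> X' \<Longrightarrow> x' \<le> x \<Longrightarrow> x \<in> X'" for X'
    using that
  proof (induction X' rule: finite_linorder_min_induct)
    case empty
    then show ?case using insert.IH by simp
  next
    case (insert b A)
    have bA: "b < a" if "a \<in> A" for a
      using insert.hyps(2) that by blast
    have up: "x \<in> A" if "x \<in> X" "x' \<in> A" "x' \<le> x" for x x'
      using insert.prems(2)[of x x'] bA[OF that(2)] that by simp
    let ?S = "X \<times> Y \<union> A \<times> {y}"
    have "\<exists>k. dilates ?S k"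
    proof (rule insert.IH)
      show "A \<subseteq> X"
        using insert.prems(1) by simp
    qed (rule up)
    then obtain k where k: "dilates ?S k"
      by blast
    have "\<exists>k'. dilates (Set.insert (b, y) ?S) k'"
    proof (rule dilates_insert[OF k])
      show "(b, y) \<notin> ?S"
        using bA[of b] Yy[of y] by auto
      show "(\<forall>u\<in>?S. \<not> (b, y) \<le> u) \<or> (\<exists>q\<in>?S. (b, y) \<le> q \<and> (\<forall>u\<in>?S. (b, y) \<le> u \<longrightarrow> q \<le> u))"
      proof (cases "A = {}")
        case True
        have "\<not> (b, y) \<le> u" if "u \<in> ?S" for u
          using that True Yy[of "snd u"] by (cases u) (simp add: not_le)
        then show ?thesis by (intro disjI1 ballI)
      next
        case False
        then have q: "Min A \<in> A"
          using insert.hyps(1) by simp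
        \<comment> \<open>Above the new point there is only the filled part of its own row, as all
          other rows are lower.\<close>
        have least: "(Min A, y) \<le> u" if "u \<in> ?S" "(b, y) \<le> u" for u
        proof -
          have "fst u \<in> A \<and> snd u = y"
            using that Yy[of "snd u"] by (cases u) auto
          then show ?thesis
            using insert.hyps(1) by (cases u) simp
        qed
        have "(Min A, y) \<in> ?S" "(b, y) \<le> (Min A, y)"
          using q bA[OF q] by simp_all
        with least show ?thesis
          by (intro disjI2 bexI[of _ "(Min A, y)"] conjI ballI impI)
      qed
      show "(\<forall>l\<in>?S. \<not> l \<le> (b, y)) \<or> (\<exists>r\<in>?S. r \<le> (b, y) \<and> (\<forall>l\<in>?S. l \<le> (b, y) \<longrightarrow> l \<le> r))"
      proof (cases "Y = {}")
        case True
        have "\<not> l \<le> (b, y)" if "l \<in> ?S" for l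
          using that True bA[of "fst l"] by (cases l) (simp add: not_le)
        then show ?thesis by (intro disjI1 ballI)
      next
        case False
        then have r: "Max Y \<in> Y"
          using finY by simp
        \<comment> \<open>The filled part of the row lies strictly to the right, so points below
          \<open>(b, y)\<close> belong to older rows. These rows are complete and contain the column
          \<open>b\<close>.\<close>
        have greatest: "l \<le> (b, Max Y)" if "l \<in> ?S" "l \<le> (b, y)" for l
        proof -
          have "snd l \<in> Y"
            using that bA[of "fst l"] by (cases l) auto
          then show ?thesis
            using finY that by (cases l) simp
        qed
        have "(b, Max Y) \<in> ?S" "(b, Max Y) \<le> (b, y)"
          using r Yy[OF r] insert.prems(1) by simp_all
        with greatest show ?thesis
          by (intro disjI2 bexI[of _ "(b, Max Y)"] conjI ballI impI)
      qed
    qed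
    moreover have "Set.insert (b, y) ?S = X \<times> Y \<union> Set.insert b A \<times> {y}"
      by auto
    ultimately show ?case by (simp only:)
  qed
  from this[OF assms(1) order_refl] have "\<exists>k. dilates (X \<times> Y \<union> X \<times> {y}) k"
    by blast
  moreover have "X \<times> Y \<union> X \<times> {y} = X \<times> Set.insert y Y"
    by auto
  ultimately show ?case by (simp only:)
qed

text \<open>The diagonal is prescribed and thus bounded uniformly in \<open>n\<close>, which gives
  compactness; the other prescribed values are eventually constant and persist in the limit.\<close>

lemma dilates_cluster_point:
  assumes F: "F \<noteq> bot" and k: "\<And>n. dilates (S n) (k n)" and S: "\<And>z. \<forall>\<^sub>F n in F. z \<in> S n"
  obtains G l where "G \<noteq> bot" "G \<le> F" "dilates UNIV l"
    "\<And>x y. x \<in> UNIV \<times> vectors H \<Longrightarrow> y \<in> UNIV \<times> vectors H \<Longrightarrow> ((\<lambda>n. k n x y) \<longlongrightarrow> l x y) G"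
proof -
  have diag: "Re (k n x x) \<le> Re (cinner H (snd x) (snd x))" if "x \<in> S n \<times> vectors H" for n x
    using that by (auto simp: dilates_same[OF k])
  have ev: "\<forall>\<^sub>F n in F. x \<in> S n \<times> vectors H" if "x \<in> UNIV \<times> vectors H" for x
    using S[of "fst x"] by eventually_elim (use that in auto)
  obtain G l where G: "G \<noteq> bot" "G \<le> F" and l: "psd_kernel (UNIV \<times> vectors H) l"
    "\<And>x y. x \<in> UNIV \<times> vectors H \<Longrightarrow> y \<in> UNIV \<times> vectors H \<Longrightarrow> ((\<lambda>n. k n x y) \<longlongrightarrow> l x y) G"
    by (rule psd_kernel_cluster_point[OF F dilates_psd[OF k], where I = "UNIV \<times> vectors H", OF diag ev];
      (assumption | rule that))
  have "dilates UNIV l"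
    unfolding dilates_def
  proof (intro conjI l(1) ballI impI)
    fix z l' :: "real \<times> real" and h h' assume zl: "l' \<le> z" "h \<in> vectors H" "h' \<in> vectors H"
    have "\<forall>\<^sub>F n in F. k n (z, h) (l', h') = cinner H (U (z - l') h) h'"
      using S[of z] S[of l'] by eventually_elim (simp add: dilates_ge[OF k] zl)
    then have "\<forall>\<^sub>F n in G. k n (z, h) (l', h') = cinner H (U (z - l') h) h'"
      using G(2) by (simp add: le_filter_def)
    then have "((\<lambda>n. k n (z, h) (l', h')) \<longlongrightarrow> cinner H (U (z - l') h) h') G"
      by (simp add: tendsto_cong)
    then show "l (z, h) (l', h') = cinner H (U (z - l') h) h'"
      using tendsto_unique[OF G(1) l(2)] zl by blast
  qed
  with G l show ?thesis
    using that by blast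
qed

text \<open>Square grids over one finite set of reals are directed by inclusion, and a point belongs
  to the grid as soon as both of its coordinates belong to the set.\<close>

lemma dilates_UNIV: "\<exists>k. dilates UNIV k"
proof -
  have "\<exists>k. finite Z \<longrightarrow> dilates (Z \<times> Z) k" for Z
    using dilates_grid[of Z Z] by blast
  then obtain k where k: "\<And>Z. finite Z \<Longrightarrow> dilates (Z \<times> Z) (k Z)"
    by metis
  define S where "S Z = (if finite Z then Z \<times> Z else {})" for Z :: "real set"
  have S: "dilates (S Z) (k Z)" for Z
  proof (cases "finite Z")
    case False
    then show ?thesis
      unfolding dilates_def by (auto simp: S_def intro!: psd_kernelI)
  qed (simp add: S_def k)
  have ev: "\<forall>\<^sub>F Z in finite_subsets_at_top UNIV. z \<in> S Z" for z
    unfolding eventually_finite_subsets_at_top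
    by (intro exI[of _ "{fst z, snd z}"]) (auto simp: S_def mem_Times_iff)
  show ?thesis
    by (rule dilates_cluster_point[OF finite_subsets_at_top_neq_bot S ev]) (rule exI)
qed

section \<open>Averaging over translates\<close>

definition shift :: "real \<times> real \<Rightarrow> (real \<times> real) \<times> 'a \<Rightarrow> (real \<times> real) \<times> 'a" where
  "shift a x = (fst x + a, snd x)"

definition shift_invariant ::
  "real \<times> real \<Rightarrow> ((real \<times> real) \<times> 'a \<Rightarrow> (real \<times> real) \<times> 'a \<Rightarrow> complex) \<Rightarrow> bool" where
  "shift_invariant a k \<longleftrightarrow>
     (\<forall>x\<in>UNIV \<times> vectors H. \<forall>y\<in>UNIV \<times> vectors H. k (shift a x) (shift a y) = k x y)"

lemma shift_invariantD:
  "shift_invariant a k \<Longrightarrow> x \<in> UNIV \<times> vectors H \<Longrightarrow> y \<in> UNIV \<times> vectors H \<Longrightarrow>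
     k (shift a x) (shift a y) = k x y"
  unfolding shift_invariant_def by blast

lemma shift_shift: "shift a (shift b x) = shift (a + b) x"
  by (simp add: shift_def add_ac)

lemma shift_carrier [simp]: "shift a x \<in> UNIV \<times> vectors H \<longleftrightarrow> x \<in> UNIV \<times> vectors H"
  by (simp add: shift_def mem_Times_iff)

text \<open>The prescribed values depend on \<open>z - l\<close> only, so each translate of
  \<open>k\<close> is admissible, and so is a convex combination of translates.\<close>

lemma dilates_average:
  assumes k: "dilates UNIV k"
  shows "dilates UNIV (\<lambda>x y. of_real (1 / real (Suc n)) *
    (\<Sum>i<Suc n. k (shift (real i *\<^sub>R a) x) (shift (real i *\<^sub>R a) y)))" (is "dilates UNIV ?l")
  unfolding dilates_def
proof (intro conjI ballI impI)
  show "psd_kernel (UNIV \<times> vectors H) ?l"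
    by (intro psd_kernel_scale psd_kernel_sum psd_kernel_pullback[OF dilates_psd[OF k]])
      (auto simp: shift_def)
  fix z l :: "real \<times> real" and h h' assume zl: "l \<le> z" "h \<in> vectors H" "h' \<in> vectors H"
  have "k (shift b (z, h)) (shift b (l, h')) = cinner H (U (z - l) h) h'" for b
    using zl by (simp add: shift_def dilates_ge[OF k] less_eq_prod_def)
  then show "?l (z, h) (l, h') = cinner H (U (z - l) h) h'"
    by (simp del: of_nat_Suc)
qed

text \<open>Cesaro means over the translates by multiples of \<open>a\<close>. A further shift by
  \<open>a\<close> exchanges one term of the mean for another, a change of at most
  \<open>2 * B / (n + 1)\<close>, so cluster points are invariant. Translations commute, hence
  invariance under \<open>b\<close> survives, and several translations can be treated in
  turn.\<close>

lemma dilates_shift_invariant: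
  assumes k: "dilates UNIV k"
  obtains l where "dilates UNIV l" "shift_invariant a l" "\<And>b. shift_invariant b k \<Longrightarrow> shift_invariant b l"
proof -
  define s where "s i x y = k (shift (real i *\<^sub>R a) x) (shift (real i *\<^sub>R a) y)" for i x y
  define m where "m n x y = of_real (1 / real (Suc n)) * (\<Sum>i<Suc n. s i x y)" for n x y
  have m: "dilates UNIV (m n)" for n
    unfolding m_def s_def by (rule dilates_average[OF k])
  obtain G l where G: "G \<noteq> bot" "G \<le> sequentially" and l: "dilates UNIV l"
    and lim: "\<And>x y. x \<in> UNIV \<times> vectors H \<Longrightarrow> y \<in> UNIV \<times> vectors H \<Longrightarrow> ((\<lambda>n. m n x y) \<longlongrightarrow> l x y) G"
    by (rule dilates_cluster_point[OF sequentially_bot m]) (simp, rule that)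
  show ?thesis
  proof (rule that[OF l])
    show "shift_invariant a l"
      unfolding shift_invariant_def
    proof (intro ballI)
      fix x y :: "(real \<times> real) \<times> 'a" assume xy: "x \<in> UNIV \<times> vectors H" "y \<in> UNIV \<times> vectors H"
      define B where "B = hnorm H (snd x) * hnorm H (snd y)"
      have bound: "cmod (s i x y) \<le> B" for i
        using psd_kernel_Cauchy_Schwarz[OF dilates_psd[OF k], of "shift (real i *\<^sub>R a) x" "shift (real i *\<^sub>R a) y"] xy
        by (auto simp: s_def B_def shift_def hnorm_def dilates_same[OF k])
      have "m n (shift a x) (shift a y) - m n x y = of_real (1 / real (Suc n)) * (s (Suc n) x y - s 0 x y)" for n
      proof -
        have "s i (shift a x) (shift a y) = s (Suc i) x y" for i
          by (simp add: s_def shift_shift algebra_simps)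
        then have "(\<Sum>i<Suc n. s i (shift a x) (shift a y)) - (\<Sum>i<Suc n. s i x y)
            = (\<Sum>i<Suc n. s (Suc i) x y - s i x y)"
          by (simp add: sum_subtractf)
        also have "\<dots> = s (Suc n) x y - s 0 x y"
          by (rule sum_lessThan_telescope)
        finally show ?thesis
          unfolding m_def right_diff_distrib[symmetric] by (rule arg_cong)
      qed
      then have "norm (m n (shift a x) (shift a y) - m n x y)
          = inverse (real (Suc n)) * cmod (s (Suc n) x y - s 0 x y)" for n
        by (simp only: norm_mult norm_of_real) (simp add: inverse_eq_divide del: of_nat_Suc)
      moreover have "cmod (s (Suc n) x y - s 0 x y) \<le> 2 * B" for n
        using norm_triangle_ineq4[of "s (Suc n) x y" "s 0 x y"] bound[of "Suc n"] bound[of 0] by linarith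
      ultimately have bd: "norm (m n (shift a x) (shift a y) - m n x y) \<le> 2 * B * inverse (real (Suc n))" for n
        using mult_left_mono[of _ "2 * B" "inverse (real (Suc n))"]
        by (simp add: mult.commute del: of_nat_Suc)
      have "(\<lambda>n. 2 * B * inverse (real (Suc n))) \<longlonglongrightarrow> 0"
        by (rule tendsto_mult_right_zero[OF LIMSEQ_inverse_real_of_nat])
      then have "(\<lambda>n. m n (shift a x) (shift a y) - m n x y) \<longlonglongrightarrow> 0"
        by (rule Lim_null_comparison[OF always_eventually[OF allI[OF bd]]])
      then have "((\<lambda>n. m n (shift a x) (shift a y) - m n x y) \<longlongrightarrow> 0) G"
        using G(2) tendsto_mono by blast
      moreover have "((\<lambda>n. m n (shift a x) (shift a y) - m n x y) \<longlongrightarrow> l (shift a x) (shift a y) - l x y) G"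
        using xy by (intro tendsto_diff lim) simp_all
      ultimately show "l (shift a x) (shift a y) = l x y"
        using tendsto_unique[OF G(1)] by fastforce
    qed
    fix b assume b: "shift_invariant b k"
    show "shift_invariant b l"
      unfolding shift_invariant_def
    proof (intro ballI)
      fix x y :: "(real \<times> real) \<times> 'a" assume xy: "x \<in> UNIV \<times> vectors H" "y \<in> UNIV \<times> vectors H"
      have "s i (shift b x) (shift b y) = s i x y" for i
      proof -
        have "s i (shift b x) (shift b y)
            = k (shift b (shift (real i *\<^sub>R a) x)) (shift b (shift (real i *\<^sub>R a) y))"
          by (simp add: s_def shift_shift add.commute)
        also have "\<dots> = s i x y"
          unfolding s_def by (rule shift_invariantD[OF b]) (use xy in \<open>simp_all only: shift_carrier\<close>)
        finally show ?thesis .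
      qed
      then have "m n (shift b x) (shift b y) = m n x y" for n
        by (simp add: m_def)
      then have "((\<lambda>n. m n x y) \<longlongrightarrow> l (shift b x) (shift b y)) G"
        using lim[of "shift b x" "shift b y"] xy by simp
      then show "l (shift b x) (shift b y) = l x y"
        using tendsto_unique[OF G(1)] lim[OF xy] by blast
    qed
  qed
qed

text \<open>The pattern of the Markov-Kakutani theorem: the translations are commuting affine maps
  of a compact convex set. A kernel invariant under finitely many of them exists by induction, and a
  cluster point along the finite sets of translations is invariant under all.\<close>

proposition invariant_dilating_kernel: "\<exists>k. dilates UNIV k \<and> (\<forall>a. shift_invariant a k)"
proof -
  have "\<exists>k. dilates UNIV k \<and> (\<forall>a\<in>A. shift_invariant a k)" if "finite A" for A
    using that
  proof (induction A rule: finite_induct)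
    case empty
    then show ?case using dilates_UNIV by simp
  next
    case (insert a A)
    then obtain k where k: "dilates UNIV k" "\<forall>a\<in>A. shift_invariant a k"
      by blast
    obtain l where "dilates UNIV l" "shift_invariant a l" "\<And>b. shift_invariant b k \<Longrightarrow> shift_invariant b l"
      using dilates_shift_invariant[OF k(1)] by blast
    then show ?case
      using k(2) by blast
  qed
  then obtain k where k: "\<And>A. finite A \<Longrightarrow> dilates UNIV (k A) \<and> (\<forall>a\<in>A. shift_invariant a (k A))"
    by metis
  \<comment> \<open>Infinite sets get the kernel of the empty set, so that every index of the net
    carries a dilating kernel.\<close>
  define k' where "k' A = (if finite A then k A else k {})" for A
  have k': "dilates UNIV (k' A)" for A
    using k by (simp add: k'_def)
  obtain G l where G: "G \<noteq> bot" "G \<le> finite_subsets_at_top UNIV" and l: "dilates UNIV l"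
    and lim: "\<And>x y. x \<in> UNIV \<times> vectors H \<Longrightarrow> y \<in> UNIV \<times> vectors H \<Longrightarrow> ((\<lambda>A. k' A x y) \<longlongrightarrow> l x y) G"
    by (rule dilates_cluster_point[OF finite_subsets_at_top_neq_bot k']) (simp, rule that)
  have "shift_invariant a l" for a
    unfolding shift_invariant_def
  proof (intro ballI)
    fix x y :: "(real \<times> real) \<times> 'a" assume xy: "x \<in> UNIV \<times> vectors H" "y \<in> UNIV \<times> vectors H"
    have "\<forall>\<^sub>F A in finite_subsets_at_top UNIV. k' A (shift a x) (shift a y) = k' A x y"
      unfolding eventually_finite_subsets_at_top
    proof (intro exI[of _ "{a}"] conjI allI impI)
      fix A assume A: "finite A \<and> {a} \<subseteq> A \<and> A \<subseteq> UNIV"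
      then have "shift_invariant a (k A)"
        using k by blast
      then show "k' A (shift a x) (shift a y) = k' A x y"
        using A xy unfolding k'_def shift_invariant_def by (simp only: if_True)
    qed simp_all
    then have "\<forall>\<^sub>F A in G. k' A (shift a x) (shift a y) = k' A x y"
      using G(2) by (simp add: le_filter_def)
    then have "((\<lambda>A. k' A x y) \<longlongrightarrow> l (shift a x) (shift a y)) G"
      using lim[of "shift a x" "shift a y"] xy by (simp add: tendsto_cong)
    then show "l (shift a x) (shift a y) = l x y"
      using tendsto_unique[OF G(1)] lim[OF xy] by blast
  qed
  with l show ?thesis by blast
qed

end

section \<open>Extension of isometries\<close>

lemma (in complex_inner_space) lincomb_uminus:
  "lincomb X e (map (apfst uminus) xs) = - lincomb X e xs"
  by (induction xs) (simp_all add: scale_minus_left)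

lemma (in complex_inner_space) lincomb_scale:
  "lincomb X e (map (apfst ((*) c)) xs) = cscale X c (lincomb X e xs)"
  by (induction xs) (simp_all add: scale_right_distrib)

lemma (in complex_inner_space) lincomb_in_span:
  "snd ` set xs \<subseteq> I \<Longrightarrow> lincomb X e xs \<in> span (e ` I)"
  by (induction xs) (auto intro: span_zero span_add span_scale span_base)

lemma (in complex_inner_space) linear_between_lincomb:
  assumes "linear_between X X A" "\<And>x. x \<in> snd ` set xs \<Longrightarrow> e x \<in> vectors X"
  shows "A (lincomb X e xs) = lincomb X (\<lambda>x. A (e x)) xs"
  using assms(2)
proof (induction xs)
  case Nil
  have "A (cscale X 0 0) = cscale X 0 (A 0)"
    using assms(1) vectors_zero unfolding linear_between_def by blast
  then show ?case by simp
next
  case (Cons p xs)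
  have v: "e (snd p) \<in> vectors X" "lincomb X e xs \<in> vectors X" "cscale X (fst p) (e (snd p)) \<in> vectors X"
    using Cons.prems by (auto intro: vectors_lincomb vectors_scale)
  have "A (cscale X (fst p) (e (snd p)) + lincomb X e xs)
      = A (cscale X (fst p) (e (snd p))) + A (lincomb X e xs)"
    using assms(1) v unfolding linear_between_def by blast
  moreover have "A (cscale X (fst p) (e (snd p))) = cscale X (fst p) (A (e (snd p)))"
    using assms(1) v unfolding linear_between_def by blast
  ultimately show ?case
    using Cons by simp
qed

lemma isometryD:
  assumes "isometry X A"
  shows "linear_between X X A"
    and "x \<in> vectors X \<Longrightarrow> A x \<in> vectors X"
    and "x \<in> vectors X \<Longrightarrow> y \<in> vectors X \<Longrightarrow> A (x + y) = A x + A y"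
    and "x \<in> vectors X \<Longrightarrow> A (cscale X c x) = cscale X c (A x)"
    and "x \<in> vectors X \<Longrightarrow> hnorm X (A x) = hnorm X x"
  using assms unfolding isometry_def bounded_operator_def linear_between_def by blast+

lemma isometryI:
  assumes "\<And>x. x \<in> vectors X \<Longrightarrow> A x \<in> vectors X"
    and "\<And>x y. x \<in> vectors X \<Longrightarrow> y \<in> vectors X \<Longrightarrow> A (x + y) = A x + A y"
    and "\<And>c x. x \<in> vectors X \<Longrightarrow> A (cscale X c x) = cscale X c (A x)"
    and "\<And>x. x \<in> vectors X \<Longrightarrow> hnorm X (A x) = hnorm X x"
  shows "isometry X A"
  unfolding isometry_def bounded_operator_def linear_between_def
proof (intro conjI)
  show "\<exists>C. \<forall>x\<in>vectors X. hnorm X (A x) \<le> C * hnorm X x"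
    using assms(4) by (intro exI[of _ 1]) simp
qed (use assms in blast)+

lemma isometry_compose: "isometry X A \<Longrightarrow> isometry X B \<Longrightarrow> isometry X (\<lambda>x. A (B x))"
  by (rule isometryI) (simp_all add: isometryD)

lemma (in complex_inner_space) isometry_diff:
  assumes A: "isometry X A" and x: "x \<in> vectors X" "y \<in> vectors X"
  shows "A (x - y) = A x - A y"
  using isometryD(3)[OF A vectors_diff[OF x] x(2)] by simp

locale total_family = complex_hilbert_space K
  for K :: "('b::ab_group_add) cspace" +
  fixes I :: "'i set" and e :: "'i \<Rightarrow> 'b"
  assumes e_vectors: "x \<in> I \<Longrightarrow> e x \<in> vectors K"
    and total: "f \<in> vectors K \<Longrightarrow> \<epsilon> > 0 \<Longrightarrow>
      \<exists>xs. snd ` set xs \<subseteq> I \<and> hnorm K (f - lincomb K e xs) < \<epsilon>"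
begin

lemma lincomb_vectors: "snd ` set xs \<subseteq> I \<Longrightarrow> lincomb K e xs \<in> vectors K"
  by (rule vectors_lincomb) (blast intro: e_vectors)

lemma isometry_eqI:
  assumes A: "isometry K A" and B: "isometry K B"
    and AB: "\<And>x. x \<in> I \<Longrightarrow> A (e x) = B (e x)" and f: "f \<in> vectors K"
  shows "A f = B f"
proof (rule eq_if_hnorm_diff_small)
  fix \<epsilon> :: real assume "\<epsilon> > 0"
  then have "\<epsilon> / 2 > 0" by simp
  then obtain xs where xs: "snd ` set xs \<subseteq> I" "hnorm K (f - lincomb K e xs) < \<epsilon> / 2"
    using total[OF f] by blast
  define w where "w = lincomb K e xs"
  have w: "w \<in> vectors K"
    unfolding w_def by (rule lincomb_vectors[OF xs(1)])
  have "A w = lincomb K (\<lambda>x. A (e x)) xs"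
    unfolding w_def by (rule linear_between_lincomb[OF isometryD(1)[OF A]]) (use xs(1) e_vectors in blast)
  also have "\<dots> = lincomb K (\<lambda>x. B (e x)) xs"
    by (rule lincomb_cong) (use xs(1) AB in blast)
  also have "\<dots> = B w"
    unfolding w_def by (rule linear_between_lincomb[OF isometryD(1)[OF B], symmetric]) (use xs(1) e_vectors in blast)
  finally have "A w = B w" .
  then have "hnorm K (A f - B f) \<le> hnorm K (A f - A w) + hnorm K (B w - B f)"
    using hnorm_diff_triangle[of "A f" "A w" "B f"] isometryD(2)[OF A] isometryD(2)[OF B] f w by simp
  also have "hnorm K (A f - A w) = hnorm K (f - w)"
    using isometry_diff[OF A f w] isometryD(5)[OF A vectors_diff[OF f w]] by simp
  also have "hnorm K (B w - B f) = hnorm K (f - w)"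
    using isometry_diff[OF B w f] isometryD(5)[OF B vectors_diff[OF w f]] hnorm_minus_commute[OF f w] by simp
  finally show "hnorm K (A f - B f) \<le> \<epsilon>"
    using xs(2) by (simp add: w_def)
qed (use f isometryD(2)[OF A] isometryD(2)[OF B] in blast)+

text \<open>
  The isometric extension \<open>g\<close> of \<open>e x \<mapsto> \<phi> x\<close> at \<open>f\<close> is pinned down by having the same
  distances to the linear combinations of the \<open>\<phi> x\<close> as \<open>f\<close> has to those of the \<open>e x\<close>.
\<close>
proposition isometry_extension:
  assumes \<phi>: "\<And>x. x \<in> I \<Longrightarrow> \<phi> x \<in> vectors K"
    and inner: "\<And>x y. x \<in> I \<Longrightarrow> y \<in> I \<Longrightarrow> cinner K (\<phi> x) (\<phi> y) = cinner K (e x) (e y)"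
  shows "\<exists>V. isometry K V \<and> (\<forall>x\<in>I. V (e x) = \<phi> x)"
proof -
  let ?E = "lincomb K e" and ?F = "lincomb K \<phi>" and ?ok = "\<lambda>xs. snd ` set xs \<subseteq> I"
  have E: "?E xs \<in> vectors K" and F: "?F xs \<in> vectors K" if "?ok xs" for xs
    using that by (auto intro!: vectors_lincomb e_vectors \<phi>)
  have norm_F: "hnorm K (?F xs) = hnorm K (?E xs)" if "?ok xs" for xs
  proof -
    have "cinner K (?F xs) (?F xs) = kform (\<lambda>x y. cinner K (\<phi> x) (\<phi> y)) xs xs"
      by (rule cinner_lincomb) (use that \<phi> in blast)+
    also have "\<dots> = kform (\<lambda>x y. cinner K (e x) (e y)) xs xs"
      by (rule kform_cong) (use that inner in blast)
    also have "\<dots> = cinner K (?E xs) (?E xs)"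
      by (rule cinner_lincomb[symmetric]) (use that e_vectors in blast)+
    finally show ?thesis
      by (simp add: hnorm_def)
  qed
  \<comment> \<open>A difference of two combinations is one combination, of the list that appends
    the second with negated coefficients, so equality of norms gives equality of distances.\<close>
  have dist_F: "hnorm K (?F xs - ?F ys) = hnorm K (?E xs - ?E ys)" if "?ok xs" "?ok ys" for xs ys
  proof -
    have "?ok (xs @ map (apfst uminus) ys)"
      using that by (simp add: image_Un image_image)
    from norm_F[OF this] show ?thesis
      by (simp add: lincomb_uminus)
  qed
  define P where "P f g \<longleftrightarrow> g \<in> vectors K \<and> (\<forall>xs. ?ok xs \<longrightarrow> hnorm K (g - ?F xs) = hnorm K (f - ?E xs))" for f g
  have "\<exists>g. P f g" if f: "f \<in> vectors K" for f
  proof -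
    have "\<exists>xs. ?ok xs \<and> hnorm K (f - ?E xs) < 1 / real (Suc n)" for n
      using total[OF f, of "1 / real (Suc n)"] by simp
    then obtain Z where Z: "\<And>n. ?ok (Z n)" "\<And>n. hnorm K (f - ?E (Z n)) < 1 / real (Suc n)"
      by metis
    have Z0: "(\<lambda>n. hnorm K (?E (Z n) - f)) \<longlonglongrightarrow> 0"
    proof (rule Lim_null_comparison[OF always_eventually LIMSEQ_inverse_real_of_nat], rule allI)
      show "norm (hnorm K (?E (Z n) - f)) \<le> inverse (real (Suc n))" for n
        using Z(2)[of n] hnorm_minus_commute[OF f E[OF Z(1)[of n]]]
          hnorm_nonneg[OF vectors_diff[OF f E[OF Z(1)[of n]]]]
        by (simp add: inverse_eq_divide del: of_nat_Suc)
    qed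
    have "MCauchy (\<lambda>n. ?F (Z n))"
      unfolding MCauchy_hnorm_iff
    proof (intro conjI allI impI F Z)
      fix \<epsilon> :: real assume "\<epsilon> > 0"
      then have "\<epsilon> / 2 > 0" by simp
      from order_tendstoD(2)[OF Z0 this]
      obtain N where N: "\<And>n. N \<le> n \<Longrightarrow> hnorm K (?E (Z n) - f) < \<epsilon> / 2"
        unfolding eventually_sequentially by blast
      have "hnorm K (?F (Z m) - ?F (Z n)) < \<epsilon>" if "N \<le> m" "N \<le> n" for m n
        using N[OF that(1)] N[OF that(2)] hnorm_diff_triangle[OF E[OF Z(1)[of m]] f E[OF Z(1)[of n]]]
          hnorm_minus_commute[OF f E[OF Z(1)[of n]]] dist_F[OF Z(1)[of m] Z(1)[of n]]
        by linarith
      then show "\<exists>N. \<forall>m n. N \<le> m \<longrightarrow> N \<le> n \<longrightarrow> hnorm K (?F (Z m) - ?F (Z n)) < \<epsilon>"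
        by blast
    qed
    then obtain g where "limitin mtopology (\<lambda>n. ?F (Z n)) g sequentially"
      using complete unfolding mcomplete_def by blast
    then have g: "g \<in> vectors K" "(\<lambda>n. hnorm K (?F (Z n) - g)) \<longlonglongrightarrow> 0"
      using limitin_hnorm_iff[of "\<lambda>n. ?F (Z n)"] F[OF Z(1)] by blast+
    have lim: "(\<lambda>n. hnorm K (\<sigma> n - c)) \<longlonglongrightarrow> hnorm K (a - c)"
      if "\<And>n. \<sigma> n \<in> vectors K" "a \<in> vectors K" "c \<in> vectors K" "(\<lambda>n. hnorm K (\<sigma> n - a)) \<longlonglongrightarrow> 0" for \<sigma> a c
    proof (rule LIM_zero_cancel, rule Lim_null_comparison[OF always_eventually that(4)], rule allI)
      show "norm (hnorm K (\<sigma> n - c) - hnorm K (a - c)) \<le> hnorm K (\<sigma> n - a)" for n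
        using hnorm_diff_ineq[OF vectors_diff[OF that(1,3)] vectors_diff[OF that(2,3)], of n] by simp
    qed
    \<comment> \<open>Both sides are limits of the same sequence, since \<open>?F (Z n)\<close> is
      as far from \<open>?F xs\<close> as \<open>?E (Z n)\<close> from \<open>?E xs\<close>.\<close>
    have "hnorm K (g - ?F xs) = hnorm K (f - ?E xs)" if xs: "?ok xs" for xs
    proof (rule LIMSEQ_unique)
      show "(\<lambda>n. hnorm K (?F (Z n) - ?F xs)) \<longlonglongrightarrow> hnorm K (g - ?F xs)"
        by (rule lim[OF F[OF Z(1)] g(1) F[OF xs] g(2)])
      show "(\<lambda>n. hnorm K (?F (Z n) - ?F xs)) \<longlonglongrightarrow> hnorm K (f - ?E xs)"
        unfolding dist_F[OF Z(1) xs] by (rule lim[OF E[OF Z(1)] f E[OF xs] Z0])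
    qed
    with g(1) show ?thesis
      unfolding P_def by blast
  qed
  then obtain V where V: "\<And>f. f \<in> vectors K \<Longrightarrow> P f (V f)"
    by metis
  have Vv: "V f \<in> vectors K" if "f \<in> vectors K" for f
    using V[OF that] by (simp add: P_def)
  have Vd: "hnorm K (V f - ?F xs) = hnorm K (f - ?E xs)" if "f \<in> vectors K" "?ok xs" for f xs
    using V[OF that(1)] that(2) unfolding P_def by blast
  have "isometry K V"
  proof (rule isometryI)
    fix f assume f: "f \<in> vectors K"
    show "V f \<in> vectors K"
      by (rule Vv[OF f])
    show "hnorm K (V f) = hnorm K f"
      using Vd[OF f, of "[]"] by simp
    show "V (cscale K c f) = cscale K c (V f)" for c
    proof (rule eq_if_hnorm_diff_small)
      show "V (cscale K c f) \<in> vectors K" "cscale K c (V f) \<in> vectors K"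
        using Vv f vectors_scale by blast+
      fix \<epsilon> :: real assume "\<epsilon> > 0"
      \<comment> \<open>Passing through the scaled approximant costs two errors, each
        \<open>cmod c\<close> times the distance of \<open>f\<close> from \<open>?E xs\<close>; the
        summand 1 avoids division by 0.\<close>
      then have "\<epsilon> / (2 * (cmod c + 1)) > 0"
        by (simp add: add_nonneg_pos)
      then obtain xs where xs: "?ok xs" "hnorm K (f - ?E xs) < \<epsilon> / (2 * (cmod c + 1))"
        using total[OF f] by blast
      let ?ys = "map (apfst ((*) c)) xs"
      have ys: "?ok ?ys"
        using xs(1) by (simp add: image_image)
      have Fc: "cscale K c (?F xs) \<in> vectors K"
        by (rule vectors_scale[OF F[OF xs(1)]])
      have "hnorm K (V (cscale K c f) - cscale K c (V f))
          \<le> hnorm K (V (cscale K c f) - cscale K c (?F xs)) + hnorm K (cscale K c (?F xs) - cscale K c (V f))"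
        by (intro hnorm_diff_triangle Vv Fc vectors_scale f)
      also have "hnorm K (V (cscale K c f) - cscale K c (?F xs)) = hnorm K (cscale K c f - cscale K c (?E xs))"
        using Vd[OF vectors_scale[OF f] ys] by (simp only: lincomb_scale)
      also have "\<dots> = cmod c * hnorm K (f - ?E xs)"
        using f E[OF xs(1)] by (simp add: hnorm_scale vectors_diff flip: scale_right_diff_distrib)
      also have "hnorm K (cscale K c (?F xs) - cscale K c (V f)) = cmod c * hnorm K (?F xs - V f)"
        using f F[OF xs(1)] Vv by (simp add: hnorm_scale vectors_diff flip: scale_right_diff_distrib)
      also have "hnorm K (?F xs - V f) = hnorm K (f - ?E xs)"
        using Vd[OF f xs(1)] hnorm_minus_commute[OF F[OF xs(1)] Vv[OF f]] by simp
      also have "cmod c * hnorm K (f - ?E xs) + cmod c * hnorm K (f - ?E xs)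
          \<le> 2 * (cmod c + 1) * hnorm K (f - ?E xs)"
        using hnorm_nonneg[OF vectors_diff[OF f E[OF xs(1)]]] by (simp add: algebra_simps)
      also have "\<dots> \<le> 2 * (cmod c + 1) * (\<epsilon> / (2 * (cmod c + 1)))"
        using xs(2) by (intro mult_left_mono) auto
      also have "\<dots> = \<epsilon>"
      proof -
        have "C * (\<epsilon> / C) = \<epsilon>" if "C > 0" for C
          using that by simp
        then show ?thesis
          by (simp only: add_nonneg_pos norm_ge_zero zero_less_one mult_pos_pos zero_less_numeral)
      qed
      finally show "hnorm K (V (cscale K c f) - cscale K c (V f)) \<le> \<epsilon>" .
    qed
    fix f' assume f': "f' \<in> vectors K"
    show "V (f + f') = V f + V f'"
    proof (rule eq_if_hnorm_diff_small)
      show "V (f + f') \<in> vectors K" "V f + V f' \<in> vectors K"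
        using Vv f f' vectors_add by blast+
      fix \<epsilon> :: real assume "\<epsilon> > 0"
      \<comment> \<open>Four errors occur: those of \<open>f\<close> and \<open>f'\<close> against
        their approximants, once for \<open>V (f + f')\<close> and once for
        \<open>V f + V f'\<close>.\<close>
      then have "\<epsilon> / 4 > 0" by simp
      then obtain xs ys where xs: "?ok xs" "hnorm K (f - ?E xs) < \<epsilon> / 4"
        and ys: "?ok ys" "hnorm K (f' - ?E ys) < \<epsilon> / 4"
        using total[OF f] total[OF f'] by meson
      have xys: "?ok (xs @ ys)"
        using xs ys by (simp add: image_Un)
      note v = f f' E[OF xs(1)] E[OF ys(1)] F[OF xs(1)] F[OF ys(1)] Vv[OF f] Vv[OF f']
      have "hnorm K (V (f + f') - (?F xs + ?F ys)) = hnorm K (f + f' - (?E xs + ?E ys))"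
        using Vd[OF vectors_add[OF f f'] xys] by simp
      also have "\<dots> \<le> hnorm K (f - ?E xs) + hnorm K (f' - ?E ys)"
        using hnorm_triangle[of "f - ?E xs" "f' - ?E ys"] v by (simp add: vectors_diff algebra_simps)
      finally have 1: "hnorm K (V (f + f') - (?F xs + ?F ys)) < \<epsilon> / 2"
        using xs ys by simp
      have "hnorm K (?F xs + ?F ys - (V f + V f')) \<le> hnorm K (?F xs - V f) + hnorm K (?F ys - V f')"
        using hnorm_triangle[of "?F xs - V f" "?F ys - V f'"] v by (simp add: vectors_diff algebra_simps)
      also have "\<dots> = hnorm K (f - ?E xs) + hnorm K (f' - ?E ys)"
        using Vd[OF f xs(1)] Vd[OF f' ys(1)] hnorm_minus_commute v by simp
      finally have 2: "hnorm K (?F xs + ?F ys - (V f + V f')) < \<epsilon> / 2"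
        using xs ys by simp
      show "hnorm K (V (f + f') - (V f + V f')) \<le> \<epsilon>"
        using 1 2 hnorm_diff_triangle[of "V (f + f')" "?F xs + ?F ys" "V f + V f'"]
          Vv[OF vectors_add[OF f f']] v vectors_add by fastforce
    qed
  qed
  moreover have "V (e x) = \<phi> x" if "x \<in> I" for x
  proof -
    have "hnorm K (V (e x) - \<phi> x) = 0"
      using Vd[OF e_vectors[OF that], of "[(1, x)]"] that by simp
    then show ?thesis
      using hnorm_eq_0[OF vectors_diff[OF Vv[OF e_vectors[OF that]] \<phi>[OF that]]] by simp
  qed
  ultimately show ?thesis
    by blast
qed

lemma closed_linear_span_total: "closed_linear_span K (e ` I) = vectors K"
proof -
  have "f \<in> mtopology closure_of (span (e ` I))" if f: "f \<in> vectors K" for f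
    unfolding metric_closure_of
  proof (intro CollectI conjI f allI impI)
    fix r :: real assume "r > 0"
    then obtain xs where xs: "snd ` set xs \<subseteq> I" "hnorm K (f - lincomb K e xs) < r"
      using total[OF f] by blast
    then have "lincomb K e xs \<in> mball f r"
      using f lincomb_vectors by (simp add: hdist_def)
    then show "\<exists>y\<in>span (e ` I). y \<in> mball f r"
      using lincomb_in_span[OF xs(1)] by blast
  qed
  moreover have "mtopology closure_of (span (e ` I)) \<subseteq> vectors K"
    using closure_of_subset_topspace[of mtopology] by simp
  ultimately show ?thesis
    unfolding closed_linear_span_def htopology_def by blast
qed

text \<open>Everything is checked on the total family. The semigroup law passes to \<open>K\<close>
  because isometries agreeing on a total family are equal; continuity passes because all
  \<open>V s\<close> have the same Lipschitz constant 1.\<close>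

proposition isometry_semigroup_extension:
  fixes \<sigma> :: "real \<Rightarrow> 'i \<Rightarrow> 'i"
  assumes \<sigma>: "\<And>s x. 0 \<le> s \<Longrightarrow> x \<in> I \<Longrightarrow> \<sigma> s x \<in> I"
    and inner: "\<And>s x y. 0 \<le> s \<Longrightarrow> x \<in> I \<Longrightarrow> y \<in> I \<Longrightarrow>
      cinner K (e (\<sigma> s x)) (e (\<sigma> s y)) = cinner K (e x) (e y)"
    and \<sigma>_0: "\<And>x. x \<in> I \<Longrightarrow> \<sigma> 0 x = x"
    and \<sigma>_add: "\<And>s t x. 0 \<le> s \<Longrightarrow> 0 \<le> t \<Longrightarrow> x \<in> I \<Longrightarrow> \<sigma> (s + t) x = \<sigma> s (\<sigma> t x)"
    and continuous: "\<And>x \<epsilon>. x \<in> I \<Longrightarrow> \<epsilon> > 0 \<Longrightarrow>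
      \<exists>\<delta>>0. \<forall>s\<ge>0. \<forall>t\<ge>0. \<bar>s - t\<bar> < \<delta> \<longrightarrow> hnorm K (e (\<sigma> s x) - e (\<sigma> t x)) < \<epsilon>"
  shows "\<exists>V. isometry_semigroup K V \<and> (\<forall>s\<ge>0. \<forall>x\<in>I. V s (e x) = e (\<sigma> s x))"
proof -
  have "\<exists>V. 0 \<le> s \<longrightarrow> isometry K V \<and> (\<forall>x\<in>I. V (e x) = e (\<sigma> s x))" for s
    using isometry_extension[of "\<lambda>x. e (\<sigma> s x)"] e_vectors \<sigma> inner by (cases "0 \<le> s") auto
  then obtain V where V: "\<And>s. 0 \<le> s \<Longrightarrow> isometry K (V s)"
    "\<And>s x. 0 \<le> s \<Longrightarrow> x \<in> I \<Longrightarrow> V s (e x) = e (\<sigma> s x)"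
    by metis
  \<comment> \<open>Uniform continuity of the orbit, with \<open>\<delta>\<close> independent of the
    base point; it is stable under linear combinations and, by the isometry property, under norm
    limits.\<close>
  define C where "C f \<longleftrightarrow> (\<forall>\<epsilon>>0. \<exists>\<delta>>0. \<forall>s\<ge>0. \<forall>t\<ge>0. \<bar>s - t\<bar> < \<delta> \<longrightarrow> hnorm K (V s f - V t f) < \<epsilon>)" for f
  have C_lincomb: "C (lincomb K e xs)" if "snd ` set xs \<subseteq> I" for xs
    using that
  proof (induction xs)
    case Nil
    have "V s 0 = 0" if "0 \<le> s" for s
      using isometry_diff[OF V(1)[OF that] vectors_zero vectors_zero] by simp
    then show ?case
      by (auto simp: C_def intro: exI[of _ 1])
  next
    case (Cons p xs)
    have x: "snd p \<in> I" "e (snd p) \<in> vectors K" "lincomb K e xs \<in> vectors K"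
      using Cons.prems by (auto intro: e_vectors lincomb_vectors)
    show ?case
      unfolding C_def
    proof (intro allI impI)
      fix \<epsilon> :: real assume e: "\<epsilon> > 0"
      have "\<epsilon> / (2 * (cmod (fst p) + 1)) > 0"
        using e by (simp add: add_nonneg_pos)
      then obtain a where a: "a > 0" "\<And>s t. 0 \<le> s \<Longrightarrow> 0 \<le> t \<Longrightarrow> \<bar>s - t\<bar> < a \<Longrightarrow>
          hnorm K (e (\<sigma> s (snd p)) - e (\<sigma> t (snd p))) < \<epsilon> / (2 * (cmod (fst p) + 1))"
        using continuous[OF x(1)] by meson
      have "\<epsilon> / 2 > 0" using e by simp
      moreover have "C (lincomb K e xs)"
        using Cons by simp
      ultimately obtain b where b: "b > 0" "\<And>s t. 0 \<le> s \<Longrightarrow> 0 \<le> t \<Longrightarrow> \<bar>s - t\<bar> < b \<Longrightarrow>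
          hnorm K (V s (lincomb K e xs) - V t (lincomb K e xs)) < \<epsilon> / 2"
        unfolding C_def by meson
      have "hnorm K (V s (lincomb K e (p # xs)) - V t (lincomb K e (p # xs))) < \<epsilon>"
        if st: "0 \<le> s" "0 \<le> t" "\<bar>s - t\<bar> < min a b" for s t
      proof -
        let ?d = "e (\<sigma> s (snd p)) - e (\<sigma> t (snd p))"
        let ?r = "V s (lincomb K e xs) - V t (lincomb K e xs)"
        have d: "?d \<in> vectors K" "?r \<in> vectors K"
          using st x \<sigma> isometryD(2)[OF V(1)] by (auto intro!: vectors_diff e_vectors)
        have "V r (lincomb K e (p # xs)) = cscale K (fst p) (e (\<sigma> r (snd p))) + V r (lincomb K e xs)"
          if "0 \<le> r" for r
          using isometryD(3)[OF V(1)[OF that] vectors_scale[OF x(2)] x(3)]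
            isometryD(4)[OF V(1)[OF that] x(2)] V(2)[OF that x(1)] by simp
        then have "V s (lincomb K e (p # xs)) - V t (lincomb K e (p # xs)) = cscale K (fst p) ?d + ?r"
          using st by (simp add: scale_right_diff_distrib)
        also have "hnorm K \<dots> \<le> cmod (fst p) * hnorm K ?d + hnorm K ?r"
          using hnorm_triangle[OF vectors_scale[OF d(1)] d(2), of "fst p"] hnorm_scale[OF d(1)] by simp
        also have "\<dots> < \<epsilon> / 2 + \<epsilon> / 2"
        proof (rule add_le_less_mono)
          have "cmod (fst p) * hnorm K ?d \<le> (cmod (fst p) + 1) * (\<epsilon> / (2 * (cmod (fst p) + 1)))"
            using a(2)[of s t] st d by (intro mult_mono) (auto simp: hnorm_nonneg)
          also have "\<dots> = \<epsilon> / 2"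
          proof -
            have "C * (\<epsilon> / (2 * C)) = \<epsilon> / 2" if "C > 0" for C
              using that by simp
            then show ?thesis
              by (simp only: add_nonneg_pos norm_ge_zero zero_less_one)
          qed
          finally show "cmod (fst p) * hnorm K ?d \<le> \<epsilon> / 2" .
          show "hnorm K ?r < \<epsilon> / 2"
            using b(2)[of s t] st by simp
        qed
        finally show ?thesis by simp
      qed
      then show "\<exists>\<delta>>0. \<forall>s\<ge>0. \<forall>t\<ge>0. \<bar>s - t\<bar> < \<delta> \<longrightarrow>
          hnorm K (V s (lincomb K e (p # xs)) - V t (lincomb K e (p # xs))) < \<epsilon>"
        using a(1) b(1) by (intro exI[of _ "min a b"] conjI allI impI) (simp_all del: lincomb_simps)
    qed
  qed
  have C: "C f" if f: "f \<in> vectors K" for f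
    unfolding C_def
  proof (intro allI impI)
    fix \<epsilon> :: real assume "\<epsilon> > 0"
    then have e3: "\<epsilon> / 3 > 0" by simp
    then obtain xs where xs: "snd ` set xs \<subseteq> I" "hnorm K (f - lincomb K e xs) < \<epsilon> / 3"
      using total[OF f] by blast
    define w where "w = lincomb K e xs"
    have w: "w \<in> vectors K" "hnorm K (f - w) < \<epsilon> / 3" "C w"
      using xs lincomb_vectors C_lincomb by (auto simp: w_def)
    obtain d where d: "d > 0" "\<And>s t. 0 \<le> s \<Longrightarrow> 0 \<le> t \<Longrightarrow> \<bar>s - t\<bar> < d \<Longrightarrow> hnorm K (V s w - V t w) < \<epsilon> / 3"
      using w(3) e3 unfolding C_def by meson
    have "hnorm K (V s f - V t f) < \<epsilon>" if st: "0 \<le> s" "0 \<le> t" "\<bar>s - t\<bar> < d" for s t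
    proof -
      have v: "V r g \<in> vectors K" if "0 \<le> r" "g \<in> vectors K" for r g
        using isometryD(2)[OF V(1)] that by blast
      have near: "hnorm K (V r f - V r w) < \<epsilon> / 3" if "0 \<le> r" for r
        using isometry_diff[OF V(1)[OF that] f w(1)] isometryD(5)[OF V(1)[OF that] vectors_diff[OF f w(1)]] w(2)
        by simp
      have "hnorm K (V s f - V t f) \<le> hnorm K (V s f - V s w) + hnorm K (V s w - V t f)"
        by (intro hnorm_diff_triangle v st f w)
      also have "hnorm K (V s w - V t f) \<le> hnorm K (V s w - V t w) + hnorm K (V t w - V t f)"
        by (intro hnorm_diff_triangle v st f w)
      also have "hnorm K (V t w - V t f) = hnorm K (V t f - V t w)"
        by (intro hnorm_minus_commute v st f w)
      finally show ?thesis
        using near[OF st(1)] near[OF st(2)] d(2)[OF st] by linarith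
    qed
    then show "\<exists>\<delta>>0. \<forall>s\<ge>0. \<forall>t\<ge>0. \<bar>s - t\<bar> < \<delta> \<longrightarrow> hnorm K (V s f - V t f) < \<epsilon>"
      using d(1) by blast
  qed
  have "isometry_semigroup K V"
    unfolding isometry_semigroup_def continuous_semigroup_def
  proof (intro conjI allI impI ballI)
    show "bounded_operator K (V s)" "isometry K (V s)" if "0 \<le> s" for s
      using V(1)[OF that] by (auto simp: isometry_def)
    show "V 0 f = f" if "f \<in> vectors K" for f
      by (rule isometry_eqI[OF V(1) _ _ that, where B = "\<lambda>x. x"]) (auto simp: V(2) \<sigma>_0 intro: isometryI)
    show "V (s + t) f = V s (V t f)" if "0 \<le> s" "0 \<le> t" "f \<in> vectors K" for s t f
      by (rule isometry_eqI[OF V(1) isometry_compose[OF V(1) V(1)] _ that(3)])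
        (use that in \<open>simp_all add: V(2) \<sigma>_add \<sigma>\<close>)
    fix f assume f: "f \<in> vectors K"
    show "continuous_map (top_of_set {0..}) (htopology K) (\<lambda>s. V s f)"
      unfolding htopology_def continuous_map_to_metric
    proof (intro ballI allI impI)
      fix s \<epsilon> :: real assume s: "s \<in> topspace (top_of_set {0..})" and "\<epsilon> > 0"
      then obtain d where d: "d > 0" "\<And>s t. 0 \<le> s \<Longrightarrow> 0 \<le> t \<Longrightarrow> \<bar>s - t\<bar> < d \<Longrightarrow> hnorm K (V s f - V t f) < \<epsilon>"
        using C[OF f] unfolding C_def by meson
      show "\<exists>U. openin (top_of_set {0..}) U \<and> s \<in> U \<and> (\<forall>t\<in>U. V t f \<in> mball (V s f) \<epsilon>)"
      proof (intro exI[of _ "{0..} \<inter> ball s d"] conjI ballI)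
        show "V t f \<in> mball (V s f) \<epsilon>" if "t \<in> {0..} \<inter> ball s d" for t
          using that s d(2)[of s t] isometryD(2)[OF V(1) f]
          by (simp add: hdist_def dist_real_def)
      qed (use s d in \<open>auto simp: openin_open_Int\<close>)
    qed
  qed
  with V(2) show ?thesis
    by blast
qed

end

text \<open>The defect of additivity or homogeneity is orthogonal to every \<open>J z\<close>. Being
  itself a combination of such vectors, it is orthogonal to itself and vanishes.\<close>

lemma inner_preserving_linear:
  assumes X: "complex_inner_space X" and Y: "complex_inner_space Y"
    and J: "\<And>x. x \<in> vectors X \<Longrightarrow> J x \<in> vectors Y"
    and inner: "\<And>x y. x \<in> vectors X \<Longrightarrow> y \<in> vectors X \<Longrightarrow> cinner Y (J x) (J y) = cinner X x y"
  shows "linear_between X Y J"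
proof -
  interpret X: complex_inner_space X by fact
  interpret Y: complex_inner_space Y by fact
  have zero: "d = 0" if "d \<in> vectors Y" "cinner Y d d = 0" for d
    using Y.cinner_pos[OF that(1)] that(2) by auto
  show ?thesis
    unfolding linear_between_def
  proof (intro conjI ballI allI)
    fix x y assume xy: "x \<in> vectors X" "y \<in> vectors X"
    note v = J[OF xy(1)] J[OF xy(2)] J[OF X.vectors_add[OF xy]] Y.vectors_add[OF J[OF xy(1)] J[OF xy(2)]]
    define d where "d = J (x + y) - (J x + J y)"
    have d: "d \<in> vectors Y"
      unfolding d_def by (intro Y.vectors_diff v)
    have "cinner Y d (J z) = 0" if "z \<in> vectors X" for z
      using that xy v J[OF that] by (simp add: d_def Y.cinner_diff_left Y.cinner_add_left inner X.vectors_add X.cinner_add_left)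
    then have "cinner Y d (J (x + y) - (J x + J y)) = 0"
      using d v xy by (simp add: Y.cinner_diff_right Y.cinner_add_right X.vectors_add)
    then show "J (x + y) = J x + J y"
      using zero[OF d] by (simp add: d_def)
  next
    fix c x assume x: "x \<in> vectors X"
    note v = J[OF x] J[OF X.vectors_scale[OF x, of c]] Y.vectors_scale[OF J[OF x], of c]
    define d where "d = J (cscale X c x) - cscale Y c (J x)"
    have d: "d \<in> vectors Y"
      unfolding d_def by (intro Y.vectors_diff v)
    have "cinner Y d (J z) = 0" if "z \<in> vectors X" for z
      using that x v J[OF that] by (simp add: d_def Y.cinner_diff_left Y.cinner_scale_left inner X.vectors_scale X.cinner_scale_left)
    then have "cinner Y d (J (cscale X c x) - cscale Y c (J x)) = 0"
      using d v x by (simp add: Y.cinner_diff_right Y.cinner_scale_right X.vectors_scale)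
    then show "J (cscale X c x) = cscale Y c (J x)"
      using zero[OF d] by (simp add: d_def)
  qed (use J in blast)
qed

section \<open>The dilation\<close>

lemma continuous_semigroup_at_0:
  assumes X: "complex_inner_space X" and T: "continuous_semigroup X T" and h: "h \<in> vectors X" and "\<epsilon> > 0"
  shows "\<exists>\<delta>>0. \<forall>r\<ge>0. r < \<delta> \<longrightarrow> hnorm X (T r h - h) < \<epsilon>"
proof -
  interpret complex_inner_space X by fact
  have cont: "continuous_map (top_of_set {0..}) mtopology (\<lambda>s. T s h)" and T0: "T 0 h = h"
    using T h unfolding continuous_semigroup_def htopology_def by simp_all
  have "0 \<in> topspace (top_of_set {0::real..})"
    by simp
  from cont[unfolded continuous_map_to_metric, THEN bspec, OF this, THEN spec, THEN mp, OF \<open>\<epsilon> > 0\<close>]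
  obtain U where U: "openin (top_of_set {0..}) U" "0 \<in> U" "\<forall>t\<in>U. T t h \<in> mball h \<epsilon>"
    unfolding T0 by (elim exE conjE)
  obtain d where d: "d > 0" "ball 0 d \<inter> {0..} \<subseteq> U"
    using U(1,2) unfolding openin_contains_ball by blast
  have "hnorm X (T r h - h) < \<epsilon>" if "0 \<le> r" "r < d" for r
  proof -
    have "r \<in> U"
      using d(2) that by (auto simp: dist_real_def)
    then have "T r h \<in> vectors X \<and> hnorm X (h - T r h) < \<epsilon>"
      using U(3) h by (auto simp: hdist_def)
    then show ?thesis
      using hnorm_minus_commute[OF h, of "T r h"] by simp
  qed
  then show ?thesis
    using d(1) by blast
qed

context contraction_family
begin

text \<open>Since comparable points are involved, this distance is determined by \<open>U\<close> alone.\<close>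
lemma dilation_orbit_dist:
  assumes K: "complex_inner_space K" and k: "dilates UNIV k"
    and a: "a \<in> vectors K" "b \<in> vectors K" and zw: "z \<le> w" and h: "h \<in> vectors H"
    and ab: "cinner K a a = k (z, h) (z, h)" "cinner K b b = k (w, h) (w, h)" "cinner K b a = k (w, h) (z, h)"
  shows "(hnorm K (b - a))\<^sup>2 \<le> 2 * (hnorm H h * hnorm H (U (w - z) h - h))"
proof -
  interpret K: complex_inner_space K by fact
  have Uh: "U (w - z) h \<in> vectors H"
    by (rule U_diff_vectors[OF zw h])
  have "(hnorm K (b - a))\<^sup>2 = 2 * Re (cinner H h h) - 2 * Re (cinner H (U (w - z) h) h)"
    using h by (simp add: K.hnorm_diff_sq a K.hnorm_sq ab dilates_same[OF k] dilates_ge[OF k _ _ zw])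
  also have "\<dots> = 2 * Re (cinner H (h - U (w - z) h) h)"
    using h Uh by (simp add: cinner_diff_left)
  also have "\<dots> \<le> 2 * (hnorm H (h - U (w - z) h) * hnorm H h)"
    using h Uh by (intro mult_left_mono order_trans[OF complex_Re_le_cmod Cauchy_Schwarz] vectors_diff) auto
  finally show ?thesis
    using hnorm_minus_commute[OF h Uh] by (simp add: mult.commute)
qed

end

lemma contraction_family_semigroup_pair:
  assumes H: "complex_hilbert_space H"
    and T1: "contraction_semigroup H T\<^sub>1" and T2: "contraction_semigroup H T\<^sub>2"
    and comm: "commuting_semigroups H T\<^sub>1 T\<^sub>2"
  shows "contraction_family H (\<lambda>p h. T\<^sub>1 (fst p) (T\<^sub>2 (snd p) h))"
proof -
  interpret complex_hilbert_space H by fact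
  have bounded: "bounded_operator H (T s)" and contr: "h \<in> vectors H \<Longrightarrow> hnorm H (T s h) \<le> hnorm H h"
    if "contraction_semigroup H T" "0 \<le> s" for T s h
    using that unfolding contraction_semigroup_def contraction_def by blast+
  have v: "T s h \<in> vectors H" and add: "h' \<in> vectors H \<Longrightarrow> T s (h + h') = T s h + T s h'"
    and scale: "T s (cscale H c h) = cscale H c (T s h)"
    if "contraction_semigroup H T" "0 \<le> s" "h \<in> vectors H" for T s h h' c
    using bounded[OF that(1,2)] that(3) unfolding bounded_operator_def linear_between_def by blast+
  have zero: "T 0 h = h" and plus: "0 \<le> s \<Longrightarrow> 0 \<le> t \<Longrightarrow> T (s + t) h = T s (T t h)"
    if "contraction_semigroup H T" "h \<in> vectors H" for T s t h
    using that unfolding contraction_semigroup_def continuous_semigroup_def by blast+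
  show ?thesis
  proof (intro contraction_family.intro contraction_family_axioms.intro complex_inner_space_axioms)
    fix p q :: "real \<times> real" and h h' :: 'a and c
    assume p: "0 \<le> p" and h: "h \<in> vectors H"
    then have p': "0 \<le> fst p" "0 \<le> snd p"
      by (simp_all add: less_eq_prod_def)
    note v2 = v[OF T2 p'(2) h]
    show "T\<^sub>1 (fst p) (T\<^sub>2 (snd p) h) \<in> vectors H"
      by (rule v[OF T1 p'(1) v2])
    show "T\<^sub>1 (fst p) (T\<^sub>2 (snd p) (cscale H c h)) = cscale H c (T\<^sub>1 (fst p) (T\<^sub>2 (snd p) h))"
      by (simp add: scale[OF T2 p'(2) h] scale[OF T1 p'(1) v2])
    show "hnorm H (T\<^sub>1 (fst p) (T\<^sub>2 (snd p) h)) \<le> hnorm H h"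
      by (rule order_trans[OF contr[OF T1 p'(1) v2] contr[OF T2 p'(2) h]])
    show "T\<^sub>1 (fst p) (T\<^sub>2 (snd p) (h + h')) = T\<^sub>1 (fst p) (T\<^sub>2 (snd p) h) + T\<^sub>1 (fst p) (T\<^sub>2 (snd p) h')"
      if "h' \<in> vectors H"
      using add[OF T2 p'(2) h that] add[OF T1 p'(1) v2 v[OF T2 p'(2) that]] by simp
    assume "0 \<le> q"
    then have q: "0 \<le> fst q" "0 \<le> snd q"
      by (simp_all add: less_eq_prod_def)
    have "T\<^sub>1 (fst (p + q)) (T\<^sub>2 (snd (p + q)) h) = T\<^sub>1 (fst p) (T\<^sub>1 (fst q) (T\<^sub>2 (snd p) (T\<^sub>2 (snd q) h)))"
      using plus[OF T2 h p'(2) q(2)] plus[OF T1 v[OF T2 p'(2) v[OF T2 q(2) h]] p'(1) q(1)] by simp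
    \<comment> \<open>Commutativity of the given semigroups enters here: it turns the two
      one-parameter laws into a semigroup law over the quadrant.\<close>
    also have "T\<^sub>1 (fst q) (T\<^sub>2 (snd p) (T\<^sub>2 (snd q) h)) = T\<^sub>2 (snd p) (T\<^sub>1 (fst q) (T\<^sub>2 (snd q) h))"
      using comm q p' v[OF T2 q(2) h] unfolding commuting_semigroups_def by blast
    finally show "T\<^sub>1 (fst (p + q)) (T\<^sub>2 (snd (p + q)) h)
        = T\<^sub>1 (fst p) (T\<^sub>2 (snd p) (T\<^sub>1 (fst q) (T\<^sub>2 (snd q) h)))" .
  qed (simp add: zero[OF T1] zero[OF T2])
qed

theorem theorem2p1:
  fixes H :: "('a::ab_group_add) cspace"
    and T\<^sub>1 T\<^sub>2 :: "real \<Rightarrow> 'a \<Rightarrow> 'a"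
  assumes "complex_hilbert_space H"
    and "contraction_semigroup H T\<^sub>1"
    and "contraction_semigroup H T\<^sub>2"
    and "commuting_semigroups H T\<^sub>1 T\<^sub>2"
  shows "\<exists>(K :: 'a dilation_space) J V\<^sub>1 V\<^sub>2.
    complex_hilbert_space K \<and>
    isometric_embedding H K J \<and>
    isometry_semigroup K V\<^sub>1 \<and>
    isometry_semigroup K V\<^sub>2 \<and>
    commuting_semigroups K V\<^sub>1 V\<^sub>2 \<and>
    (\<forall>s\<ge>0. \<forall>t\<ge>0. \<forall>h\<in>vectors H.
       J (T\<^sub>1 s (T\<^sub>2 t h)) =
       orthogonal_projection K (J ` vectors H) (V\<^sub>1 s (V\<^sub>2 t (J h)))) \<and>
    vectors K = closed_linear_span K {V\<^sub>1 s (V\<^sub>2 t (J h)) | s t h. 0 \<le> s \<and> 0 \<le> t \<and> h \<in> vectors H}"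
proof -
  define U where "U = (\<lambda>p h. T\<^sub>1 (fst p) (T\<^sub>2 (snd p) h))"
  interpret contraction_family H U
    unfolding U_def by (rule contraction_family_semigroup_pair[OF assms])
  have sg: "continuous_semigroup H T\<^sub>1" "continuous_semigroup H T\<^sub>2"
    using assms(2,3) unfolding contraction_semigroup_def by blast+
  have zero: "T\<^sub>1 0 h = h" "T\<^sub>2 0 h = h" if "h \<in> vectors H" for h
    using sg that unfolding continuous_semigroup_def by blast+
  obtain k where k: "dilates UNIV k" and inv: "\<And>a. shift_invariant a k"
    using invariant_dilating_kernel by blast
  define I :: "(real \<times> real \<times> 'a) set" where "I = {(s, t, h). 0 \<le> s \<and> 0 \<le> t \<and> h \<in> vectors H}"
  have I: "(s, t, h) \<in> I \<longleftrightarrow> 0 \<le> s \<and> 0 \<le> t \<and> h \<in> vectors H" for s t h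
    by (simp add: I_def)
  \<comment> \<open>A mere reassociation: indices of the dilation space are triples, those of
    \<open>dilates\<close> are pairs of a point and a vector.\<close>
  define g :: "real \<times> real \<times> 'a \<Rightarrow> (real \<times> real) \<times> 'a" where "g = (\<lambda>(s, t, h). ((s, t), h))"
  have "psd_kernel I (\<lambda>x y. k (g x) (g y))"
    by (rule psd_kernel_pullback[OF dilates_psd[OF k]]) (auto simp: g_def I_def)
  from kernel_realization[OF this] obtain K :: "'a dilation_space" and e
    where K: "complex_hilbert_space K" "e ` I \<subseteq> vectors K"
      and eK: "\<forall>x\<in>I. \<forall>y\<in>I. cinner K (e x) (e y) = k (g x) (g y)"
      and dense: "\<forall>f\<in>vectors K. \<forall>\<epsilon>>0. \<exists>xs. snd ` set xs \<subseteq> I \<and> hnorm K (f - lincomb K e xs) < \<epsilon>"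
    by (elim exE conjE) (rule that)
  interpret K: total_family K I e
  proof (intro total_family.intro total_family_axioms.intro K(1))
    show "e x \<in> vectors K" if "x \<in> I" for x
      using K(2) that by blast
    show "\<exists>xs. snd ` set xs \<subseteq> I \<and> hnorm K (f - lincomb K e xs) < \<epsilon>"
      if "f \<in> vectors K" "\<epsilon> > 0" for f \<epsilon>
      using dense that by blast
  qed
  have inner: "cinner K (e (s, t, h)) (e (s', t', h')) = k ((s, t), h) ((s', t'), h')"
    if "(s, t, h) \<in> I" "(s', t', h') \<in> I" for s t h s' t' h'
    using eK that by (simp add: g_def)
  \<comment> \<open>Orbits in a nonnegative direction \<open>(c, d)\<close>; the values
    \<open>(1, 0)\<close> and \<open>(0, 1)\<close> serve the two semigroups. Points of such an
    orbit are pairwise comparable, so \<open>dilation_orbit_dist\<close> applies.\<close>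
  have cont: "\<exists>\<delta>>0. \<forall>s\<ge>0. \<forall>t\<ge>0. \<bar>s - t\<bar> < \<delta> \<longrightarrow>
      hnorm K (e (a + s * c, b + s * d, h) - e (a + t * c, b + t * d, h)) < \<epsilon>"
    if h: "(a, b, h) \<in> I" and cd: "0 \<le> c" "0 \<le> d" and "\<epsilon> > 0"
      and U: "\<And>\<epsilon>. \<epsilon> > 0 \<Longrightarrow> \<exists>\<delta>>0. \<forall>r\<ge>0. r < \<delta> \<longrightarrow> hnorm H (U (r * c, r * d) h - h) < \<epsilon>"
    for a b c d h \<epsilon>
  proof -
    \<comment> \<open>The factor \<open>2 * hnorm H h\<close> is the one in
      \<open>dilation_orbit_dist\<close>; the added 1 keeps \<open>C\<close> positive when
      \<open>h = 0\<close>.\<close>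
    define C where "C = 2 * (hnorm H h + 1)"
    have hv: "h \<in> vectors H" "0 \<le> a" "0 \<le> b"
      using h by (simp_all add: I)
    have C: "C > 0" "2 * hnorm H h \<le> C"
      using hnorm_nonneg[OF hv(1)] by (simp_all add: C_def)
    then have "\<epsilon>\<^sup>2 / C > 0"
      using \<open>\<epsilon> > 0\<close> by simp
    then obtain \<delta> where \<delta>: "\<delta> > 0" "\<And>r. 0 \<le> r \<Longrightarrow> r < \<delta> \<Longrightarrow> hnorm H (U (r * c, r * d) h - h) < \<epsilon>\<^sup>2 / C"
      using U by blast
    define y where "y s = (a + s * c, b + s * d, h)" for s
    have yI: "y s \<in> I" if "0 \<le> s" for s
      using that hv cd by (simp add: y_def I)
    have less: "hnorm K (e (y t) - e (y s)) < \<epsilon>" if st: "0 \<le> s" "s \<le> t" "t - s < \<delta>" for s t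
    proof -
      define z w where "z = (a + s * c, b + s * d)" and "w = (a + t * c, b + t * d)"
      have zw: "z \<le> w"
        using st cd by (simp add: z_def w_def mult_right_mono)
      have wz: "w - z = ((t - s) * c, (t - s) * d)"
        by (simp add: z_def w_def algebra_simps)
      have t: "0 \<le> t"
        using st by simp
      have "(hnorm K (e (y t) - e (y s)))\<^sup>2 \<le> 2 * (hnorm H h * hnorm H (U (w - z) h - h))"
        by (rule dilation_orbit_dist[OF K.complex_inner_space_axioms k K.e_vectors[OF yI[OF st(1)]]
              K.e_vectors[OF yI[OF t]] zw hv(1)])
          (use yI[OF st(1)] yI[OF t] in \<open>simp_all add: inner y_def z_def w_def\<close>)
      also have "\<dots> \<le> C * hnorm H (U (w - z) h - h)"
        using mult_right_mono[OF C(2), of "hnorm H (U (w - z) h - h)"]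
          hnorm_nonneg[OF vectors_diff[OF U_diff_vectors[OF zw hv(1)] hv(1)]] by simp
      also have "\<dots> < C * (\<epsilon>\<^sup>2 / C)"
        using \<delta>(2)[of "t - s"] st C(1) unfolding wz by (intro mult_strict_left_mono) auto
      also have "\<dots> = \<epsilon>\<^sup>2"
        using C(1) by simp
      finally show ?thesis
        using \<open>\<epsilon> > 0\<close> by (meson less_eq_real_def power_less_imp_less_base)
    qed
    have "hnorm K (e (y s) - e (y t)) < \<epsilon>" if "0 \<le> s" "0 \<le> t" "\<bar>s - t\<bar> < \<delta>" for s t
    proof (cases "s \<le> t")
      case True
      then show ?thesis
        using less[of s t] that K.hnorm_minus_commute[OF K.e_vectors[OF yI] K.e_vectors[OF yI], of s t] by simp
    next
      case False
      then show ?thesis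
        using less[of t s] that by simp
    qed
    then show ?thesis
      using \<delta>(1) unfolding y_def by blast
  qed
  have shift1: "k ((a + s, b), h) ((a' + s, b'), h') = k ((a, b), h) ((a', b'), h')"
    and shift2: "k ((a, b + s), h) ((a', b' + s), h') = k ((a, b), h) ((a', b'), h')"
    if "h \<in> vectors H" "h' \<in> vectors H" for a b a' b' s h h'
    using shift_invariantD[OF inv, of "((a, b), h)" "((a', b'), h')" "(s, 0)"]
      shift_invariantD[OF inv, of "((a, b), h)" "((a', b'), h')" "(0, s)"] that
    by (simp_all add: shift_def)
  obtain V\<^sub>1 where V1: "isometry_semigroup K V\<^sub>1"
    and V1e: "\<And>s a b h. 0 \<le> s \<Longrightarrow> (a, b, h) \<in> I \<Longrightarrow> V\<^sub>1 s (e (a, b, h)) = e (a + s, b, h)"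
  proof -
    define \<sigma> :: "real \<Rightarrow> real \<times> real \<times> 'a \<Rightarrow> real \<times> real \<times> 'a" where "\<sigma> = (\<lambda>s (a, b, h). (a + s, b, h))"
    have "\<exists>V. isometry_semigroup K V \<and> (\<forall>s\<ge>0. \<forall>x\<in>I. V s (e x) = e (\<sigma> s x))"
    proof (rule K.isometry_semigroup_extension)
      show "\<sigma> s x \<in> I" if "0 \<le> s" "x \<in> I" for s x
        using that by (cases x) (simp add: \<sigma>_def I)
      show "cinner K (e (\<sigma> s x)) (e (\<sigma> s y)) = cinner K (e x) (e y)"
        if "0 \<le> s" "x \<in> I" "y \<in> I" for s x y
        using that by (cases x; cases y) (simp add: \<sigma>_def I inner shift1)
      show "\<sigma> 0 x = x" "\<sigma> (s + t) x = \<sigma> s (\<sigma> t x)" for s t x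
        by (simp_all add: \<sigma>_def case_prod_unfold)
      fix x and \<epsilon> :: real assume x: "x \<in> I" and "\<epsilon> > 0"
      obtain a b h where x_eq: "x = (a, b, h)"
        by (cases x)
      have "\<exists>\<delta>>0. \<forall>r\<ge>0. r < \<delta> \<longrightarrow> hnorm H (U (r * 1, r * 0) h - h) < \<epsilon>" if "\<epsilon> > 0" for \<epsilon>
        using continuous_semigroup_at_0[OF complex_inner_space_axioms sg(1) _ that, of h] x
        by (simp add: x_eq I U_def zero)
      from cont[of a b h 1 0, OF _ _ _ \<open>\<epsilon> > 0\<close> this] x
      show "\<exists>\<delta>>0. \<forall>s\<ge>0. \<forall>t\<ge>0. \<bar>s - t\<bar> < \<delta> \<longrightarrow> hnorm K (e (\<sigma> s x) - e (\<sigma> t x)) < \<epsilon>"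
        by (simp add: x_eq \<sigma>_def)
    qed
    then show ?thesis
      using that unfolding \<sigma>_def by fastforce
  qed
  obtain V\<^sub>2 where V2: "isometry_semigroup K V\<^sub>2"
    and V2e: "\<And>s a b h. 0 \<le> s \<Longrightarrow> (a, b, h) \<in> I \<Longrightarrow> V\<^sub>2 s (e (a, b, h)) = e (a, b + s, h)"
  proof -
    define \<sigma> :: "real \<Rightarrow> real \<times> real \<times> 'a \<Rightarrow> real \<times> real \<times> 'a" where "\<sigma> = (\<lambda>s (a, b, h). (a, b + s, h))"
    have "\<exists>V. isometry_semigroup K V \<and> (\<forall>s\<ge>0. \<forall>x\<in>I. V s (e x) = e (\<sigma> s x))"
    proof (rule K.isometry_semigroup_extension)
      show "\<sigma> s x \<in> I" if "0 \<le> s" "x \<in> I" for s x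
        using that by (cases x) (simp add: \<sigma>_def I)
      show "cinner K (e (\<sigma> s x)) (e (\<sigma> s y)) = cinner K (e x) (e y)"
        if "0 \<le> s" "x \<in> I" "y \<in> I" for s x y
        using that by (cases x; cases y) (simp add: \<sigma>_def I inner shift2)
      show "\<sigma> 0 x = x" "\<sigma> (s + t) x = \<sigma> s (\<sigma> t x)" for s t x
        by (simp_all add: \<sigma>_def case_prod_unfold)
      fix x and \<epsilon> :: real assume x: "x \<in> I" and "\<epsilon> > 0"
      obtain a b h where x_eq: "x = (a, b, h)"
        by (cases x)
      have "\<exists>\<delta>>0. \<forall>r\<ge>0. r < \<delta> \<longrightarrow> hnorm H (U (r * 0, r * 1) h - h) < \<epsilon>" if "\<epsilon> > 0" for \<epsilon>
      proof -
        \<comment> \<open>\<open>T\<^sub>1 0\<close> is the identity on the carrier only, so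
          membership of \<open>T\<^sub>2 r h\<close> has to be established first.\<close>
        have "T\<^sub>1 0 (T\<^sub>2 r h) = T\<^sub>2 r h" if "0 \<le> r" for r
          using sg(2) that x unfolding continuous_semigroup_def bounded_operator_def linear_between_def
          by (intro zero(1)) (auto simp: x_eq I)
        then show ?thesis
          using continuous_semigroup_at_0[OF complex_inner_space_axioms sg(2) _ that, of h] x
          by (simp add: x_eq I U_def)
      qed
      from cont[of a b h 0 1, OF _ _ _ \<open>\<epsilon> > 0\<close> this] x
      show "\<exists>\<delta>>0. \<forall>s\<ge>0. \<forall>t\<ge>0. \<bar>s - t\<bar> < \<delta> \<longrightarrow> hnorm K (e (\<sigma> s x) - e (\<sigma> t x)) < \<epsilon>"
        by (simp add: x_eq \<sigma>_def)
    qed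
    then show ?thesis
      using that unfolding \<sigma>_def by fastforce
  qed
  have iso: "isometry K (V\<^sub>1 s)" "isometry K (V\<^sub>2 s)" if "0 \<le> s" for s
    using V1 V2 that unfolding isometry_semigroup_def by blast+
  \<comment> \<open>\<open>H\<close> is identified with its copy over the origin, the least point of
    the quadrant. All other points lie above it, so their inner products with this copy are
    prescribed by \<open>U\<close>.\<close>
  define J where "J h = e (0, 0, h)" for h
  have J: "J h \<in> vectors K" if "h \<in> vectors H" for h
    using that by (auto simp: J_def I intro: K.e_vectors)
  have J_inner: "cinner K (J h) (J h') = cinner H h h'" if "h \<in> vectors H" "h' \<in> vectors H" for h h'
    using that by (simp add: J_def inner I dilates_same[OF k])
  have J_linear: "linear_between H K J"
    by (rule inner_preserving_linear[OF complex_inner_space_axioms K.complex_inner_space_axioms J J_inner])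
  have VVJ: "V\<^sub>1 s (V\<^sub>2 t (J h)) = e (s, t, h)" if "0 \<le> s" "0 \<le> t" "h \<in> vectors H" for s t h
    using that by (simp add: J_def V1e V2e I)
  show ?thesis
  proof (intro exI conjI)
    show "complex_hilbert_space K" "isometry_semigroup K V\<^sub>1" "isometry_semigroup K V\<^sub>2"
      by fact+
    show "isometric_embedding H K J"
      unfolding isometric_embedding_def using J_linear J_inner by blast
    show "commuting_semigroups K V\<^sub>1 V\<^sub>2"
      unfolding commuting_semigroups_def
    proof (intro allI impI ballI)
      fix s t :: real and f assume st: "0 \<le> s" "0 \<le> t" and f: "f \<in> vectors K"
      show "V\<^sub>1 s (V\<^sub>2 t f) = V\<^sub>2 t (V\<^sub>1 s f)"
      proof (rule K.isometry_eqI[OF isometry_compose[OF iso(1)[OF st(1)] iso(2)[OF st(2)]]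
            isometry_compose[OF iso(2)[OF st(2)] iso(1)[OF st(1)]] _ f])
        fix x assume "x \<in> I"
        then show "V\<^sub>1 s (V\<^sub>2 t (e x)) = V\<^sub>2 t (V\<^sub>1 s (e x))"
          using st by (cases x) (simp add: V1e V2e I)
      qed
    qed
    show "\<forall>s\<ge>0. \<forall>t\<ge>0. \<forall>h\<in>vectors H. J (T\<^sub>1 s (T\<^sub>2 t h)) =
        orthogonal_projection K (J ` vectors H) (V\<^sub>1 s (V\<^sub>2 t (J h)))"
    proof (intro allI impI ballI)
      fix s t :: real and h assume st: "0 \<le> s" "0 \<le> t" and h: "h \<in> vectors H"
      have U: "U (s, t) h = T\<^sub>1 s (T\<^sub>2 t h)" "U (s, t) h \<in> vectors H"
        using st h U_vectors[of "(s, t)" h] by (simp_all add: U_def less_eq_prod_def)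
      have sI: "(s, t, h) \<in> I"
        using st h by (simp add: I)
      have "orthogonal_projection K (J ` vectors H) (e (s, t, h)) = J (U (s, t) h)"
      proof (rule K.orthogonal_projection_eqI)
        show "K.subspace (J ` vectors H)"
        proof (rule K.subspaceI)
          have "J (cscale H 0 0) = cscale K 0 (J 0)"
            using J_linear vectors_zero unfolding linear_between_def by blast
          then have "J 0 = 0"
            by simp
          then show "0 \<in> J ` vectors H"
            using vectors_zero by force
        next
          fix x y assume "x \<in> J ` vectors H" "y \<in> J ` vectors H"
          then obtain u v where "u \<in> vectors H" "v \<in> vectors H" "x = J u" "y = J v"
            by blast
          then have "x + y = J (u + v)" "u + v \<in> vectors H"
            using J_linear vectors_add unfolding linear_between_def by simp_all
          then show "x + y \<in> J ` vectors H"
            by blast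
        next
          fix c x assume "x \<in> J ` vectors H"
          then obtain u where "u \<in> vectors H" "x = J u"
            by blast
          then have "cscale K c x = J (cscale H c u)" "cscale H c u \<in> vectors H"
            using J_linear vectors_scale unfolding linear_between_def by simp_all
          then show "cscale K c x \<in> J ` vectors H"
            by blast
        qed
        show "J ` vectors H \<subseteq> vectors K"
          using J by blast
        show "e (s, t, h) \<in> vectors K"
          by (rule K.e_vectors[OF sI])
        show "J (U (s, t) h) \<in> J ` vectors H"
          using U(2) by blast
        \<comment> \<open>The prescribed value at \<open>(s, t) \<ge> (0, 0)\<close> says that
          \<open>e (s, t, h)\<close> and \<open>J (U (s, t) h)\<close> have the same inner products
          with all vectors over the origin.\<close>
        show "\<forall>z\<in>J ` vectors H. cinner K (e (s, t, h) - J (U (s, t) h)) z = 0"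
        proof
          fix z assume "z \<in> J ` vectors H"
          then obtain h' where h': "h' \<in> vectors H" "z = J h'"
            by blast
          have "cinner K (e (s, t, h)) (J h') = cinner H (U (s, t) h) h'"
            using st h h' sI dilates_ge[OF k, of "(s, t)" "(0, 0)" h h']
            by (simp add: J_def inner I less_eq_prod_def)
          then show "cinner K (e (s, t, h) - J (U (s, t) h)) z = 0"
            using h' U(2) J K.e_vectors[OF sI] J_inner[OF U(2) h'(1)] by (simp add: K.cinner_diff_left)
        qed
      qed
      then show "J (T\<^sub>1 s (T\<^sub>2 t h)) = orthogonal_projection K (J ` vectors H) (V\<^sub>1 s (V\<^sub>2 t (J h)))"
        using VVJ[OF st h] U(1) by simp
    qed
    \<comment> \<open>Minimality: the orbit of the copy of \<open>H\<close> is precisely the family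
      of kernel vectors, which is total by construction.\<close>
    have "{V\<^sub>1 s (V\<^sub>2 t (J h)) | s t h. 0 \<le> s \<and> 0 \<le> t \<and> h \<in> vectors H} = e ` I"
    proof (intro equalityI subsetI)
      fix f assume "f \<in> {V\<^sub>1 s (V\<^sub>2 t (J h)) | s t h. 0 \<le> s \<and> 0 \<le> t \<and> h \<in> vectors H}"
      then show "f \<in> e ` I"
        using VVJ I by (auto intro!: imageI)
    next
      fix f assume "f \<in> e ` I"
      then obtain s t h where "0 \<le> s" "0 \<le> t" "h \<in> vectors H" "f = e (s, t, h)"
        using I by (auto simp: image_iff)
      then show "f \<in> {V\<^sub>1 s (V\<^sub>2 t (J h)) | s t h. 0 \<le> s \<and> 0 \<le> t \<and> h \<in> vectors H}"
        using VVJ[of s t h] by (intro CollectI exI[of _ s] exI[of _ t] exI[of _ h]) simp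
    qed
    then show "vectors K = closed_linear_span K {V\<^sub>1 s (V\<^sub>2 t (J h)) | s t h. 0 \<le> s \<and> 0 \<le> t \<and> h \<in> vectors H}"
      using K.closed_linear_span_total by simp
  qed
qed

end
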